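(* Let $G$ be a locally compact group. Then: (a) if $G$ is the direct product of a group with the fixed-point property for cones and a group of subexponential growth, then $G$ has the fixed-point property for cones; (b) if $G$ is an extension of a compact group by a group with the fixed-point property for cones, i.e. $G$ has a compact normal subgroup $N$ such that $G/N$ has the fixed-point property for cones, then $G$ has the fixed-point property for cones.
   Context: Locally compact groups are Hausdorff. A locally compact group $K$ with left Haar measure $m_K$ is of subexponential growth if $\lim_n m_K(A^n)^{1/n}=1$ for every compact neighborhood $A\subset K$ of the identity. Direct products carry the product topology, quotients the quotient topology. All vector spaces are real and all locally convex topologies are Hausdorff; $E'$ denotes the topological dual of $E$. A cone $C$ in a vector space is a non-empty subset closed under addition and under multiplication by non-negative scalars (hence convex); it is proper if $C\cap(-C)=\{0\}$. Let $C$ be a cone in a locally convex vector space $E$. A representation of a topological group $G$ on $C$ is a linear representation $\pi$ of $G$ on $E$ (each $\pi(g)$ continuous, so that the adjoint $\pi^*(g)\lambda=\lambda\circ\pi(g^{-1})$ acts on $E'$) such that $\pi(g)C\subset C$ for all $g\in G$. - It is locally bounded right-uniformly continuous if there is a non-zero $x_0\in C$ whose orbit is a bounded subset of $E$ (absorbed by every neighborhood of the origin) and such that for every neighborhood $U\subset E$ of the origin there is a neighborhood $V\subset G$ of the identity with $\pi(ag)x_0-\pi(g)x_0\in U$ for all $a\in V$, $g\in G$. - It is of cobounded type if there is $\lambda\in E'$ such that for every $\lambda'\in E'$ there are $g_1,\dots,g_n\in G$ with $\pm\lambda'\le\sum_{j=1}^n\pi^*(g_j)\lambda$, where $\mu\le\nu$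 in $E'$ means $\mu(c)\le\nu(c)$ for all $c\in C$. $G$ has the fixed-point property for cones if every representation of $G$ on a non-empty weakly complete (i.e. complete for the weak topology $\sigma(E,E')$) proper convex cone $C$ in a locally convex vector space $E$ which is locally bounded right-uniformly continuous and of cobounded type has a non-zero fixed point in $C$. *)

theory Defs
  imports
    "HOL-Analysis.Analysis"
    "HOL-Algebra.Coset"
    "HOL-Library.Function_Algebras"
begin

section \<open>Topological groups\<close>

definition topological_group :: "('g, 'b) monoid_scheme \<Rightarrow> 'g topology \<Rightarrow> bool" where
  "topological_group G T \<longleftrightarrow>
     group G \<and> topspace T = carrier G \<and>
     continuous_map (prod_topology T T) T (\<lambda>(x, y). x \<otimes>\<^bsub>G\<^esub> y) \<and>
     continuous_map T T (\<lambda>x. inv\<^bsub>G\<^esub> x)"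

definition locally_compact_group :: "('g, 'b) monoid_scheme \<Rightarrow> 'g topology \<Rightarrow> bool" where
  "locally_compact_group G T \<longleftrightarrow>
     topological_group G T \<and> Hausdorff_space T \<and> locally_compact_space T"

definition quotient_topology :: "'a topology \<Rightarrow> ('a \<Rightarrow> 'b) \<Rightarrow> 'b topology" where
  "quotient_topology T q =
     topology (\<lambda>V. V \<subseteq> q ` topspace T \<and> openin T {x \<in> topspace T. q x \<in> V})"

lemma openin_quotient_topology:
  "openin (quotient_topology T q) V \<longleftrightarrow>
     V \<subseteq> q ` topspace T \<and> openin T {x \<in> topspace T. q x \<in> V}"
proof -
  have "istopology (\<lambda>V. V \<subseteq> q ` topspace T \<and> openin T {x \<in> topspace T. q x \<in> V})"
    unfolding istopology_def
  proof (rule conjI; clarify)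
    fix A B
    assume "openin T {x \<in> topspace T. q x \<in> A}" "openin T {x \<in> topspace T. q x \<in> B}"
    moreover have "{x \<in> topspace T. q x \<in> A \<inter> B} =
        {x \<in> topspace T. q x \<in> A} \<inter> {x \<in> topspace T. q x \<in> B}"
      by auto
    ultimately have "openin T {x \<in> topspace T. q x \<in> A \<inter> B}"
      by (simp only: openin_Int)
    moreover assume "A \<subseteq> q ` topspace T"
    ultimately show "A \<inter> B \<subseteq> q ` topspace T \<and> openin T {x \<in> topspace T. q x \<in> A \<inter> B}"
      by blast
  next
    fix \<K>
    assume *: "\<forall>K\<in>\<K>. K \<subseteq> q ` topspace T \<and> openin T {x \<in> topspace T. q x \<in> K}"
    have "{x \<in> topspace T. q x \<in> \<Union>\<K>} = (\<Union>K\<in>\<K>. {x \<in> topspace T. q x \<in> K})"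
      by auto
    moreover have "openin T (\<Union>K\<in>\<K>. {x \<in> topspace T. q x \<in> K})"
      using * by (intro openin_Union) auto
    ultimately show "\<Union>\<K> \<subseteq> q ` topspace T \<and> openin T {x \<in> topspace T. q x \<in> \<Union>\<K>}"
      using * by (metis Union_least)
  qed
  then show ?thesis
    by (simp add: quotient_topology_def topology_inverse')
qed

lemma topspace_quotient_topology [simp]:
  "topspace (quotient_topology T q) = q ` topspace T"
proof
  show "topspace (quotient_topology T q) \<subseteq> q ` topspace T"
    using openin_quotient_topology openin_topspace by metis
  have "{x \<in> topspace T. q x \<in> q ` topspace T} = topspace T"
    by auto
  then have "openin (quotient_topology T q) (q ` topspace T)"
    by (simp add: openin_quotient_topology)
  then show "q ` topspace T \<subseteq> topspace (quotient_topology T q)"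
    by (rule openin_subset)
qed

lemma quotient_map_quotient_topology: "quotient_map T (quotient_topology T q) q"
  by (auto simp: quotient_map_def openin_quotient_topology)

definition coset_topology :: "('g, 'b) monoid_scheme \<Rightarrow> 'g topology \<Rightarrow> 'g set \<Rightarrow> 'g set topology" where
  "coset_topology G T N = quotient_topology T (\<lambda>x. N #>\<^bsub>G\<^esub> x)"


section \<open>Haar measure and growth\<close>

text \<open>A left Haar measure is a non-zero left-invariant Radon measure on the Borel sets; the Radon
  property is taken in the form: finite on compact sets, outer regular on Borel sets, inner regular
  on open sets.\<close>

definition left_haar_measure :: "('g, 'b) monoid_scheme \<Rightarrow> 'g topology \<Rightarrow> 'g measure \<Rightarrow> bool" where
  "left_haar_measure G T m \<longleftrightarrow>
     space m = topspace T \<and>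
     sets m = sigma_sets (topspace T) {U. openin T U} \<and>
     emeasure m (space m) \<noteq> 0 \<and>
     (\<forall>K. compactin T K \<longrightarrow> emeasure m K < \<infinity>) \<and>
     (\<forall>B \<in> sets m. emeasure m B = (INF U \<in> {U. openin T U \<and> B \<subseteq> U}. emeasure m U)) \<and>
     (\<forall>U. openin T U \<longrightarrow> emeasure m U = (SUP K \<in> {K. compactin T K \<and> K \<subseteq> U}. emeasure m K)) \<and>
     (\<forall>g \<in> carrier G. \<forall>B \<in> sets m. emeasure m (g <#\<^bsub>G\<^esub> B) = emeasure m B)"

primrec set_power :: "('g, 'b) monoid_scheme \<Rightarrow> 'g set \<Rightarrow> nat \<Rightarrow> 'g set" where
  "set_power G A 0 = {\<one>\<^bsub>G\<^esub>}"
| "set_power G A (Suc n) = set_power G A n <#>\<^bsub>G\<^esub> A"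

text \<open>By existence and uniqueness of Haar measure up to a positive factor, which does not affect
  the limit, \<^emph>\<open>some\<close> and \<^emph>\<open>every\<close> left Haar measure are interchangeable below.\<close>

definition subexponential_growth :: "('g, 'b) monoid_scheme \<Rightarrow> 'g topology \<Rightarrow> bool" where
  "subexponential_growth G T \<longleftrightarrow>
     (\<exists>m. left_haar_measure G T m \<and>
       (\<forall>A. compactin T A \<and> (\<exists>U. openin T U \<and> \<one>\<^bsub>G\<^esub> \<in> U \<and> U \<subseteq> A) \<longrightarrow>
         (\<lambda>n. root n (measure m (set_power G A n))) \<longlonglongrightarrow> 1))"


section \<open>Locally convex spaces and cones\<close>

text \<open>The topology of a locally convex space \<open>E\<close> is a value \<open>T\<close> of type \<^typ>\<open>'e topology\<close> on
  a type \<^typ>\<open>'e\<close> of class \<^class>\<open>real_vector\<close>, so that one vector space may carry many topologies.\<close>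

definition locally_convex_space :: "'e::real_vector topology \<Rightarrow> bool" where
  "locally_convex_space T \<longleftrightarrow>
     topspace T = UNIV \<and> Hausdorff_space T \<and>
     continuous_map (prod_topology T T) T (\<lambda>(x, y). x + y) \<and>
     continuous_map (prod_topology euclideanreal T) T (\<lambda>(r, x). r *\<^sub>R x) \<and>
     (\<forall>U. openin T U \<and> 0 \<in> U \<longrightarrow> (\<exists>V. openin T V \<and> 0 \<in> V \<and> convex V \<and> V \<subseteq> U))"

definition topological_dual :: "'e::real_vector topology \<Rightarrow> ('e \<Rightarrow> real) set" where
  "topological_dual T = {l. linear l \<and> continuous_map T euclideanreal l}"

definition weak_topology :: "'e::real_vector topology \<Rightarrow> 'e topology" where
  "weak_topology T =
     topology_generated_by {l -` S | l S. l \<in> topological_dual T \<and> open S}"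

text \<open>Completeness of a subset of a topological vector space, with respect to the translation
  uniformity.\<close>

definition cauchy_filter_on :: "'e::real_vector topology \<Rightarrow> 'e filter \<Rightarrow> bool" where
  "cauchy_filter_on T F \<longleftrightarrow>
     (\<forall>U. openin T U \<and> 0 \<in> U \<longrightarrow> (\<forall>\<^sub>F (x, y) in F \<times>\<^sub>F F. x - y \<in> U))"

definition complete_subset :: "'e::real_vector topology \<Rightarrow> 'e set \<Rightarrow> bool" where
  "complete_subset T C \<longleftrightarrow>
     (\<forall>F. F \<noteq> bot \<and> F \<le> principal C \<and> cauchy_filter_on T F \<longrightarrow>
       (\<exists>c \<in> C. limitin T (\<lambda>x. x) c F))"

definition weakly_complete :: "'e::real_vector topology \<Rightarrow> 'e set \<Rightarrow> bool" where
  "weakly_complete T C \<longleftrightarrow> complete_subset (weak_topology T) C"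

definition proper_cone :: "'e::real_vector set \<Rightarrow> bool" where
  "proper_cone C \<longleftrightarrow> convex_cone C \<and> C \<inter> uminus ` C = {0}"

definition bounded_subset :: "'e::real_vector topology \<Rightarrow> 'e set \<Rightarrow> bool" where
  "bounded_subset T B \<longleftrightarrow>
     (\<forall>U. openin T U \<and> 0 \<in> U \<longrightarrow> (\<exists>s>0. \<forall>t\<ge>s. B \<subseteq> (\<lambda>x. t *\<^sub>R x) ` U))"

definition dual_le :: "'e set \<Rightarrow> ('e \<Rightarrow> real) \<Rightarrow> ('e \<Rightarrow> real) \<Rightarrow> bool" where
  "dual_le C \<mu> \<nu> \<longleftrightarrow> (\<forall>c \<in> C. \<mu> c \<le> \<nu> c)"


section \<open>Representations on cones\<close>

definition cone_representation ::
  "('g, 'b) monoid_scheme \<Rightarrow> 'e::real_vector topology \<Rightarrow> 'e set \<Rightarrow> ('g \<Rightarrow> 'e \<Rightarrow> 'e) \<Rightarrow> bool" where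
  "cone_representation G T C \<pi> \<longleftrightarrow>
     (\<forall>g \<in> carrier G. linear (\<pi> g) \<and> continuous_map T T (\<pi> g) \<and> \<pi> g ` C \<subseteq> C) \<and>
     (\<forall>x. \<pi> \<one>\<^bsub>G\<^esub> x = x) \<and>
     (\<forall>g \<in> carrier G. \<forall>h \<in> carrier G. \<forall>x. \<pi> (g \<otimes>\<^bsub>G\<^esub> h) x = \<pi> g (\<pi> h x))"

definition adjoint_rep ::
  "('g, 'b) monoid_scheme \<Rightarrow> ('g \<Rightarrow> 'e \<Rightarrow> 'e) \<Rightarrow> 'g \<Rightarrow> ('e \<Rightarrow> real) \<Rightarrow> 'e \<Rightarrow> real" where
  "adjoint_rep G \<pi> g l = l \<circ> \<pi> (inv\<^bsub>G\<^esub> g)"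

definition locally_bounded_ruc ::
  "('g, 'b) monoid_scheme \<Rightarrow> 'g topology \<Rightarrow> 'e::real_vector topology \<Rightarrow> 'e set \<Rightarrow>
     ('g \<Rightarrow> 'e \<Rightarrow> 'e) \<Rightarrow> bool" where
  "locally_bounded_ruc G TG T C \<pi> \<longleftrightarrow>
     (\<exists>x\<^sub>0 \<in> C. x\<^sub>0 \<noteq> 0 \<and>
       bounded_subset T ((\<lambda>g. \<pi> g x\<^sub>0) ` carrier G) \<and>
       (\<forall>U. openin T U \<and> 0 \<in> U \<longrightarrow>
         (\<exists>V. openin TG V \<and> \<one>\<^bsub>G\<^esub> \<in> V \<and>
           (\<forall>a \<in> V. \<forall>g \<in> carrier G. \<pi> (a \<otimes>\<^bsub>G\<^esub> g) x\<^sub>0 - \<pi> g x\<^sub>0 \<in> U))))"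

definition cobounded_type ::
  "('g, 'b) monoid_scheme \<Rightarrow> 'e::real_vector topology \<Rightarrow> 'e set \<Rightarrow> ('g \<Rightarrow> 'e \<Rightarrow> 'e) \<Rightarrow> bool" where
  "cobounded_type G T C \<pi> \<longleftrightarrow>
     (\<exists>l \<in> topological_dual T. \<forall>l' \<in> topological_dual T.
       \<exists>gs. set gs \<subseteq> carrier G \<and>
         dual_le C l' (\<Sum>g\<leftarrow>gs. adjoint_rep G \<pi> g l) \<and>
         dual_le C (- l') (\<Sum>g\<leftarrow>gs. adjoint_rep G \<pi> g l))"


section \<open>The fixed-point property for cones\<close>

text \<open>HOL cannot quantify over all types inside a definition, so the type \<^typ>\<open>'e\<close> carrying the
  locally convex space is a parameter. The property in the usual sense is the conjunction over all
  types \<^typ>\<open>'e\<close>.\<close>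

definition fixed_point_property_for_cones ::
  "'e::real_vector itself \<Rightarrow> ('g, 'b) monoid_scheme \<Rightarrow> 'g topology \<Rightarrow> bool" where
  "fixed_point_property_for_cones _ G TG \<longleftrightarrow>
     (\<forall>(T :: 'e topology) C \<pi>.
       locally_convex_space T \<and> proper_cone C \<and> weakly_complete T C \<and>
       cone_representation G T C \<pi> \<and> locally_bounded_ruc G TG T C \<pi> \<and> cobounded_type G T C \<pi> \<longrightarrow>
       (\<exists>x \<in> C. x \<noteq> 0 \<and> (\<forall>g \<in> carrier G. \<pi> g x = x)))"

text \<open>For a group with elements in \<^typ>\<open>'g\<close>, the single vector space
  \<^typ>\<open>('g \<Rightarrow> real) \<Rightarrow> real\<close> suffices to test the property. With the product topology it
  contains, for every \<open>f\<close>, the weakly complete cone of positive functionals on the space of bounded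
  right-uniformly continuous functions dominated by finite sums of translates of \<open>|f|\<close> (extended by
  0 to all other functions). Given a representation on a cone in any other space, take for \<open>f\<close> the
  matrix coefficient of the vector \<open>x\<^sub>0\<close> and the functional \<open>\<lambda>\<close> of the definitions above: an invariant
  positive functional, applied to the coefficients of \<open>x\<^sub>0\<close>, is a weak limit of points of the cone
  and hence gives a fixed point there. So the property for this one type amounts to the property
  for all types; assuming it only for this type is formally the weaker hypothesis.\<close>

instantiation "fun" :: (type, real_vector) real_vector
begin

definition scaleR_fun :: "real \<Rightarrow> ('a \<Rightarrow> 'b) \<Rightarrow> 'a \<Rightarrow> 'b" where
  "scaleR_fun r f = (\<lambda>x. r *\<^sub>R f x)"

instance
  by standard (simp_all add: scaleR_fun_def fun_eq_iff scaleR_add_right scaleR_add_left)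

end

end

theory Submission
  imports Defs
begin

text \<open>The fixed-point property is equivalent to the following: every non-zero bounded right-uniformly
  continuous function \<open>f \<ge> 0\<close> admits a left-invariant positive functional \<open>J\<close>, normalised by
  \<open>J f = 1\<close>, on the functions dominated by finite sums of left translates of \<open>f\<close>. The property yields
  \<open>J\<close> as a fixed point in the cone of all positive functionals on that space. Conversely, \<open>J\<close> applied
  to the matrix coefficients of \<open>x\<^sub>0\<close> is a functional on \<open>E'\<close> that is non-negative on the dual cone,
  hence evaluation at a point of the weakly complete cone \<open>C\<close>, and this point is fixed.

  For an extension by a compact group \<open>N\<close>, compose \<open>J\<close> on \<open>G/N\<close> with averaging over the cosets of \<open>N\<close>.
  For a product with a group \<open>S\<close> of subexponential growth, integrate over \<open>S\<close> against the integrable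
  weight \<open>\<Sum>\<^sub>n r\<^sup>n 1\<^bsub>A\<^sup>n\<^esub>\<close>, which elements of \<open>A\<close> translate up to a factor \<open>1/r\<close>, apply \<open>J\<close> on the other
  factor, and let \<open>A\<close> grow and \<open>r\<close> tend to \<open>1\<close>; compactness provides a limit.\<close>

subsection \<open>Functional analysis\<close>

text \<open>An invariant mean on all bounded functions may vanish on a given \<open>f\<close>; the
  normalisation \<open>J f = 1\<close> rules this out, with \<open>f\<close> taking the place of the
  constant 1 and domination by translates of \<open>f\<close> that of boundedness. Cobounded type
  provides one coefficient of \<open>x0\<close> that dominates all others in this sense. In a
  product, invariance fails at every stage of the limit: for \<open>\<phi> \<ge> 0\<close> and an
  element g with S-component in A, only r J(L_g \<phi>) \<le> J \<phi> holds. As r tends to 1 this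
  becomes J(L_g \<phi>) \<le> J \<phi> for all g, and the inverse of g supplies the converse. A
  second obstacle is that domination involves translates by arbitrary elements of S, while estimates
  are available only when these lie in A. The approximating functionals are therefore required to
  behave well only on functions dominated through elements of a finite subset of S, and this subset
  grows along the limit.\<close>

lemma compact_bounded_functions:
  fixes b :: "'a \<Rightarrow> real"
  shows "compact {J. \<forall>x. \<bar>J x\<bar> \<le> b x}"
proof -
  have "compactin (product_topology (\<lambda>_::'a. euclideanreal) UNIV) (PiE UNIV (\<lambda>x. {- b x..b x}))"
    unfolding compactin_PiE by simp
  moreover have "PiE UNIV (\<lambda>x. {- b x..b x}) = {J. \<forall>x. \<bar>J x\<bar> \<le> b x}"
    by (simp add: abs_le_iff PiE_def extensional_def Pi_def set_eq_iff) (metis minus_le_iff)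
  ultimately show ?thesis
    by (simp add: euclidean_product_topology)
qed

text \<open>By compactness it is enough to meet finitely many of the sets at once, and directedness
  puts a single \<open>Z k\<close> inside any finite intersection. Serves twice: to turn almost
  separating vectors into a separating one, and to pass to the limit of almost invariant
  functionals.\<close>

lemma directed_bounded_functions_Inter:
  fixes Z :: "'i \<Rightarrow> ('a \<Rightarrow> real) set" and b :: "'a \<Rightarrow> real"
  assumes "I \<noteq> {}"
    and closed: "\<And>i. i \<in> I \<Longrightarrow> closed (Z i)"
    and ne: "\<And>i. i \<in> I \<Longrightarrow> Z i \<noteq> {}"
    and bd: "\<And>i J x. i \<in> I \<Longrightarrow> J \<in> Z i \<Longrightarrow> \<bar>J x\<bar> \<le> b x"
    and dir: "\<And>i j. i \<in> I \<Longrightarrow> j \<in> I \<Longrightarrow> \<exists>k\<in>I. Z k \<subseteq> Z i \<inter> Z j"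
  shows "\<exists>J. \<forall>i\<in>I. J \<in> Z i"
proof -
  let ?K = "{J. \<forall>x. \<bar>J x\<bar> \<le> b x}"
  have *: "\<exists>k\<in>I. Z k \<subseteq> (\<Inter>i\<in>F. Z i)" if "finite F" "F \<subseteq> I" for F
    using that
  proof induction
    case empty
    then show ?case using \<open>I \<noteq> {}\<close> by auto
  next
    case (insert i F)
    then obtain k where "k \<in> I" "Z k \<subseteq> (\<Inter>i\<in>F. Z i)" by auto
    moreover obtain k' where "k' \<in> I" "Z k' \<subseteq> Z i \<inter> Z k"
      using dir[of i k] insert.prems \<open>k \<in> I\<close> by auto
    ultimately show ?case by (intro bexI[of _ k']) auto
  qed
  have "?K \<inter> (\<Inter>i\<in>I. Z i) \<noteq> {}"
  proof (rule compact_imp_fip_image[OF compact_bounded_functions])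
    fix F assume "finite F" "F \<subseteq> I"
    then obtain k where k: "k \<in> I" "Z k \<subseteq> (\<Inter>i\<in>F. Z i)" using *[of F] by auto
    then obtain J where "J \<in> Z k" using ne[of k] by auto
    with k bd[of k J] have "J \<in> ?K \<inter> (\<Inter>i\<in>F. Z i)" by blast
    then show "?K \<inter> (\<Inter>i\<in>F. Z i) \<noteq> {}" by blast
  qed (rule closed)
  then show ?thesis by auto
qed

section \<open>The Hahn-Banach theorem for sublinear functionals\<close>

definition sublinear :: "('e::real_vector \<Rightarrow> real) \<Rightarrow> bool" where
  "sublinear p \<longleftrightarrow>
     (\<forall>x y. p (x + y) \<le> p x + p y) \<and> (\<forall>t>0. \<forall>x. p (t *\<^sub>R x) \<le> t * p x) \<and> p 0 = 0"

text \<open>The inequality for the factor 1/t, applied at t x, reverses the one for t. So the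
  definition may ask for one inequality only, which is easy to check for infima.\<close>

lemma sublinear_scale:
  assumes "sublinear p" "t > 0"
  shows "p (t *\<^sub>R x) = t * p x"
proof (rule antisym)
  have "p ((1/t) *\<^sub>R (t *\<^sub>R x)) \<le> (1/t) * p (t *\<^sub>R x)"
    using assms unfolding sublinear_def by (metis zero_less_divide_1_iff)
  with assms(2) show "t * p x \<le> p (t *\<^sub>R x)" by (simp add: field_simps)
qed (use assms in \<open>auto simp: sublinear_def\<close>)

lemma sublinear_minus: "sublinear p \<Longrightarrow> - p (- x) \<le> p x"
proof -
  assume "sublinear p"
  then have "p (x + - x) \<le> p x + p (- x)" "p 0 = 0"
    unfolding sublinear_def by blast+
  then show ?thesis by simp
qed

text \<open>The parameter t = 0 shows that the result lies below \<open>p\<close>; t = 1 at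
  \<open>- y\<close> gives at most \<open>- p y\<close>. This is the usual lowering of
  \<open>p\<close> that forces linearity along \<open>y\<close>.\<close>

definition sublinear_descent :: "'e \<Rightarrow> ('e::real_vector \<Rightarrow> real) \<Rightarrow> 'e \<Rightarrow> real" where
  "sublinear_descent y p x = (INF t\<in>{0..}. p (x + t *\<^sub>R y) - t * p y)"

lemma sublinear_descent_le:
  assumes "sublinear p" "t \<ge> 0"
  shows "sublinear_descent y p x \<le> p (x + t *\<^sub>R y) - t * p y"
proof -
  \<comment> \<open>Subadditivity applied to s y = (x + s y) + (- x) bounds the family below;
    without a bound the infimum would carry no information.\<close>
  have "- p (- x) \<le> p (x + s *\<^sub>R y) - s * p y" if "s \<ge> 0" for s
  proof -
    have "s * p y = p (s *\<^sub>R y)"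
      using that sublinear_scale[OF assms(1), of s y] assms(1)
      by (cases "s = 0") (auto simp: sublinear_def)
    moreover have "p ((x + s *\<^sub>R y) + - x) \<le> p (x + s *\<^sub>R y) + p (- x)"
      using assms(1) unfolding sublinear_def by blast
    ultimately show ?thesis by simp
  qed
  then have "bdd_below ((\<lambda>t. p (x + t *\<^sub>R y) - t * p y) ` {0..})"
    by (intro bdd_belowI2[of _ "- p (- x)"]) auto
  then show ?thesis
    unfolding sublinear_descent_def using assms(2) by (intro cINF_lower) auto
qed

lemma sublinear_descent_less:
  assumes "sublinear_descent y p x < c"
  shows "\<exists>t\<ge>0. p (x + t *\<^sub>R y) - t * p y < c"
proof (rule ccontr)
  assume "\<not> ?thesis"
  then have "c \<le> sublinear_descent y p x"
    unfolding sublinear_descent_def by (intro cINF_greatest) auto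
  with assms show False by simp
qed

lemma sublinear_sublinear_descent:
  assumes p: "sublinear p"
  shows "sublinear (sublinear_descent y p)"
proof -
  let ?q = "sublinear_descent y p"
  have p_add: "p (a + b) \<le> p a + p b" for a b
    using p by (simp add: sublinear_def)
  have "?q (a + b) \<le> ?q a + ?q b" for a b
  proof (rule field_le_epsilon)
    fix e :: real assume "e > 0"
    then obtain s t where st: "s \<ge> 0" "p (a + s *\<^sub>R y) - s * p y < ?q a + e/2"
        "t \<ge> 0" "p (b + t *\<^sub>R y) - t * p y < ?q b + e/2"
      using sublinear_descent_less[of y p a "?q a + e/2"] sublinear_descent_less[of y p b "?q b + e/2"]
      by auto
    have "?q (a + b) \<le> p (a + b + (s + t) *\<^sub>R y) - (s + t) * p y"
      using st by (intro sublinear_descent_le[OF p]) auto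
    also have "a + b + (s + t) *\<^sub>R y = (a + s *\<^sub>R y) + (b + t *\<^sub>R y)"
      by (simp add: scaleR_left_distrib)
    finally show "?q (a + b) \<le> ?q a + ?q b + e"
      using p_add[of "a + s *\<^sub>R y" "b + t *\<^sub>R y"] st by (simp add: algebra_simps)
  qed
  moreover have "?q (c *\<^sub>R a) \<le> c * ?q a" if "c > 0" for c a
  proof (rule field_le_epsilon)
    fix e :: real assume "e > 0"
    with that have "e/c > 0" by simp
    then obtain s where s: "s \<ge> 0" "p (a + s *\<^sub>R y) - s * p y < ?q a + e/c"
      using sublinear_descent_less[of y p a "?q a + e/c"] by auto
    have "?q (c *\<^sub>R a) \<le> p (c *\<^sub>R a + (c * s) *\<^sub>R y) - (c * s) * p y"
      using s that by (intro sublinear_descent_le[OF p]) auto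
    also have "c *\<^sub>R a + (c * s) *\<^sub>R y = c *\<^sub>R (a + s *\<^sub>R y)"
      by (simp add: scaleR_right_distrib)
    also have "p \<dots> = c * p (a + s *\<^sub>R y)"
      by (rule sublinear_scale[OF p that])
    finally have "?q (c *\<^sub>R a) \<le> c * (p (a + s *\<^sub>R y) - s * p y)"
      by (simp add: algebra_simps)
    also have "\<dots> \<le> c * (?q a + e/c)"
      using s that by (intro mult_left_mono) auto
    finally show "?q (c *\<^sub>R a) \<le> c * ?q a + e"
      using that by (simp add: algebra_simps)
  qed
  moreover have "?q 0 = 0"
  proof (rule antisym)
    show "?q 0 \<le> 0"
      using sublinear_descent_le[OF p, of 0 y 0] p by (simp add: sublinear_def)
    have "p (t *\<^sub>R y) = t * p y" if "t \<ge> 0" for t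
      using that sublinear_scale[OF p, of t y] p by (cases "t = 0") (auto simp: sublinear_def)
    then show "0 \<le> ?q 0"
      unfolding sublinear_descent_def by (intro cINF_greatest) auto
  qed
  ultimately show ?thesis unfolding sublinear_def by blast
qed

text \<open>A minimal sublinear functional is linear, because \<^const>\<open>sublinear_descent\<close> cannot lower it.\<close>

lemma sublinear_dominates_linear:
  assumes p: "sublinear p"
  shows "\<exists>l. linear l \<and> (\<forall>x. l x \<le> p x)"
proof -
  define A where "A = {q. sublinear q \<and> q \<le> p}"
  \<comment> \<open>The order is reversed, so that the maximal element given by Zorn is a minimal
    sublinear functional.\<close>
  let ?P = "\<lambda>q q'. q' \<le> (q :: 'a \<Rightarrow> real)"
  have "\<exists>m\<in>A. \<forall>a\<in>A. ?P m a \<longrightarrow> a = m"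
  proof (rule predicate_Zorn)
    show "partial_order_on A (relation_of ?P A)"
      by (rule partial_order_on_relation_ofI) auto
    fix C assume C: "C \<in> Chains (relation_of ?P A)"
    show "\<exists>u\<in>A. \<forall>a\<in>C. ?P a u"
    proof (cases "C = {}")
      case True
      with p show ?thesis by (auto simp: A_def)
    next
      case False
      have CA: "q \<in> A" if "q \<in> C" for q
        using C that unfolding Chains_def relation_of_def by auto
      have Csub: "sublinear q" and Cle: "q \<le> p" if "q \<in> C" for q
        using CA[OF that] by (auto simp: A_def)
      have Clin: "q \<le> q' \<or> q' \<le> q" if "q \<in> C" "q' \<in> C" for q q'
        using C that unfolding Chains_def relation_of_def by auto
      define u where "u x = (INF q\<in>C. q x)" for x
      \<comment> \<open>Each q in the chain satisfies q x \<ge> - q (- x) \<ge> - p (- x), a bound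
        that does not depend on q.\<close>
      have bdd: "bdd_below ((\<lambda>q. q x) ` C)" for x
      proof (rule bdd_belowI2)
        fix q assume "q \<in> C"
        then show "- p (- x) \<le> q x"
          using sublinear_minus[OF Csub, of q x] le_funD[OF Cle, of q "- x"] by simp
      qed
      have u_le: "u x \<le> q x" if "q \<in> C" for q x
        unfolding u_def using bdd that by (intro cINF_lower) auto
      have u_less: "\<exists>q\<in>C. q x < c" if "u x < c" for x c
        using that cINF_less_iff[OF False bdd] by (auto simp: u_def)
      have "u (a + b) \<le> u a + u b" for a b
      proof (rule field_le_epsilon)
        fix e :: real assume "e > 0"
        then obtain q1 q2 where q: "q1 \<in> C" "q1 a < u a + e/2" "q2 \<in> C" "q2 b < u b + e/2"
          using u_less[of a "u a + e/2"] u_less[of b "u b + e/2"] by auto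
        \<comment> \<open>The smaller of the two chain members serves both arguments.\<close>
        obtain q where "q \<in> C" "q \<le> q1" "q \<le> q2"
          using Clin[of q1 q2] q by auto
        then have "u (a + b) \<le> q (a + b)" "q (a + b) \<le> q a + q b" "q a \<le> q1 a" "q b \<le> q2 b"
          using u_le Csub[of q] by (auto simp: sublinear_def le_fun_def)
        with q show "u (a + b) \<le> u a + u b + e" by linarith
      qed
      moreover have "u (t *\<^sub>R a) \<le> t * u a" if "t > 0" for t a
      proof (rule field_le_epsilon)
        fix e :: real assume "e > 0"
        with that have "e/t > 0" by simp
        then obtain q where q: "q \<in> C" "q a < u a + e/t"
          using u_less[of a "u a + e/t"] by auto
        have "u (t *\<^sub>R a) \<le> q (t *\<^sub>R a)" using u_le q by blast
        also have "\<dots> = t * q a" by (rule sublinear_scale[OF Csub[OF q(1)] that])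
        also have "\<dots> \<le> t * (u a + e/t)" using q that by (intro mult_left_mono) auto
        finally show "u (t *\<^sub>R a) \<le> t * u a + e" using that by (simp add: algebra_simps)
      qed
      moreover have "u 0 = 0"
      proof -
        have "(\<lambda>q. q 0) ` C = {0}" using False Csub by (force simp: sublinear_def)
        then show ?thesis by (simp add: u_def)
      qed
      ultimately have "sublinear u" by (simp add: sublinear_def)
      moreover have "u \<le> q" if "q \<in> C" for q using u_le that by (simp add: le_fun_def)
      moreover have "u \<le> p" using False Cle calculation(2) by (meson all_not_in_conv order_trans)
      ultimately show ?thesis by (intro bexI[of _ u]) (auto simp: A_def)
    qed
  qed
  then obtain q where q: "sublinear q" "q \<le> p"
    and min: "\<And>q'. sublinear q' \<Longrightarrow> q' \<le> p \<Longrightarrow> q' \<le> q \<Longrightarrow> q' = q"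
    by (auto simp: A_def)
  have neg: "q (- y) = - q y" for y
  proof (rule antisym)
    \<comment> \<open>By minimality the descent along \<open>y\<close> changes nothing; its estimate
      at \<open>- y\<close> with t = 1 is the missing half of oddness.\<close>
    have "sublinear_descent y q \<le> q"
      using sublinear_descent_le[OF q(1), of 0 y] by (simp add: le_fun_def)
    then have "sublinear_descent y q = q"
      using q by (intro min sublinear_sublinear_descent) auto
    then show "q (- y) \<le> - q y"
      using sublinear_descent_le[OF q(1), of 1 y "- y"] q by (simp add: sublinear_def)
    show "- q y \<le> q (- y)" using sublinear_minus[OF q(1), of "- y"] by simp
  qed
  have sub: "q (x + y) \<le> q x + q y" for x y using q by (simp add: sublinear_def)
  have "linear q"
  proof (rule linearI)
    fix x y :: 'a
    show "q (x + y) = q x + q y"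
    proof (rule antisym[OF sub])
      have "q (- (x + y)) \<le> q (- x) + q (- y)"
        using sub[of "- x" "- y"] by (metis minus_add_distrib)
      then show "q x + q y \<le> q (x + y)" unfolding neg by simp
    qed
    fix t :: real
    consider "t > 0" | "t = 0" | "t < 0" by linarith
    then show "q (t *\<^sub>R x) = t *\<^sub>R q x"
    proof cases
      case 1
      then show ?thesis using sublinear_scale[OF q(1) 1, of x] by simp
    next
      case 2
      then show ?thesis using q by (simp add: sublinear_def)
    next
      case 3
      then have "q ((- t) *\<^sub>R x) = - t * q x" by (intro sublinear_scale[OF q(1)]) simp
      moreover have "q ((- t) *\<^sub>R x) = - q (t *\<^sub>R x)" using neg[of "t *\<^sub>R x"] by (simp only: scaleR_minus_left)
      ultimately show ?thesis by simp
    qed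
  qed
  with q(2) show ?thesis by (auto simp: le_fun_def)
qed

text \<open>Dominating the descent along \<open>y\<close> rather than \<open>p\<close> itself forces
  l y \<ge> p y, because the descent is at most - p y at - y.\<close>

lemma sublinear_dominates_linear_at:
  assumes p: "sublinear p"
  shows "\<exists>l. linear l \<and> (\<forall>x. l x \<le> p x) \<and> l y = p y"
proof -
  obtain l where l: "linear l" "\<And>x. l x \<le> sublinear_descent y p x"
    using sublinear_dominates_linear[OF sublinear_sublinear_descent[OF p]] by blast
  have le: "l x \<le> p x" for x
    using l(2)[of x] sublinear_descent_le[OF p, of 0 y x] by simp
  have "l (- y) \<le> - p y"
    using l(2)[of "- y"] sublinear_descent_le[OF p, of 1 y "- y"] p by (simp add: sublinear_def)
  then have "l y = p y"
    using le[of y] by (simp add: linear_neg[OF l(1)])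
  with l le show ?thesis by blast
qed

text \<open>The bound is one-sided because the convex neighbourhood to which it is applied may fail
  to be symmetric. It is used for both signs of the increment, and linearity moves it from 0 to any
  point.\<close>

lemma linear_bounded_imp_continuous_map:
  fixes T :: "'e::real_vector topology"
  assumes T: "locally_convex_space T" and l: "linear l"
    and W: "openin T W" "0 \<in> W" "\<And>y. y \<in> W \<Longrightarrow> l y \<le> 1"
  shows "continuous_map T euclideanreal l"
proof -
  have top: "topspace T = UNIV" and add: "continuous_map (prod_topology T T) T (\<lambda>(x, y). x + y)"
    and scale: "continuous_map (prod_topology euclideanreal T) T (\<lambda>(r, x). r *\<^sub>R x)"
    using T by (auto simp: locally_convex_space_def)
  have aff: "continuous_map T T (\<lambda>z. c *\<^sub>R (z + d))" for c d
  proof -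
    have "continuous_map T (prod_topology T T) (\<lambda>z. (z, d))"
      by (intro continuous_map_pairedI) (auto simp: top)
    then have "continuous_map T T (\<lambda>z. z + d)"
      using continuous_map_compose[OF _ add] by (force simp: o_def)
    then have "continuous_map T (prod_topology euclideanreal T) (\<lambda>z. (c, z + d))"
      by (intro continuous_map_pairedI) auto
    then show ?thesis
      using continuous_map_compose[OF _ scale] by (force simp: o_def)
  qed
  have "openin T {y \<in> topspace T. l y \<in> S}" if oS: "open S" for S
  proof (subst openin_subopen, intro ballI)
    fix y assume "y \<in> {y \<in> topspace T. l y \<in> S}"
    then obtain e where e: "e > 0" "ball (l y) e \<subseteq> S"
      using openE[OF oS, of "l y"] by auto
    \<comment> \<open>The factors 2/e and - 2/e yield \<bar>l z - l y\<bar> \<le> e/2, hence the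
      strict bound by e.\<close>
    let ?O = "{z \<in> topspace T. (2/e) *\<^sub>R (z + - y) \<in> W} \<inter> {z \<in> topspace T. (- 2/e) *\<^sub>R (z + - y) \<in> W}"
    have "openin T ?O"
      using openin_continuous_map_preimage[OF aff W(1)] by (intro openin_Int) blast+
    moreover have "y \<in> ?O" using W top by simp
    moreover have "?O \<subseteq> {y \<in> topspace T. l y \<in> S}"
    proof
      fix z assume z: "z \<in> ?O"
      then have "l ((2/e) *\<^sub>R (z + - y)) \<le> 1" "l ((- 2/e) *\<^sub>R (z + - y)) \<le> 1"
        using W(3) by auto
      then have "(2/e) * (l z - l y) \<le> 1" "(- 2/e) * (l z - l y) \<le> 1"
        unfolding linear_cmul[OF l] linear_add[OF l] linear_neg[OF l] by simp_all
      then have "\<bar>l z - l y\<bar> < e"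
        using e(1) by (auto simp: field_simps abs_less_iff)
      then show "z \<in> {y \<in> topspace T. l y \<in> S}"
        using e(2) top by (auto simp: dist_real_def abs_minus_commute subset_iff)
    qed
    ultimately show "\<exists>O'. openin T O' \<and> y \<in> O' \<and> O' \<subseteq> {y \<in> topspace T. l y \<in> S}" by blast
  qed
  then show ?thesis by (simp add: continuous_map_def)
qed

text \<open>Hahn-Banach for the gauge \<open>p\<close> of a convex neighbourhood \<open>V\<close> of
  0 that misses \<open>x\<close>: the gauge is at least 1 at \<open>x\<close> and at most 1 on
  \<open>V\<close>, so a linear \<open>l\<close> below \<open>p\<close> with
  \<open>l x = p x\<close> is continuous and does not vanish at \<open>x\<close>.\<close>

lemma topological_dual_separates:
  fixes T :: "'e::real_vector topology"
  assumes T: "locally_convex_space T" and "x \<noteq> 0"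
  shows "\<exists>l\<in>topological_dual T. l x \<noteq> 0"
proof -
  have top: "topspace T = UNIV" and "Hausdorff_space T"
    and scale: "continuous_map (prod_topology euclideanreal T) T (\<lambda>(r, x). r *\<^sub>R x)"
    and conv: "\<And>U. openin T U \<Longrightarrow> 0 \<in> U \<Longrightarrow> \<exists>V. openin T V \<and> 0 \<in> V \<and> convex V \<and> V \<subseteq> U"
    using T by (auto simp: locally_convex_space_def)
  then obtain U where "openin T U" "0 \<in> U" "x \<notin> U"
    using \<open>x \<noteq> 0\<close> unfolding Hausdorff_space_def by (metis UNIV_I disjnt_iff)
  then obtain V where V: "openin T V" "0 \<in> V" "convex V" "x \<notin> V"
    using conv by blast
  define S where "S y = {t. t > 0 \<and> (1/t) *\<^sub>R y \<in> V}" for y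
  define p where "p y = Inf (S y)" for y
  have absorb: "S y \<noteq> {}" for y
  proof -
    have "continuous_map euclideanreal (prod_topology euclideanreal T) (\<lambda>r. (r, y))"
      by (intro continuous_map_pairedI) (auto simp: top)
    then have "continuous_map euclideanreal T (\<lambda>r. r *\<^sub>R y)"
      using continuous_map_compose[OF _ scale] by (force simp: o_def)
    then have "open {r. r *\<^sub>R y \<in> V}"
      using openin_continuous_map_preimage[OF _ V(1)] by fastforce
    moreover have "0 \<in> {r. r *\<^sub>R y \<in> V}" using V by simp
    ultimately obtain e where "e > 0" "ball 0 e \<subseteq> {r. r *\<^sub>R y \<in> V}"
      using openE by blast
    then have "(e/2) *\<^sub>R y \<in> V" by (auto simp: subset_iff)
    then have "2/e \<in> S y" using \<open>e > 0\<close> by (simp add: S_def)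
    then show ?thesis by blast
  qed
  have bdd: "bdd_below (S y)" for y by (auto simp: S_def intro!: bdd_belowI[of _ 0])
  have p_le: "p y \<le> t" if "t \<in> S y" for t y
    unfolding p_def using bdd that by (rule cInf_lower[rotated])
  have up: "s \<in> S y" if "t \<in> S y" "t \<le> s" for s t y
  proof -
    \<comment> \<open>Convexity together with 0 in \<open>V\<close>: a larger denominator moves the
      vector towards 0.\<close>
    have "(t/s) *\<^sub>R ((1/t) *\<^sub>R y) + (1 - t/s) *\<^sub>R 0 \<in> V"
      using that V by (intro convexD) (auto simp: S_def)
    then show ?thesis using that by (simp add: S_def)
  qed
  have less_p: "t \<in> S y" if "p y < t" for t y
    using that cInf_less_iff[OF absorb bdd] up unfolding p_def by (meson less_imp_le)
  have p_nonneg: "p y \<ge> 0" for y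
    unfolding p_def using absorb by (intro cInf_greatest) (auto simp: S_def)
  have "sublinear p"
    unfolding sublinear_def
  proof (intro conjI allI impI)
    fix a b
    show "p (a + b) \<le> p a + p b"
    proof (rule field_le_epsilon)
      fix e :: real assume "e > 0"
      let ?s = "p a + e/2" and ?t = "p b + e/2"
      have st: "?s \<in> S a" "?t \<in> S b" using \<open>e > 0\<close> by (auto intro: less_p)
      have pos: "?s > 0" "?t > 0" using st by (auto simp: S_def)
      \<comment> \<open>With weights proportional to \<open>?s\<close> and \<open>?t\<close> the
        convex combination equals (a + b) / (?s + ?t).\<close>
      have "(?s/(?s+?t)) *\<^sub>R ((1/?s) *\<^sub>R a) + (?t/(?s+?t)) *\<^sub>R ((1/?t) *\<^sub>R b) \<in> V"
        using st pos V(3) by (intro convexD) (auto simp: S_def add_divide_distrib[symmetric])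
      then have "?s + ?t \<in> S (a + b)"
        using pos by (simp add: S_def scaleR_right_distrib)
      then show "p (a + b) \<le> p a + p b + e"
        using p_le by fastforce
    qed
  next
    fix t :: real and a assume t: "t > 0"
    show "p (t *\<^sub>R a) \<le> t * p a"
    proof (rule field_le_epsilon)
      fix e :: real assume "e > 0"
      then have "p a + e/t \<in> S a" using t by (intro less_p) simp
      then have "t * (p a + e/t) \<in> S (t *\<^sub>R a)" using t by (simp add: S_def)
      from p_le[OF this] show "p (t *\<^sub>R a) \<le> t * p a + e" using t by (simp add: distrib_left)
    qed
  next
    have "p 0 \<le> e" if "e > 0" for e
      using that V by (intro p_le) (simp add: S_def)
    then show "p 0 = 0"
      using p_nonneg[of 0] by (meson dense_ge antisym)
  qed
  then obtain l where l: "linear l" "\<And>y. l y \<le> p y" "l x = p x"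
    using sublinear_dominates_linear_at by blast
  have "l y \<le> 1" if "y \<in> V" for y
    using l(2)[of y] p_le[of 1 y] that by (simp add: S_def)
  then have "continuous_map T euclideanreal l"
    using linear_bounded_imp_continuous_map[OF T l(1) V(1,2)] by blast
  moreover have "p x \<ge> 1"
    using less_p[of x 1] V(4) by (force simp: S_def)
  ultimately show ?thesis
    using l by (intro bexI[of _ l]) (auto simp: topological_dual_def)
qed

section \<open>The dual space and the weak topology\<close>

lemma topological_dual_add:
  "l \<in> topological_dual T \<Longrightarrow> m \<in> topological_dual T \<Longrightarrow> (\<lambda>x. l x + m x) \<in> topological_dual T"
  by (auto simp: topological_dual_def linear_compose_add intro: continuous_map_add)

lemma topological_dual_scale:
  "l \<in> topological_dual T \<Longrightarrow> (\<lambda>x. c * l x) \<in> topological_dual T"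
  using linear_compose_scale_right[of l c]
  by (auto simp: topological_dual_def intro: continuous_map_real_mult)

lemma topological_dual_zero: "(\<lambda>x. 0) \<in> topological_dual T"
  using linear_zero by (auto simp: topological_dual_def)

lemma openin_weak_topology_vimage:
  assumes "l \<in> topological_dual T" "open S"
  shows "openin (weak_topology T) (l -` S)"
  unfolding weak_topology_def using assms by (intro topology_generated_by_Basis) blast

lemma openin_weak_topology_contains_basic:
  assumes "openin (weak_topology T) U" "x \<in> U"
  shows "\<exists>L e. finite L \<and> L \<subseteq> topological_dual T \<and> e > 0 \<and> (\<forall>y. (\<forall>l\<in>L. \<bar>l y - l x\<bar> < e) \<longrightarrow> y \<in> U)"
proof -
  have "generate_topology_on {l -` S | l S. l \<in> topological_dual T \<and> open S} U"
    using assms(1) by (simp add: weak_topology_def openin_topology_generated_by_iff)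
  then show ?thesis using assms(2)
  proof induction
    case (Int a b)
    then obtain L1 e1 L2 e2 where
      "finite L1" "L1 \<subseteq> topological_dual T" "e1 > 0" "\<forall>y. (\<forall>l\<in>L1. \<bar>l y - l x\<bar> < e1) \<longrightarrow> y \<in> a"
      "finite L2" "L2 \<subseteq> topological_dual T" "e2 > 0" "\<forall>y. (\<forall>l\<in>L2. \<bar>l y - l x\<bar> < e2) \<longrightarrow> y \<in> b"
      by auto
    then show ?case
      by (intro exI[of _ "L1 \<union> L2"] exI[of _ "min e1 e2"]) auto
  next
    case (UN K)
    then obtain k where "k \<in> K" "x \<in> k" by blast
    with UN.IH[OF this] show ?case by blast
  next
    case (Basis s)
    then obtain l S where ls: "s = l -` S" "l \<in> topological_dual T" "open S" "l x \<in> S" by auto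
    then obtain e where "e > 0" "ball (l x) e \<subseteq> S" using openE[OF \<open>open S\<close>, of "l x"] by auto
    with ls show ?case
      by (intro exI[of _ "{l}"] exI[of _ e])
         (auto simp: dist_real_def abs_minus_commute subset_iff)
  qed auto
qed

text \<open>\<open>\<Lambda>\<close> stands for a linear form on the dual of E that is non-negative
  on the dual cone. In the application \<open>\<Lambda> l\<close> is the invariant functional
  evaluated at the coefficient of \<open>x0\<close> given by \<open>l\<close>, and the aim is to
  represent it by a point of \<open>C\<close>.\<close>

locale positive_dual_functional =
  fixes T :: "'e::real_vector topology" and C :: "'e set" and \<Lambda> :: "('e \<Rightarrow> real) \<Rightarrow> real"
  assumes cone: "convex_cone C"
    and add: "\<And>l m. l \<in> topological_dual T \<Longrightarrow> m \<in> topological_dual T \<Longrightarrow>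
      \<Lambda> (\<lambda>x. l x + m x) = \<Lambda> l + \<Lambda> m"
    and scale: "\<And>l c. l \<in> topological_dual T \<Longrightarrow> \<Lambda> (\<lambda>x. c * l x) = c * \<Lambda> l"
    and pos: "\<And>l. l \<in> topological_dual T \<Longrightarrow> (\<And>c. c \<in> C \<Longrightarrow> l c \<ge> 0) \<Longrightarrow> \<Lambda> l \<ge> 0"
begin

lemma sum_dual:
  assumes "finite L" "L \<subseteq> topological_dual T"
  shows "(\<lambda>x. \<Sum>l\<in>L. v l * l x) \<in> topological_dual T \<and>
    \<Lambda> (\<lambda>x. \<Sum>l\<in>L. v l * l x) = (\<Sum>l\<in>L. v l * \<Lambda> l)"
  using assms
proof induction
  case empty
  then show ?case using scale[OF topological_dual_zero, of 0] topological_dual_zero by simp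
next
  case (insert l L)
  then show ?case
    using add[of "\<lambda>x. v l * l x" "\<lambda>x. \<Sum>l\<in>L. v l * l x"] scale[of l "v l"]
      topological_dual_scale[of l T "v l"] topological_dual_add[of "\<lambda>x. v l * l x" T "\<lambda>x. \<Sum>l\<in>L. v l * l x"]
    by simp
qed

text \<open>The residual \<open>v\<close> of an almost nearest point of \<open>C\<close> almost separates \<open>\<Lambda>\<close> from \<open>C\<close> on the
  finite set \<open>L\<close>; compactness of the bounded residuals makes the separation exact.\<close>

lemma approximation:
  assumes L: "finite L" "L \<subseteq> topological_dual T" and "e > 0"
  shows "\<exists>c\<in>C. (\<Sum>l\<in>L. (l c - \<Lambda> l)\<^sup>2) < e"
proof (rule ccontr)
  define Q where "Q c = (\<Sum>l\<in>L. (l c - \<Lambda> l)\<^sup>2)" for c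
  assume "\<not> ?thesis"
  then have Qe: "Q c \<ge> e" if "c \<in> C" for c using that by (auto simp: Q_def not_less)
  define d where "d = (INF c\<in>C. Q c)"
  have ne: "C \<noteq> {}" using cone by (rule convex_cone_nonempty)
  have bdd: "bdd_below (Q ` C)" using Qe by (intro bdd_belowI2) auto
  have "d \<ge> e" unfolding d_def using ne Qe by (rule cINF_greatest)
  with \<open>e > 0\<close> have d: "d > 0" by linarith
  have d_le: "d \<le> Q c" if "c \<in> C" for c unfolding d_def using bdd that by (rule cINF_lower)
  have d_less: "\<exists>c\<in>C. Q c < a" if "d < a" for a
    using that cINF_less_iff[OF ne bdd] by (auto simp: d_def)
  have lin: "linear l" if "l \<in> L" for l using L that by (auto simp: topological_dual_def)
  \<comment> \<open>\<open>B\<close> bounds the sum of (l c)^2 whenever Q c \<le> d + 1, by (a +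
    b)^2 \<le> 2 a^2 + 2 b^2 with l c = (l c - \<Lambda> l) + \<Lambda> l.\<close>
  define B where "B = 2 * (d + 1) + 2 * (\<Sum>l\<in>L. (\<Lambda> l)\<^sup>2)"
  \<comment> \<open>A residual v of a point with Q c \<le> d + 1 satisfies (v l)^2 \<le> d + 1 \<le>
    (d + 2)^2.\<close>
  define b where "b l = (if l \<in> L then d + 2 else 0)" for l :: "'e \<Rightarrow> real"
  \<comment> \<open>Separation with tolerance t: as a combination of \<open>L\<close>, v is almost
    non-negative on \<open>C\<close>, and its pairing with \<open>\<Lambda>\<close> is at most - d
    up to a multiple of t.\<close>
  define Z where "Z t = {v. (\<forall>l. \<bar>v l\<bar> \<le> b l) \<and>
      (\<forall>c\<in>C. - t * (1 + (\<Sum>l\<in>L. (l c)\<^sup>2)) \<le> (\<Sum>l\<in>L. v l * l c)) \<and>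
      (\<Sum>l\<in>L. v l * \<Lambda> l) \<le> t * (1 + B) - d}" for t
  have expand: "Q (a *\<^sub>R c + s *\<^sub>R c') = (\<Sum>l\<in>L. (a * l c + s * l c' - \<Lambda> l)\<^sup>2)" for a s c c'
    unfolding Q_def by (intro sum.cong refl) (simp add: linear_add[OF lin] linear_cmul[OF lin])
  have "\<exists>v. \<forall>t\<in>{0<..<1}. v \<in> Z t"
  proof (rule directed_bounded_functions_Inter)
    show "{0<..<1::real} \<noteq> {}" by simp
    show "closed (Z t)" for t
    proof -
      have eq: "Z t = {v. \<forall>l. \<bar>v l\<bar> \<le> b l} \<inter>
        (\<Inter>c\<in>C. {v. - t * (1 + (\<Sum>l\<in>L. (l c)\<^sup>2)) \<le> (\<Sum>l\<in>L. v l * l c)}) \<inter>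
        {v. (\<Sum>l\<in>L. v l * \<Lambda> l) \<le> t * (1 + B) - d}"
        by (auto simp: Z_def)
      show ?thesis
        unfolding eq
        by (intro closed_Int closed_Collect_all closed_INT ballI closed_Collect_le continuous_intros
            continuous_on_product_coordinates)
    qed
    show "\<bar>J x\<bar> \<le> b x" if "J \<in> Z t" for J x t using that by (simp add: Z_def)
    show "\<exists>k\<in>{0<..<1}. Z k \<subseteq> Z s \<inter> Z t" if "s \<in> {0<..<1}" "t \<in> {0<..<1}" for s t
    proof (intro bexI[of _ "min s t"])
      have mono: "Z r \<subseteq> Z r'" if "r \<le> r'" for r r'
      proof -
        have "B \<ge> 0" using d by (simp add: B_def sum_nonneg)
        then have le: "r * (1 + B) \<le> r' * (1 + B)" using that by (intro mult_right_mono) auto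
        have le': "- r' * (1 + (\<Sum>l\<in>L. (l c)\<^sup>2)) \<le> - r * (1 + (\<Sum>l\<in>L. (l c)\<^sup>2))" for c
          using that by (intro mult_right_mono) (auto simp: sum_nonneg add_nonneg_nonneg)
        show ?thesis
        proof
          fix v assume v: "v \<in> Z r"
          have "- r' * (1 + (\<Sum>l\<in>L. (l c)\<^sup>2)) \<le> (\<Sum>l\<in>L. v l * l c)" if "c \<in> C" for c
          proof -
            have "- r * (1 + (\<Sum>l\<in>L. (l c)\<^sup>2)) \<le> (\<Sum>l\<in>L. v l * l c)"
              using v that by (simp add: Z_def)
            with le'[of c] show ?thesis by linarith
          qed
          with v le show "v \<in> Z r'" by (simp add: Z_def)
        qed
      qed
      show "Z (min s t) \<subseteq> Z s \<inter> Z t" by (simp add: mono)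
    qed (use that in auto)
    show "Z t \<noteq> {}" if t: "t \<in> {0<..<1}" for t
    proof -
      have "t\<^sup>2 > 0" "t\<^sup>2 \<le> 1" using t by (auto simp: power_le_one)
      then obtain c where c: "c \<in> C" "Q c < d + t\<^sup>2" using d_less[of "d + t\<^sup>2"] by auto
      define v where "v l = (if l \<in> L then l c - \<Lambda> l else 0)" for l
      have Qv: "Q c = (\<Sum>l\<in>L. (v l)\<^sup>2)" by (simp add: Q_def v_def)
      have "\<bar>v l\<bar> \<le> b l" for l
      proof (cases "l \<in> L")
        case True
        then have "(v l)\<^sup>2 \<le> Q c"
          unfolding Qv using L(1) by (intro member_le_sum) auto
        also have "\<dots> \<le> (d + 2)\<^sup>2"
        proof -
          have "(d + 2)\<^sup>2 = d\<^sup>2 + 4 * d + 4" by (simp add: power2_eq_square algebra_simps)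
          then show ?thesis using c(2) \<open>t\<^sup>2 \<le> 1\<close> d zero_le_power2[of d] by linarith
        qed
        finally show ?thesis using True d abs_le_square_iff[of "v l" "d + 2"] by (simp add: b_def)
      qed (simp add: v_def b_def)
      moreover have "- t * (1 + (\<Sum>l\<in>L. (l c')\<^sup>2)) \<le> (\<Sum>l\<in>L. v l * l c')" if c': "c' \<in> C" for c'
      proof -
        \<comment> \<open>The point c is nearest up to t^2, so a step of length t along c' lowers Q
          by less than t^2; dividing by t leaves an error of order t.\<close>
        have "d \<le> Q (1 *\<^sub>R c + t *\<^sub>R c')"
          using c c' t by (intro d_le convex_cone_add[OF cone] convex_cone_scaleR[OF cone]) auto
        also have "\<dots> = (\<Sum>l\<in>L. (v l + t * l c')\<^sup>2)"
          unfolding expand by (intro sum.cong refl) (simp add: v_def algebra_simps)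
        also have "\<dots> = Q c + 2 * t * (\<Sum>l\<in>L. v l * l c') + t\<^sup>2 * (\<Sum>l\<in>L. (l c')\<^sup>2)"
          unfolding Qv by (simp add: power2_sum sum.distrib sum_distrib_left power_mult_distrib mult_ac)
        finally have "0 \<le> t * (t + 2 * (\<Sum>l\<in>L. v l * l c') + t * (\<Sum>l\<in>L. (l c')\<^sup>2))"
          using c(2) by (simp add: power2_eq_square algebra_simps)
        then have "0 \<le> t + 2 * (\<Sum>l\<in>L. v l * l c') + t * (\<Sum>l\<in>L. (l c')\<^sup>2)"
          using t by (simp add: zero_le_mult_iff)
        moreover have "0 \<le> t * (1 + (\<Sum>l\<in>L. (l c')\<^sup>2))" using t by (simp add: sum_nonneg)
        ultimately show ?thesis by (simp add: algebra_simps)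
      qed
      moreover have "(\<Sum>l\<in>L. v l * \<Lambda> l) \<le> t * (1 + B) - d"
      proof -
        let ?a = "\<Sum>l\<in>L. v l * l c" and ?b = "\<Sum>l\<in>L. (l c)\<^sup>2"
        have "?b \<le> (\<Sum>l\<in>L. 2 * (v l)\<^sup>2 + 2 * (\<Lambda> l)\<^sup>2)"
        proof (intro sum_mono)
          fix l assume "l \<in> L"
          then have "l c = v l + \<Lambda> l" by (simp add: v_def)
          then show "(l c)\<^sup>2 \<le> 2 * (v l)\<^sup>2 + 2 * (\<Lambda> l)\<^sup>2"
            using zero_le_power2[of "v l - \<Lambda> l"] by (simp add: power2_eq_square algebra_simps)
        qed
        also have "\<dots> \<le> B"
          using c(2) \<open>t\<^sup>2 \<le> 1\<close> by (simp add: B_def Qv sum.distrib sum_distrib_left[symmetric])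
        finally have bB: "?b \<le> B" .
        \<comment> \<open>The shrunk point (1 - t) c is still in the cone; comparing it with c
          bounds the pairing \<open>?a\<close> of the residual with c from above. The zero summand
          only gives the point the shape required by \<open>expand\<close>.\<close>
        have "d \<le> Q ((1 - t) *\<^sub>R c + 0 *\<^sub>R c)"
          using c t convex_cone_scaleR[OF cone, of "1 - t" c] by (intro d_le) auto
        also have "\<dots> = (\<Sum>l\<in>L. (v l - t * l c)\<^sup>2)"
          unfolding expand by (intro sum.cong refl) (simp add: v_def algebra_simps)
        also have "\<dots> = Q c - 2 * t * ?a + t\<^sup>2 * ?b"
          unfolding Qv
          by (simp add: power2_diff sum.distrib sum_subtractf sum_distrib_left power_mult_distrib mult_ac)
        finally have "0 \<le> t * (t - 2 * ?a + t * ?b)"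
          using c(2) by (simp add: power2_eq_square algebra_simps)
        then have "0 \<le> t - 2 * ?a + t * ?b" using t by (simp add: zero_le_mult_iff)
        moreover have "t * ?b \<le> t * B" using bB t by (intro mult_left_mono) auto
        moreover have "0 \<le> ?b" by (simp add: sum_nonneg)
        then have "0 \<le> t * B" using bB t by (intro mult_nonneg_nonneg) auto
        ultimately have "2 * ?a \<le> t + t * B" "0 \<le> t * B" by linarith+
        moreover have "t * (1 + B) = t + t * B" by (simp add: distrib_left)
        ultimately have "?a \<le> t * (1 + B)" using t by auto
        \<comment> \<open>On \<open>L\<close> one has \<Lambda> l = l c - v l, and the squares of v
          add up to Q c.\<close>
        moreover have "(\<Sum>l\<in>L. v l * \<Lambda> l) = ?a - Q c"
          unfolding Qv sum_subtractf[symmetric]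
          by (intro sum.cong refl) (simp add: v_def power2_eq_square algebra_simps)
        ultimately show ?thesis using d_le[OF c(1)] by linarith
      qed
      ultimately have "v \<in> Z t" by (simp add: Z_def)
      then show ?thesis by blast
    qed
  qed
  then obtain v where *: "\<forall>t\<in>{0<..<1}. v \<in> Z t" ..
  have v: "v \<in> Z t" if "0 < t" "t < 1" for t using * that by simp
  have lim0: "a \<le> x" if "\<And>t. 0 < t \<Longrightarrow> t < 1 \<Longrightarrow> a \<le> x + t * y" for a x y :: real
  proof (rule tendsto_lowerbound)
    show "((\<lambda>t. x + t * y) \<longlongrightarrow> x) (at_right 0)"
      by (auto intro!: tendsto_eq_intros)
    show "\<forall>\<^sub>F t in at_right 0. a \<le> x + t * y"
      using that by (auto simp: eventually_at_right_field intro: exI[of _ 1])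
  qed simp
  \<comment> \<open>The common v separates exactly: \<open>?\<mu>\<close> is non-negative on
    \<open>C\<close>, although its image under \<open>\<Lambda>\<close> is at most - d < 0.\<close>
  let ?\<mu> = "\<lambda>x. \<Sum>l\<in>L. v l * l x"
  have "0 \<le> ?\<mu> c" if "c \<in> C" for c
  proof (rule lim0)
    fix t :: real assume "0 < t" "t < 1"
    have "- t * (1 + (\<Sum>l\<in>L. (l c)\<^sup>2)) \<le> ?\<mu> c"
      using v[OF \<open>0 < t\<close> \<open>t < 1\<close>] that by (simp add: Z_def)
    then show "0 \<le> ?\<mu> c + t * (1 + (\<Sum>l\<in>L. (l c)\<^sup>2))" by linarith
  qed
  then have "0 \<le> \<Lambda> ?\<mu>" using sum_dual[OF L] by (intro pos) auto
  then have "0 \<le> (\<Sum>l\<in>L. v l * \<Lambda> l)" using sum_dual[OF L] by simp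
  moreover have "(\<Sum>l\<in>L. v l * \<Lambda> l) \<le> - d"
  proof (rule lim0)
    fix t :: real assume "0 < t" "t < 1"
    from v[OF this] show "(\<Sum>l\<in>L. v l * \<Lambda> l) \<le> - d + t * (1 + B)" by (simp add: Z_def)
  qed
  ultimately show False using d by linarith
qed

text \<open>Points of \<open>C\<close> can approach the prescribed values at finitely many
  functionals simultaneously. The filter of these approximants is weakly Cauchy, and its limit in
  \<open>C\<close> represents \<open>\<Lambda>\<close>.\<close>

lemma representation:
  assumes "weakly_complete T C"
  shows "\<exists>c\<in>C. \<forall>l\<in>topological_dual T. l c = \<Lambda> l"
proof -
  define I where "I = {(L, e::real). finite L \<and> L \<subseteq> topological_dual T \<and> e > 0}"
  \<comment> \<open>The square on e makes each single deviation \<bar>l c - \<Lambda> l\<bar>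
    smaller than e.\<close>
  define A where "A = (\<lambda>(L, e). {c\<in>C. (\<Sum>l\<in>L. (l c - \<Lambda> l)\<^sup>2) < e\<^sup>2})"
  define F where "F = (INF i\<in>I. principal (A i))"
  have near: "\<bar>l c - \<Lambda> l\<bar> < e" if "c \<in> A (L, e)" "l \<in> L" "(L, e) \<in> I" for c l L e
  proof -
    have "(l c - \<Lambda> l)\<^sup>2 \<le> (\<Sum>l\<in>L. (l c - \<Lambda> l)\<^sup>2)"
      using that by (intro member_le_sum) (auto simp: I_def)
    also have "\<dots> < e\<^sup>2" using that by (simp add: A_def)
    finally have "\<bar>l c - \<Lambda> l\<bar> < \<bar>e\<bar>" using abs_le_square_iff[of e "l c - \<Lambda> l"] by linarith
    then show ?thesis using that by (simp add: I_def)
  qed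
  have ev: "eventually P F \<longleftrightarrow> (\<exists>i\<in>I. \<forall>x\<in>A i. P x)" for P
    unfolding F_def
  proof (subst eventually_INF_base)
    have "({}, 1) \<in> I" by (simp add: I_def)
    then show "I \<noteq> {}" by blast
    fix i j assume "i \<in> I" "j \<in> I"
    then obtain L e L' e' where ij: "i = (L, e)" "j = (L', e')" "(L, e) \<in> I" "(L', e') \<in> I"
      by (metis surj_pair)
    have "A (L \<union> L', min e e') \<subseteq> A i \<inter> A j"
    proof -
      have "(\<Sum>l\<in>K. (l c - \<Lambda> l)\<^sup>2) < a\<^sup>2"
        if "(\<Sum>l\<in>L \<union> L'. (l c - \<Lambda> l)\<^sup>2) < (min e e')\<^sup>2" "K \<subseteq> L \<union> L'" "min e e' \<le> a" for K c a
      proof -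
        have "(\<Sum>l\<in>K. (l c - \<Lambda> l)\<^sup>2) \<le> (\<Sum>l\<in>L \<union> L'. (l c - \<Lambda> l)\<^sup>2)"
          using that ij by (intro sum_mono2) (auto simp: I_def)
        also note that(1)
        also have "(min e e')\<^sup>2 \<le> a\<^sup>2"
          using that ij by (intro power_mono) (auto simp: I_def)
        finally show ?thesis .
      qed
      then show ?thesis by (auto simp: A_def ij(1,2))
    qed
    then show "\<exists>k\<in>I. principal (A k) \<le> inf (principal (A i)) (principal (A j))"
      using ij by (intro bexI[of _ "(L \<union> L', min e e')"]) (auto simp: I_def)
  qed (simp add: eventually_principal)
  have "F \<noteq> bot"
  proof
    assume "F = bot"
    then have "eventually (\<lambda>_. False) F" by simp
    then obtain L e where "(L, e) \<in> I" "A (L, e) = {}" unfolding ev by auto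
    then show False using approximation[of L "e\<^sup>2"] by (auto simp: A_def I_def)
  qed
  moreover have "F \<le> principal C"
  proof -
    have "eventually (\<lambda>x. x \<in> C) F"
      unfolding ev by (intro bexI[of _ "({}, 1)"]) (auto simp: A_def I_def)
    then show ?thesis by (simp add: le_principal)
  qed
  moreover have "cauchy_filter_on (weak_topology T) F"
    unfolding cauchy_filter_on_def
  proof (intro allI impI, elim conjE)
    fix U assume "openin (weak_topology T) U" "(0::'e) \<in> U"
    then obtain L e where Le: "finite L" "L \<subseteq> topological_dual T" "e > 0"
      and U: "\<And>y. (\<And>l. l \<in> L \<Longrightarrow> \<bar>l y - l 0\<bar> < e) \<Longrightarrow> y \<in> U"
      using openin_weak_topology_contains_basic[of T U 0] by metis
    have I: "(L, e/2) \<in> I" using Le by (simp add: I_def)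
    then have "eventually (\<lambda>x. x \<in> A (L, e/2)) F" unfolding ev by blast
    moreover have "x - y \<in> U" if "x \<in> A (L, e/2)" "y \<in> A (L, e/2)" for x y
    proof (rule U)
      fix l assume l: "l \<in> L"
      then have "linear l" using Le by (auto simp: topological_dual_def)
      then have "l (x - y) - l 0 = l x - l y" by (simp add: linear_diff linear_0)
      moreover have "\<bar>l x - l y\<bar> < e"
        using near[OF that(1) l I] near[OF that(2) l I] by (simp only: abs_less_iff) linarith
      ultimately show "\<bar>l (x - y) - l 0\<bar> < e" by simp
    qed
    ultimately show "\<forall>\<^sub>F (x, y) in F \<times>\<^sub>F F. x - y \<in> U"
      unfolding eventually_prod_same by (intro exI[of _ "\<lambda>x. x \<in> A (L, e/2)"]) auto
  qed
  ultimately obtain c where c: "c \<in> C" "limitin (weak_topology T) (\<lambda>x. x) c F"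
    using assms by (auto simp: weakly_complete_def complete_subset_def)
  have "l c = \<Lambda> l" if l: "l \<in> topological_dual T" for l
  proof (rule ccontr)
    assume "l c \<noteq> \<Lambda> l"
    define e where "e = \<bar>l c - \<Lambda> l\<bar> / 2"
    have "e > 0" using \<open>l c \<noteq> \<Lambda> l\<close> by (simp add: e_def)
    have I: "({l}, e) \<in> I" using l \<open>e > 0\<close> by (simp add: I_def)
    have "openin (weak_topology T) (l -` ball (l c) e)"
      by (rule openin_weak_topology_vimage[OF l open_ball])
    then have "eventually (\<lambda>x. x \<in> l -` ball (l c) e) F"
      using c(2) \<open>e > 0\<close> unfolding limitin_def by (metis centre_in_ball vimageI)
    then obtain i where i: "i \<in> I" "\<And>x. x \<in> A i \<Longrightarrow> \<bar>l c - l x\<bar> < e"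
      unfolding ev by (auto simp: dist_real_def)
    have "eventually (\<lambda>x. x \<in> A i \<and> x \<in> A ({l}, e)) F"
      using i I by (intro eventually_conj) (auto simp: ev)
    then obtain x where "x \<in> A i" "x \<in> A ({l}, e)"
      using \<open>F \<noteq> bot\<close> eventually_happens by blast
    then have "\<bar>l c - l x\<bar> < e" "\<bar>l x - \<Lambda> l\<bar> < e"
      using i(2)[of x] near[of x "{l}" e l] I by auto
    then have "\<bar>l c - \<Lambda> l\<bar> < 2 * e" using abs_triangle_ineq[of "l c - l x" "l x - \<Lambda> l"] by simp
    then show False by (simp add: e_def)
  qed
  with c(1) show ?thesis by blast
qed

end

subsection \<open>Invariant functionals and the fixed-point property\<close>

text \<open>The small factor acts on the left, as in the continuity condition on \<open>x0\<close>,
  so that the coefficients of \<open>x0\<close> belong to this class.\<close>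

definition ruc :: "('g, 'b) monoid_scheme \<Rightarrow> 'g topology \<Rightarrow> ('g \<Rightarrow> real) \<Rightarrow> bool" where
  "ruc G T \<phi> \<longleftrightarrow>
     (\<exists>B. \<forall>x\<in>carrier G. \<bar>\<phi> x\<bar> \<le> B) \<and>
     (\<forall>e>0. \<exists>V. openin T V \<and> \<one>\<^bsub>G\<^esub> \<in> V \<and>
       (\<forall>a\<in>V. \<forall>x\<in>carrier G. \<bar>\<phi> (a \<otimes>\<^bsub>G\<^esub> x) - \<phi> x\<bar> < e))"

text \<open>Translation is the identity off the carrier, so that it is an action on all functions.\<close>

definition left_translate :: "('g, 'b) monoid_scheme \<Rightarrow> 'g \<Rightarrow> ('g \<Rightarrow> real) \<Rightarrow> 'g \<Rightarrow> real" where
  "left_translate G g \<phi> = (\<lambda>x. if x \<in> carrier G then \<phi> (g \<otimes>\<^bsub>G\<^esub> x) else \<phi> x)"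

text \<open>For non-negative \<open>f\<close> this is the order ideal generated by the left
  translates of \<open>f\<close> within the bounded right-uniformly continuous functions.\<close>

definition dominated ::
  "('g, 'b) monoid_scheme \<Rightarrow> 'g topology \<Rightarrow> ('g \<Rightarrow> real) \<Rightarrow> ('g \<Rightarrow> real) set" where
  "dominated G T f = {\<phi>. ruc G T \<phi> \<and>
     (\<exists>c\<ge>0. \<exists>gs. set gs \<subseteq> carrier G \<and>
       (\<forall>x\<in>carrier G. \<bar>\<phi> x\<bar> \<le> c * (\<Sum>g\<leftarrow>gs. f (g \<otimes>\<^bsub>G\<^esub> x))))}"

text \<open>The laws are confined to dominated functions; on all other functions the value of
  \<open>J\<close> is arbitrary.\<close>

definition positive_functional ::
  "('g, 'b) monoid_scheme \<Rightarrow> 'g topology \<Rightarrow> ('g \<Rightarrow> real) \<Rightarrow> (('g \<Rightarrow> real) \<Rightarrow> real) \<Rightarrow> bool" where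
  "positive_functional G T f J \<longleftrightarrow>
     (\<forall>\<phi>\<in>dominated G T f. \<forall>\<psi>\<in>dominated G T f. J (\<lambda>x. \<phi> x + \<psi> x) = J \<phi> + J \<psi>) \<and>
     (\<forall>\<phi>\<in>dominated G T f. \<forall>c. J (\<lambda>x. c * \<phi> x) = c * J \<phi>) \<and>
     (\<forall>\<phi>\<in>dominated G T f. (\<forall>x\<in>carrier G. 0 \<le> \<phi> x) \<longrightarrow> 0 \<le> J \<phi>)"

definition left_invariant ::
  "('g, 'b) monoid_scheme \<Rightarrow> 'g topology \<Rightarrow> ('g \<Rightarrow> real) \<Rightarrow> (('g \<Rightarrow> real) \<Rightarrow> real) \<Rightarrow> bool" where
  "left_invariant G T f J \<longleftrightarrow>
     (\<forall>\<phi>\<in>dominated G T f. \<forall>g\<in>carrier G. J (left_translate G g \<phi>) = J \<phi>)"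

text \<open>The condition mentions no vector space, so it carries the fixed-point property from the
  one type in which it is assumed to every type in which it is asserted.\<close>

definition invariant_functionals :: "('g, 'b) monoid_scheme \<Rightarrow> 'g topology \<Rightarrow> bool" where
  "invariant_functionals G T \<longleftrightarrow>
     (\<forall>f. ruc G T f \<and> (\<forall>x\<in>carrier G. 0 \<le> f x) \<and> (\<exists>x\<in>carrier G. f x \<noteq> 0) \<longrightarrow>
       (\<exists>J. positive_functional G T f J \<and> left_invariant G T f J \<and> J f = 1))"

section \<open>Stability of the function spaces and rules for positive functionals\<close>

lemma ruc_bounded: "ruc G T \<phi> \<Longrightarrow> \<exists>B. \<forall>x\<in>carrier G. \<bar>\<phi> x\<bar> \<le> B"
  by (simp add: ruc_def)

lemma rucD:
  assumes "ruc G T \<phi>" "e > 0"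
  shows "\<exists>V. openin T V \<and> \<one>\<^bsub>G\<^esub> \<in> V \<and> (\<forall>a\<in>V. \<forall>x\<in>carrier G. \<bar>\<phi> (a \<otimes>\<^bsub>G\<^esub> x) - \<phi> x\<bar> < e)"
  using assms by (simp add: ruc_def)

lemma ruc_cong:
  assumes "group G" "topspace T = carrier G" "\<And>x. x \<in> carrier G \<Longrightarrow> \<phi> x = \<psi> x" "ruc G T \<phi>"
  shows "ruc G T \<psi>"
proof -
  interpret group G by fact
  have "a \<otimes>\<^bsub>G\<^esub> x \<in> carrier G" if "openin T V" "a \<in> V" "x \<in> carrier G" for V a x
    using that assms(2) openin_subset by (metis m_closed subsetD)
  with assms(3,4) show ?thesis unfolding ruc_def by metis
qed

lemma ruc_add:
  assumes "ruc G T \<phi>" "ruc G T \<psi>"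
  shows "ruc G T (\<lambda>x. \<phi> x + \<psi> x)"
  unfolding ruc_def
proof (intro conjI allI impI)
  obtain B B' where "\<forall>x\<in>carrier G. \<bar>\<phi> x\<bar> \<le> B" "\<forall>x\<in>carrier G. \<bar>\<psi> x\<bar> \<le> B'"
    using assms by (auto simp: ruc_def)
  then show "\<exists>B. \<forall>x\<in>carrier G. \<bar>\<phi> x + \<psi> x\<bar> \<le> B"
    by (intro exI[of _ "B + B'"]) (meson order_trans abs_triangle_ineq add_mono)
next
  fix e :: real assume "e > 0"
  then have "e/2 > 0" by simp
  obtain V where V: "openin T V" "\<one>\<^bsub>G\<^esub> \<in> V"
    "\<forall>a\<in>V. \<forall>x\<in>carrier G. \<bar>\<phi> (a \<otimes>\<^bsub>G\<^esub> x) - \<phi> x\<bar> < e/2"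
    using assms(1) \<open>e/2 > 0\<close> unfolding ruc_def by meson
  obtain W where W: "openin T W" "\<one>\<^bsub>G\<^esub> \<in> W"
    "\<forall>a\<in>W. \<forall>x\<in>carrier G. \<bar>\<psi> (a \<otimes>\<^bsub>G\<^esub> x) - \<psi> x\<bar> < e/2"
    using assms(2) \<open>e/2 > 0\<close> unfolding ruc_def by meson
  have "\<bar>\<phi> (a \<otimes>\<^bsub>G\<^esub> x) + \<psi> (a \<otimes>\<^bsub>G\<^esub> x) - (\<phi> x + \<psi> x)\<bar> < e"
    if "a \<in> V \<inter> W" "x \<in> carrier G" for a x
  proof -
    have "\<bar>\<phi> (a \<otimes>\<^bsub>G\<^esub> x) - \<phi> x\<bar> < e/2" "\<bar>\<psi> (a \<otimes>\<^bsub>G\<^esub> x) - \<psi> x\<bar> < e/2"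
      using that V W by auto
    then show ?thesis by (simp only: abs_less_iff) linarith
  qed
  then show "\<exists>V. openin T V \<and> \<one>\<^bsub>G\<^esub> \<in> V \<and> (\<forall>a\<in>V. \<forall>x\<in>carrier G.
      \<bar>\<phi> (a \<otimes>\<^bsub>G\<^esub> x) + \<psi> (a \<otimes>\<^bsub>G\<^esub> x) - (\<phi> x + \<psi> x)\<bar> < e)"
    using V(1,2) W(1,2) openin_Int[OF V(1) W(1)] by (intro exI[of _ "V \<inter> W"]) blast
qed

lemma ruc_scale:
  assumes "ruc G T \<phi>"
  shows "ruc G T (\<lambda>x. c * \<phi> x)"
  unfolding ruc_def
proof (intro conjI allI impI)
  obtain B where "\<forall>x\<in>carrier G. \<bar>\<phi> x\<bar> \<le> B"
    using assms by (auto simp: ruc_def)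
  then show "\<exists>B. \<forall>x\<in>carrier G. \<bar>c * \<phi> x\<bar> \<le> B"
    by (intro exI[of _ "\<bar>c\<bar> * B"]) (auto simp: abs_mult intro: mult_left_mono)
next
  fix e :: real assume "e > 0"
  then have "e / (\<bar>c\<bar> + 1) > 0" by simp
  then obtain V where V: "openin T V" "\<one>\<^bsub>G\<^esub> \<in> V"
    "\<forall>a\<in>V. \<forall>x\<in>carrier G. \<bar>\<phi> (a \<otimes>\<^bsub>G\<^esub> x) - \<phi> x\<bar> < e / (\<bar>c\<bar> + 1)"
    using assms unfolding ruc_def by meson
  have "\<bar>c * \<phi> (a \<otimes>\<^bsub>G\<^esub> x) - c * \<phi> x\<bar> < e" if "a \<in> V" "x \<in> carrier G" for a x
  proof -
    have "\<bar>c * \<phi> (a \<otimes>\<^bsub>G\<^esub> x) - c * \<phi> x\<bar> = \<bar>c\<bar> * \<bar>\<phi> (a \<otimes>\<^bsub>G\<^esub> x) - \<phi> x\<bar>"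
      by (simp add: abs_mult[symmetric] right_diff_distrib)
    also have "\<dots> \<le> (\<bar>c\<bar> + 1) * \<bar>\<phi> (a \<otimes>\<^bsub>G\<^esub> x) - \<phi> x\<bar>"
      by (intro mult_right_mono) auto
    also have "\<dots> < (\<bar>c\<bar> + 1) * (e / (\<bar>c\<bar> + 1))"
      using V that by (intro mult_strict_left_mono) auto
    also have "\<dots> = e" by (simp add: field_simps add_pos_nonneg)
    finally show ?thesis .
  qed
  with V show "\<exists>V. openin T V \<and> \<one>\<^bsub>G\<^esub> \<in> V \<and>
      (\<forall>a\<in>V. \<forall>x\<in>carrier G. \<bar>c * \<phi> (a \<otimes>\<^bsub>G\<^esub> x) - c * \<phi> x\<bar> < e)"
    by blast
qed

lemma dominated_cong:
  assumes "group G" "topspace T = carrier G" "\<And>x. x \<in> carrier G \<Longrightarrow> \<phi> x = \<psi> x"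
    and "\<phi> \<in> dominated G T f"
  shows "\<psi> \<in> dominated G T f"
  using assms(4) ruc_cong[OF assms(1-3)] assms(3) unfolding dominated_def by auto

lemma sum_list_translates_nonneg:
  assumes "group G" "\<And>x. x \<in> carrier G \<Longrightarrow> 0 \<le> (f x :: real)" "set gs \<subseteq> carrier G" "x \<in> carrier G"
  shows "0 \<le> (\<Sum>g\<leftarrow>gs. f (g \<otimes>\<^bsub>G\<^esub> x))"
proof -
  interpret group G by fact
  show ?thesis using assms(2-) by (intro sum_list_nonneg) auto
qed

lemma dominated_add:
  assumes G: "group G" and f: "\<And>x. x \<in> carrier G \<Longrightarrow> 0 \<le> f x"
    and D: "\<phi> \<in> dominated G T f" "\<psi> \<in> dominated G T f"
  shows "(\<lambda>x. \<phi> x + \<psi> x) \<in> dominated G T f"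
proof -
  obtain c gs where 1: "c \<ge> 0" "set gs \<subseteq> carrier G"
    "\<And>x. x \<in> carrier G \<Longrightarrow> \<bar>\<phi> x\<bar> \<le> c * (\<Sum>g\<leftarrow>gs. f (g \<otimes>\<^bsub>G\<^esub> x))"
    using D(1) unfolding dominated_def by auto
  obtain c' gs' where 2: "c' \<ge> 0" "set gs' \<subseteq> carrier G"
    "\<And>x. x \<in> carrier G \<Longrightarrow> \<bar>\<psi> x\<bar> \<le> c' * (\<Sum>g\<leftarrow>gs'. f (g \<otimes>\<^bsub>G\<^esub> x))"
    using D(2) unfolding dominated_def by auto
  have "\<bar>\<phi> x + \<psi> x\<bar> \<le> max c c' * (\<Sum>g\<leftarrow>gs @ gs'. f (g \<otimes>\<^bsub>G\<^esub> x))" if x: "x \<in> carrier G" for x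
  proof -
    have "c * (\<Sum>g\<leftarrow>gs. f (g \<otimes>\<^bsub>G\<^esub> x)) \<le> max c c' * (\<Sum>g\<leftarrow>gs. f (g \<otimes>\<^bsub>G\<^esub> x))"
      using sum_list_translates_nonneg[OF G f 1(2) x] by (intro mult_right_mono) auto
    moreover have "c' * (\<Sum>g\<leftarrow>gs'. f (g \<otimes>\<^bsub>G\<^esub> x)) \<le> max c c' * (\<Sum>g\<leftarrow>gs'. f (g \<otimes>\<^bsub>G\<^esub> x))"
      using sum_list_translates_nonneg[OF G f 2(2) x] by (intro mult_right_mono) auto
    moreover have "max c c' * (\<Sum>g\<leftarrow>gs @ gs'. f (g \<otimes>\<^bsub>G\<^esub> x)) =
        max c c' * (\<Sum>g\<leftarrow>gs. f (g \<otimes>\<^bsub>G\<^esub> x)) + max c c' * (\<Sum>g\<leftarrow>gs'. f (g \<otimes>\<^bsub>G\<^esub> x))"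
      by (simp add: distrib_left)
    ultimately show ?thesis using 1(3)[OF x] 2(3)[OF x] by linarith
  qed
  then have "\<exists>c\<ge>0. \<exists>gs. set gs \<subseteq> carrier G \<and>
      (\<forall>x\<in>carrier G. \<bar>\<phi> x + \<psi> x\<bar> \<le> c * (\<Sum>g\<leftarrow>gs. f (g \<otimes>\<^bsub>G\<^esub> x)))"
    using 1(1,2) 2(2) by (intro exI[of _ "max c c'"] conjI exI[of _ "gs @ gs'"]) auto
  then show ?thesis using D unfolding dominated_def by (auto intro: ruc_add)
qed

lemma dominated_scale:
  assumes "\<phi> \<in> dominated G T f"
  shows "(\<lambda>x. a * \<phi> x) \<in> dominated G T f"
proof -
  obtain c gs where 1: "c \<ge> 0" "set gs \<subseteq> carrier G"
    "\<And>x. x \<in> carrier G \<Longrightarrow> \<bar>\<phi> x\<bar> \<le> c * (\<Sum>g\<leftarrow>gs. f (g \<otimes>\<^bsub>G\<^esub> x))"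
    using assms unfolding dominated_def by auto
  then have "\<bar>a * \<phi> x\<bar> \<le> (\<bar>a\<bar> * c) * (\<Sum>g\<leftarrow>gs. f (g \<otimes>\<^bsub>G\<^esub> x))" if "x \<in> carrier G" for x
    using that by (simp add: abs_mult mult.assoc mult_left_mono)
  moreover have "ruc G T (\<lambda>x. a * \<phi> x)" using assms by (auto simp: dominated_def intro: ruc_scale)
  moreover have "\<bar>a\<bar> * c \<ge> 0" using 1 by simp
  ultimately show ?thesis using 1(2) unfolding dominated_def by blast
qed

lemma self_dominated:
  assumes "group G" "ruc G T f" "\<And>x. x \<in> carrier G \<Longrightarrow> 0 \<le> f x"
  shows "f \<in> dominated G T f"
proof -
  interpret group G by fact
  have "\<forall>x\<in>carrier G. \<bar>f x\<bar> \<le> 1 * (\<Sum>g\<leftarrow>[\<one>\<^bsub>G\<^esub>]. f (g \<otimes>\<^bsub>G\<^esub> x))"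
    using assms by auto
  moreover have "set [\<one>\<^bsub>G\<^esub>] \<subseteq> carrier G" by simp
  ultimately show ?thesis
    using assms(2) zero_le_one unfolding dominated_def by blast
qed

text \<open>Write g a x as (g a g^-1) (g x): the neighbourhood for the translate is the preimage of
  \<open>V\<close> under conjugation by \<open>g\<close>. The hypothesis is continuity of
  conjugation alone, which for a quotient group follows directly from the quotient map.\<close>

lemma ruc_left_translate:
  assumes "group G" "topspace T = carrier G" "g \<in> carrier G"
    and conj: "continuous_map T T (\<lambda>x. g \<otimes>\<^bsub>G\<^esub> x \<otimes>\<^bsub>G\<^esub> inv\<^bsub>G\<^esub> g)"
    and "ruc G T \<phi>"
  shows "ruc G T (left_translate G g \<phi>)"
  unfolding ruc_def
proof (intro conjI allI impI)
  interpret group G by fact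
  show "\<exists>B. \<forall>x\<in>carrier G. \<bar>left_translate G g \<phi> x\<bar> \<le> B"
    using assms(3,5) by (auto simp: ruc_def left_translate_def)
  fix e :: real assume "e > 0"
  then obtain V where V: "openin T V" "\<one>\<^bsub>G\<^esub> \<in> V"
    "\<And>a x. a \<in> V \<Longrightarrow> x \<in> carrier G \<Longrightarrow> \<bar>\<phi> (a \<otimes>\<^bsub>G\<^esub> x) - \<phi> x\<bar> < e"
    using assms(5) unfolding ruc_def by meson
  define W where "W = {a \<in> topspace T. g \<otimes>\<^bsub>G\<^esub> a \<otimes>\<^bsub>G\<^esub> inv\<^bsub>G\<^esub> g \<in> V}"
  have "openin T W" unfolding W_def by (rule openin_continuous_map_preimage[OF conj V(1)])
  moreover have "\<one>\<^bsub>G\<^esub> \<in> W" using V assms(2,3) by (simp add: W_def)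
  moreover have "\<bar>left_translate G g \<phi> (a \<otimes>\<^bsub>G\<^esub> x) - left_translate G g \<phi> x\<bar> < e"
    if "a \<in> W" "x \<in> carrier G" for a x
  proof -
    have a: "a \<in> carrier G" using that assms(2) by (simp add: W_def)
    have "(g \<otimes>\<^bsub>G\<^esub> a \<otimes>\<^bsub>G\<^esub> inv\<^bsub>G\<^esub> g) \<otimes>\<^bsub>G\<^esub> (g \<otimes>\<^bsub>G\<^esub> x) = g \<otimes>\<^bsub>G\<^esub> a \<otimes>\<^bsub>G\<^esub> (inv\<^bsub>G\<^esub> g \<otimes>\<^bsub>G\<^esub> (g \<otimes>\<^bsub>G\<^esub> x))"
      using a that(2) assms(3) by (simp add: m_assoc)
    also have "inv\<^bsub>G\<^esub> g \<otimes>\<^bsub>G\<^esub> (g \<otimes>\<^bsub>G\<^esub> x) = x"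
      using that(2) assms(3) by (simp add: m_assoc[symmetric])
    finally have "(g \<otimes>\<^bsub>G\<^esub> a \<otimes>\<^bsub>G\<^esub> inv\<^bsub>G\<^esub> g) \<otimes>\<^bsub>G\<^esub> (g \<otimes>\<^bsub>G\<^esub> x) = g \<otimes>\<^bsub>G\<^esub> (a \<otimes>\<^bsub>G\<^esub> x)"
      using a that(2) assms(3) by (simp add: m_assoc)
    then show ?thesis
      using V(3)[of "g \<otimes>\<^bsub>G\<^esub> a \<otimes>\<^bsub>G\<^esub> inv\<^bsub>G\<^esub> g" "g \<otimes>\<^bsub>G\<^esub> x"] a that assms(3)
      by (simp add: left_translate_def W_def)
  qed
  ultimately show "\<exists>V. openin T V \<and> \<one>\<^bsub>G\<^esub> \<in> V \<and> (\<forall>a\<in>V. \<forall>x\<in>carrier G.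
      \<bar>left_translate G g \<phi> (a \<otimes>\<^bsub>G\<^esub> x) - left_translate G g \<phi> x\<bar> < e)"
    by blast
qed

lemma dominated_left_translate:
  assumes "group G" "topspace T = carrier G" "g \<in> carrier G"
    and conj: "continuous_map T T (\<lambda>x. g \<otimes>\<^bsub>G\<^esub> x \<otimes>\<^bsub>G\<^esub> inv\<^bsub>G\<^esub> g)"
    and "\<phi> \<in> dominated G T f"
  shows "left_translate G g \<phi> \<in> dominated G T f"
proof -
  interpret group G by fact
  obtain c gs where 1: "c \<ge> 0" "set gs \<subseteq> carrier G"
    "\<And>x. x \<in> carrier G \<Longrightarrow> \<bar>\<phi> x\<bar> \<le> c * (\<Sum>g\<leftarrow>gs. f (g \<otimes>\<^bsub>G\<^esub> x))"
    using assms(5) unfolding dominated_def by auto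
  have "\<bar>left_translate G g \<phi> x\<bar> \<le> c * (\<Sum>h\<leftarrow>map (\<lambda>h. h \<otimes>\<^bsub>G\<^esub> g) gs. f (h \<otimes>\<^bsub>G\<^esub> x))"
    if x: "x \<in> carrier G" for x
  proof -
    have "(\<Sum>h\<leftarrow>gs. f (h \<otimes>\<^bsub>G\<^esub> (g \<otimes>\<^bsub>G\<^esub> x))) = (\<Sum>h\<leftarrow>map (\<lambda>h. h \<otimes>\<^bsub>G\<^esub> g) gs. f (h \<otimes>\<^bsub>G\<^esub> x))"
      unfolding map_map o_def
      using 1(2) x assms(3) by (intro arg_cong[of _ _ sum_list] map_cong refl) (auto simp: m_assoc subset_iff)
    then show ?thesis using 1(3)[of "g \<otimes>\<^bsub>G\<^esub> x"] x assms(3) by (simp add: left_translate_def)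
  qed
  moreover have "set (map (\<lambda>h. h \<otimes>\<^bsub>G\<^esub> g) gs) \<subseteq> carrier G" using 1(2) assms(3) by auto
  moreover have "ruc G T (left_translate G g \<phi>)"
    using assms(5) by (intro ruc_left_translate[OF assms(1-4)]) (simp add: dominated_def)
  ultimately show ?thesis using 1(1) unfolding dominated_def by blast
qed

lemma positive_functional_add:
  "positive_functional G T f J \<Longrightarrow> \<phi> \<in> dominated G T f \<Longrightarrow> \<psi> \<in> dominated G T f \<Longrightarrow>
    J (\<lambda>x. \<phi> x + \<psi> x) = J \<phi> + J \<psi>"
  by (simp add: positive_functional_def)

lemma positive_functional_scale:
  "positive_functional G T f J \<Longrightarrow> \<phi> \<in> dominated G T f \<Longrightarrow> J (\<lambda>x. c * \<phi> x) = c * J \<phi>"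
  by (simp add: positive_functional_def)

lemma positive_functional_nonneg:
  "positive_functional G T f J \<Longrightarrow> \<phi> \<in> dominated G T f \<Longrightarrow>
    (\<And>x. x \<in> carrier G \<Longrightarrow> 0 \<le> \<phi> x) \<Longrightarrow> 0 \<le> J \<phi>"
  by (simp add: positive_functional_def)

lemma left_invariantD:
  "left_invariant G T f J \<Longrightarrow> \<phi> \<in> dominated G T f \<Longrightarrow> g \<in> carrier G \<Longrightarrow>
    J (left_translate G g \<phi>) = J \<phi>"
  by (simp add: left_invariant_def)

lemma positive_functional_mono:
  assumes G: "group G" and J: "positive_functional G T f J" and f: "\<And>x. x \<in> carrier G \<Longrightarrow> 0 \<le> f x"
    and D: "\<phi> \<in> dominated G T f" "\<psi> \<in> dominated G T f"
    and le: "\<And>x. x \<in> carrier G \<Longrightarrow> \<phi> x \<le> \<psi> x"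
  shows "J \<phi> \<le> J \<psi>"
proof -
  have *: "(\<lambda>x. - 1 * \<phi> x) \<in> dominated G T f" using D(1) by (rule dominated_scale)
  have "(\<lambda>x. \<psi> x + - 1 * \<phi> x) \<in> dominated G T f" by (rule dominated_add[OF G f D(2) *])
  then have "0 \<le> J (\<lambda>x. \<psi> x + - 1 * \<phi> x)" by (rule positive_functional_nonneg[OF J]) (simp add: le)
  also have "\<dots> = J \<psi> + J (\<lambda>x. - 1 * \<phi> x)" by (rule positive_functional_add[OF J D(2) *])
  also have "J (\<lambda>x. - 1 * \<phi> x) = - 1 * J \<phi>" by (rule positive_functional_scale[OF J D(1)])
  finally show ?thesis by simp
qed

text \<open>Monotonicity in both directions. It lets values off the carrier be ignored, where
  functions that represent the same object may differ.\<close>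

lemma positive_functional_cong:
  assumes "group G" "positive_functional G T f J" "\<And>x. x \<in> carrier G \<Longrightarrow> 0 \<le> f x"
    and "\<phi> \<in> dominated G T f" "\<psi> \<in> dominated G T f"
    and "\<And>x. x \<in> carrier G \<Longrightarrow> \<phi> x = \<psi> x"
  shows "J \<phi> = J \<psi>"
  using assms by (intro antisym positive_functional_mono[OF assms(1-3)]) auto

lemma positive_functional_sum_list:
  assumes G: "group G" and J: "positive_functional G T f J" and f: "\<And>x. x \<in> carrier G \<Longrightarrow> 0 \<le> f x"
    and "ruc G T f" and D: "\<And>i. i \<in> set is \<Longrightarrow> \<phi> i \<in> dominated G T f"
  shows "(\<lambda>x. \<Sum>i\<leftarrow>is. \<phi> i x) \<in> dominated G T f \<and> J (\<lambda>x. \<Sum>i\<leftarrow>is. \<phi> i x) = (\<Sum>i\<leftarrow>is. J (\<phi> i))"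
  using D
proof (induction "is")
  case Nil
  \<comment> \<open>The empty sum is the zero function, which is known to be dominated as 0 times
    \<open>f\<close>.\<close>
  have f': "f \<in> dominated G T f" using assms by (intro self_dominated)
  have "J (\<lambda>x. 0 * f x) = 0 * J f" by (rule positive_functional_scale[OF J f'])
  then show ?case using dominated_scale[OF f', of 0] by simp
next
  case (Cons i "is")
  then have 1: "(\<lambda>x. \<Sum>i\<leftarrow>is. \<phi> i x) \<in> dominated G T f" "\<phi> i \<in> dominated G T f"
    "J (\<lambda>x. \<Sum>i\<leftarrow>is. \<phi> i x) = (\<Sum>i\<leftarrow>is. J (\<phi> i))" by auto
  show ?case
    using dominated_add[OF G f 1(2,1)] positive_functional_add[OF J 1(2,1)] 1(3) by simp
qed

section \<open>From invariant functionals to fixed points\<close>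

lemma sum_list_fun_apply: "(\<Sum>g\<leftarrow>gs. F g) x = (\<Sum>g\<leftarrow>gs. (F g x :: real))"
  by (induction gs) auto

text \<open>The fixed vector is the point of \<open>C\<close> that represents l \<mapsto> J (coef
  l). It is non-zero because \<open>m\<close> takes the value \<open>J ?f = 1\<close> there, and
  fixed because continuous functionals separate points.\<close>

lemma invariant_functionals_imp_fixed_point_property:
  fixes G :: "('g, 'b) monoid_scheme" and TG :: "'g topology"
  assumes "group G" and top: "topspace TG = carrier G" and inv: "invariant_functionals G TG"
  shows "fixed_point_property_for_cones TYPE('e::real_vector) G TG"
  unfolding fixed_point_property_for_cones_def
proof (intro allI impI, elim conjE)
  interpret group G by fact
  fix T :: "'e topology" and C \<pi>
  assume T: "locally_convex_space T" and "proper_cone C" and wc: "weakly_complete T C"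
    and rep: "cone_representation G T C \<pi>" and "locally_bounded_ruc G TG T C \<pi>"
    and "cobounded_type G T C \<pi>"
  from \<open>proper_cone C\<close> have cone: "convex_cone C" by (simp add: proper_cone_def)
  have \<pi>_lin: "linear (\<pi> g)" and \<pi>_cont: "continuous_map T T (\<pi> g)"
    and \<pi>_C: "c \<in> C \<Longrightarrow> \<pi> g c \<in> C" if "g \<in> carrier G" for g c
    using rep that by (auto simp: cone_representation_def)
  have \<pi>_mult: "\<pi> (g \<otimes>\<^bsub>G\<^esub> h) x = \<pi> g (\<pi> h x)" if "g \<in> carrier G" "h \<in> carrier G" for g h x
    using rep that by (auto simp: cone_representation_def)
  have topT: "topspace T = UNIV" using T by (simp add: locally_convex_space_def)
  let ?E = "topological_dual T"
  have dual_\<pi>: "(\<lambda>x. l (\<pi> g x)) \<in> ?E" if "l \<in> ?E" "g \<in> carrier G" for l g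
    using that linear_compose[OF \<pi>_lin[OF that(2)], of l] continuous_map_compose[OF \<pi>_cont[OF that(2)], of _ l]
    by (auto simp: topological_dual_def o_def)
  obtain x0 where x0: "x0 \<in> C" "x0 \<noteq> 0" and bounded: "bounded_subset T ((\<lambda>g. \<pi> g x0) ` carrier G)"
    and uc: "\<And>U. openin T U \<Longrightarrow> 0 \<in> U \<Longrightarrow> \<exists>V. openin TG V \<and> \<one>\<^bsub>G\<^esub> \<in> V \<and>
           (\<forall>a \<in> V. \<forall>g \<in> carrier G. \<pi> (a \<otimes>\<^bsub>G\<^esub> g) x0 - \<pi> g x0 \<in> U)"
    using \<open>locally_bounded_ruc G TG T C \<pi>\<close> unfolding locally_bounded_ruc_def by blast
  obtain l0 where l0: "l0 \<in> ?E" and l0_dom: "\<And>l. l \<in> ?E \<Longrightarrow> \<exists>gs. set gs \<subseteq> carrier G \<and>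
         dual_le C l (\<Sum>g\<leftarrow>gs. adjoint_rep G \<pi> g l0) \<and> dual_le C (- l) (\<Sum>g\<leftarrow>gs. adjoint_rep G \<pi> g l0)"
    using \<open>cobounded_type G T C \<pi>\<close> unfolding cobounded_type_def by blast
  have dom0: "\<exists>gs. set gs \<subseteq> carrier G \<and> (\<forall>c\<in>C. \<bar>l c\<bar> \<le> (\<Sum>g\<leftarrow>gs. l0 (\<pi> (inv\<^bsub>G\<^esub> g) c)))"
    if "l \<in> ?E" for l
    using l0_dom[OF that] unfolding dual_le_def sum_list_fun_apply adjoint_rep_def
    by (auto simp: abs_le_iff)
  obtain gs0 where gs0: "set gs0 \<subseteq> carrier G"
    "\<And>c. c \<in> C \<Longrightarrow> \<bar>l0 c\<bar> \<le> (\<Sum>g\<leftarrow>gs0. l0 (\<pi> (inv\<^bsub>G\<^esub> g) c))"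
    using dom0[OF l0] by blast
  \<comment> \<open>\<open>l0\<close> may take negative values on \<open>C\<close>. Cobounded type
    applied to \<open>l0\<close> itself gives a sum of its translates above \<bar>l0\<bar> on
    \<open>C\<close>; this sum is non-negative there and dominates, after translation, every
    functional.\<close>
  define m where "m c = (\<Sum>g\<leftarrow>gs0. l0 (\<pi> (inv\<^bsub>G\<^esub> g) c))" for c
  have m: "m \<in> ?E"
  proof -
    have "(\<lambda>c. \<Sum>g\<leftarrow>gs. l0 (\<pi> (inv\<^bsub>G\<^esub> g) c)) \<in> ?E" if "set gs \<subseteq> carrier G" for gs
      using that
    proof (induction gs)
      case (Cons g gs)
      then show ?case using topological_dual_add[OF dual_\<pi>[OF l0]] by simp
    qed (simp add: topological_dual_zero)
    then show ?thesis using gs0(1) by (simp add: m_def[abs_def])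
  qed
  have m_ge: "l0 c \<le> m c" "0 \<le> m c" if "c \<in> C" for c
    using gs0(2)[OF that] by (auto simp: m_def)
  have dom: "\<exists>gs. set gs \<subseteq> carrier G \<and> (\<forall>c\<in>C. \<bar>l c\<bar> \<le> (\<Sum>g\<leftarrow>gs. m (\<pi> g c)))" if l: "l \<in> ?E" for l
  proof -
    obtain gs where gs: "set gs \<subseteq> carrier G" "\<And>c. c \<in> C \<Longrightarrow> \<bar>l c\<bar> \<le> (\<Sum>g\<leftarrow>gs. l0 (\<pi> (inv\<^bsub>G\<^esub> g) c))"
      using dom0[OF l] by blast
    have "\<bar>l c\<bar> \<le> (\<Sum>g\<leftarrow>map (\<lambda>g. inv\<^bsub>G\<^esub> g) gs. m (\<pi> g c))" if "c \<in> C" for c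
    proof -
      have "(\<Sum>g\<leftarrow>gs. l0 (\<pi> (inv\<^bsub>G\<^esub> g) c)) \<le> (\<Sum>g\<leftarrow>gs. m (\<pi> (inv\<^bsub>G\<^esub> g) c))"
        using gs(1) that by (intro sum_list_mono m_ge \<pi>_C) auto
      with gs(2)[OF that] show ?thesis by (simp add: o_def)
    qed
    moreover have "set (map (\<lambda>g. inv\<^bsub>G\<^esub> g) gs) \<subseteq> carrier G" using gs(1) by auto
    ultimately show ?thesis by blast
  qed
  define coef where "coef l x = l (\<pi> x x0)" for l :: "'e \<Rightarrow> real" and x
  have coef_ruc: "ruc G TG (coef l)" if l: "l \<in> ?E" for l
    unfolding ruc_def
  proof (intro conjI allI impI)
    have lin: "linear l" using l by (simp add: topological_dual_def)
    have nbhd: "openin T {y. \<bar>l y\<bar> < e}" "0 \<in> {y. \<bar>l y\<bar> < e}" if "e > 0" for e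
    proof -
      have "openin T {y \<in> topspace T. l y \<in> {-e<..<e}}"
        using l by (intro openin_continuous_map_preimage[of T euclideanreal]) (auto simp: topological_dual_def)
      then show "openin T {y. \<bar>l y\<bar> < e}" by (simp add: topT abs_less_iff conj_commute minus_less_iff)
      show "0 \<in> {y. \<bar>l y\<bar> < e}" using that lin by (simp add: linear_0)
    qed
    \<comment> \<open>The orbit is absorbed by the neighbourhood \<bar>l\<bar> < 1, and the
      absorption factor bounds the coefficient.\<close>
    obtain s where s: "s > 0" "(\<lambda>g. \<pi> g x0) ` carrier G \<subseteq> (\<lambda>x. s *\<^sub>R x) ` {y. \<bar>l y\<bar> < 1}"
      using bounded nbhd[of 1] unfolding bounded_subset_def by auto
    have "\<bar>coef l x\<bar> \<le> s" if x: "x \<in> carrier G" for x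
    proof -
      obtain y where "\<pi> x x0 = s *\<^sub>R y" "\<bar>l y\<bar> < 1"
        using subsetD[OF s(2) imageI[OF x]] by (auto simp only: image_iff mem_Collect_eq)
      then show ?thesis using s(1) lin by (simp add: coef_def linear_cmul abs_mult)
    qed
    then show "\<exists>B. \<forall>x\<in>carrier G. \<bar>coef l x\<bar> \<le> B" by blast
    fix e :: real assume "e > 0"
    show "\<exists>V. openin TG V \<and> \<one>\<^bsub>G\<^esub> \<in> V \<and> (\<forall>a\<in>V. \<forall>x\<in>carrier G. \<bar>coef l (a \<otimes>\<^bsub>G\<^esub> x) - coef l x\<bar> < e)"
      using uc[OF nbhd[OF \<open>e > 0\<close>]] lin by (simp add: coef_def linear_diff)
  qed
  let ?f = "coef m"
  have f_nonneg: "0 \<le> ?f x" if "x \<in> carrier G" for x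
    using that x0 by (simp add: coef_def m_ge \<pi>_C)
  have coef_dom: "coef l \<in> dominated G TG ?f" if l: "l \<in> ?E" for l
  proof -
    obtain gs where gs: "set gs \<subseteq> carrier G" "\<And>c. c \<in> C \<Longrightarrow> \<bar>l c\<bar> \<le> (\<Sum>g\<leftarrow>gs. m (\<pi> g c))"
      using dom[OF l] by blast
    have "\<bar>coef l x\<bar> \<le> 1 * (\<Sum>g\<leftarrow>gs. ?f (g \<otimes>\<^bsub>G\<^esub> x))" if "x \<in> carrier G" for x
    proof -
      have "(\<Sum>g\<leftarrow>gs. m (\<pi> g (\<pi> x x0))) = (\<Sum>g\<leftarrow>gs. ?f (g \<otimes>\<^bsub>G\<^esub> x))"
        using gs(1) that
        by (intro arg_cong[of _ _ sum_list] map_cong refl) (auto simp: coef_def \<pi>_mult subset_iff)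
      with gs(2)[OF \<pi>_C[OF that x0(1)]] show ?thesis by (simp add: coef_def)
    qed
    with gs(1) coef_ruc[OF l] show ?thesis unfolding dominated_def by (blast intro: zero_le_one)
  qed
  \<comment> \<open>If \<open>?f\<close> vanished on the carrier, domination would make every
    continuous functional vanish at \<open>x0\<close>, against separation of points.\<close>
  have "\<exists>x\<in>carrier G. ?f x \<noteq> 0"
  proof (rule ccontr)
    assume "\<not> ?thesis"
    then have 0: "m (\<pi> x x0) = 0" if "x \<in> carrier G" for x using that by (auto simp: coef_def)
    obtain l where l: "l \<in> ?E" "l x0 \<noteq> 0" using topological_dual_separates[OF T x0(2)] by blast
    obtain gs where gs: "set gs \<subseteq> carrier G" "\<And>c. c \<in> C \<Longrightarrow> \<bar>l c\<bar> \<le> (\<Sum>g\<leftarrow>gs. m (\<pi> g c))"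
      using dom[OF l(1)] by blast
    have "(\<Sum>g\<leftarrow>gs. m (\<pi> g x0)) = (\<Sum>g\<leftarrow>gs. 0)"
      using gs(1) 0 by (intro arg_cong[of _ _ sum_list] map_cong refl) auto
    then show False using gs(2)[OF x0(1)] l(2) by simp
  qed
  then obtain J where J: "positive_functional G TG ?f J" "left_invariant G TG ?f J" "J ?f = 1"
    using inv coef_ruc[OF m] f_nonneg unfolding invariant_functionals_def by blast
  interpret positive_dual_functional T C "\<lambda>l. J (coef l)"
  proof
    show "convex_cone C" by (rule cone)
    fix l m c assume l: "l \<in> ?E"
    show "J (coef (\<lambda>x. c * l x)) = c * J (coef l)"
      using positive_functional_scale[OF J(1) coef_dom[OF l]] by (simp add: coef_def[abs_def])
    show "J (coef (\<lambda>x. l x + m x)) = J (coef l) + J (coef m)" if "m \<in> ?E"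
      using positive_functional_add[OF J(1) coef_dom[OF l] coef_dom[OF that]] by (simp add: coef_def[abs_def])
    show "0 \<le> J (coef l)" if "\<And>c. c \<in> C \<Longrightarrow> 0 \<le> l c"
      using that \<pi>_C x0(1) by (intro positive_functional_nonneg[OF J(1) coef_dom[OF l]]) (simp add: coef_def)
  qed
  obtain c where c: "c \<in> C" "\<And>l. l \<in> ?E \<Longrightarrow> l c = J (coef l)" using representation[OF wc] by blast
  have "c \<noteq> 0"
  proof
    assume "c = 0"
    then have "m c = 0" using m by (simp add: topological_dual_def linear_0)
    then show False using c(2)[OF m] J(3) by simp
  qed
  moreover have "\<pi> g c = c" if g: "g \<in> carrier G" for g
  proof (rule ccontr)
    assume "\<pi> g c \<noteq> c"
    then obtain l where l: "l \<in> ?E" "l (\<pi> g c - c) \<noteq> 0"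
      using topological_dual_separates[OF T, of "\<pi> g c - c"] by auto
    let ?l = "\<lambda>x. l (\<pi> g x)"
    \<comment> \<open>Composing l with \<pi> g translates its coefficient. The identity is
      guaranteed on the carrier only, hence the passage through
      \<open>positive_functional_cong\<close>.\<close>
    have eq: "coef ?l x = left_translate G g (coef l) x" if "x \<in> carrier G" for x
      using that g by (simp add: coef_def left_translate_def \<pi>_mult)
    have "J (coef ?l) = J (left_translate G g (coef l))"
      using dominated_cong[OF \<open>group G\<close> top eq coef_dom[OF dual_\<pi>[OF l(1) g]]]
      by (intro positive_functional_cong[OF \<open>group G\<close> J(1) f_nonneg coef_dom[OF dual_\<pi>[OF l(1) g]] _ eq])
    also have "\<dots> = J (coef l)"
      by (rule left_invariantD[OF J(2) coef_dom[OF l(1)] g])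
    finally have "l (\<pi> g c) = l c" using c(2)[OF dual_\<pi>[OF l(1) g]] c(2)[OF l(1)] by simp
    then show False using l by (simp add: topological_dual_def linear_diff)
  qed
  ultimately show "\<exists>x\<in>C. x \<noteq> 0 \<and> (\<forall>g\<in>carrier G. \<pi> g x = x)" using c(1) by blast
qed

section \<open>The product topology on real functions as a locally convex space\<close>

lemma real_product_topology_nbhd:
  assumes "openin (powertop_real UNIV) U" "0 \<in> U"
  obtains J e where "finite J" "e > 0" "{\<Phi>. \<forall>i\<in>J. \<bar>\<Phi> i\<bar> < e} \<subseteq> U"
proof -
  obtain X where X: "0 \<in> PiE UNIV X" "\<And>i. open (X i)" "finite {i. X i \<noteq> UNIV}" "PiE UNIV X \<subseteq> U"
    using product_topology_open_contains_basis[OF assms] by auto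
  define J where "J = {i. X i \<noteq> UNIV}"
  have "\<exists>d>0. ball 0 d \<subseteq> X i" for i
  proof -
    have "0 \<in> X i" using X(1) by (auto simp: PiE_def Pi_def)
    from openE[OF X(2) this] show ?thesis by blast
  qed
  then obtain d where d: "\<And>i. d i > 0" "\<And>i. ball 0 (d i) \<subseteq> X i" by metis
  \<comment> \<open>The inserted 1 keeps the minimum meaningful when \<open>J\<close> is
    empty.\<close>
  define e where "e = Min (insert 1 (d ` J))"
  have e: "e > 0" "e \<le> d i" if "i \<in> J" for i
    using that X(3) d(1) by (auto simp: e_def J_def)
  have "e > 0" using X(3) d(1) by (auto simp: e_def J_def)
  moreover have "{\<Phi>. \<forall>i\<in>J. \<bar>\<Phi> i\<bar> < e} \<subseteq> U"
  proof
    fix \<Phi> :: "'a \<Rightarrow> real" assume \<Phi>: "\<Phi> \<in> {\<Phi>. \<forall>i\<in>J. \<bar>\<Phi> i\<bar> < e}"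
    have "\<Phi> i \<in> X i" for i
    proof (cases "i \<in> J")
      case True
      then have "\<Phi> i \<in> ball 0 (d i)" using \<Phi> e(2)[OF True] by (force simp: dist_real_def)
      then show ?thesis using d(2) by blast
    qed (simp add: J_def)
    then show "\<Phi> \<in> U" using X(4) by (auto simp: PiE_def)
  qed
  moreover have "finite J" using X(3) by (simp add: J_def)
  ultimately show ?thesis by (intro that)
qed

lemma openin_real_product_topology_nbhd:
  assumes "finite J"
  shows "openin (powertop_real UNIV) {\<Phi>. \<forall>i\<in>J. \<bar>\<Phi> i\<bar> < e}"
proof -
  have "openin (powertop_real UNIV) {\<Phi>. \<bar>\<Phi> i\<bar> < e}" for i
  proof -
    have "openin (powertop_real UNIV) {\<Phi> \<in> topspace (powertop_real UNIV). \<Phi> i \<in> {- e<..<e}}"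
      by (intro openin_continuous_map_preimage[of _ euclideanreal] continuous_map_product_projection) auto
    moreover have "{\<Phi> \<in> topspace (powertop_real UNIV). \<Phi> i \<in> {- e<..<e}} = {\<Phi>. \<bar>\<Phi> i\<bar> < e}" by auto
    ultimately show ?thesis by simp
  qed
  note * = this
  show ?thesis using assms
  proof induction
    case empty
    then show ?case using openin_topspace[of "powertop_real UNIV"] by simp
  next
    case (insert i J)
    have "{\<Phi>. \<forall>j\<in>insert i J. \<bar>\<Phi> j\<bar> < e} = {\<Phi>. \<bar>\<Phi> i\<bar> < e} \<inter> {\<Phi>. \<forall>j\<in>J. \<bar>\<Phi> j\<bar> < e}" by auto
    then show ?case using openin_Int[OF *[of i] insert.IH] by simp
  qed
qed

lemma locally_convex_real_product_topology:
  "locally_convex_space (powertop_real UNIV :: ('i \<Rightarrow> real) topology)"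
  unfolding locally_convex_space_def
proof (intro conjI allI impI)
  let ?T = "powertop_real UNIV :: ('i \<Rightarrow> real) topology"
  show "topspace ?T = UNIV" by simp
  show "Hausdorff_space ?T" unfolding Hausdorff_space_product_topology by simp
  have proj: "continuous_map ?T euclideanreal (\<lambda>\<Phi>. \<Phi> k)" for k
    by (rule continuous_map_product_projection) simp
  have 1: "continuous_map (prod_topology ?T ?T) euclideanreal (\<lambda>p. fst p k)" for k
    using continuous_map_compose[OF continuous_map_fst proj] by (simp add: o_def)
  have 2: "continuous_map (prod_topology Y ?T) euclideanreal (\<lambda>p. snd p k)" for k and Y :: "'c topology"
    using continuous_map_compose[OF continuous_map_snd proj] by (simp add: o_def)
  show "continuous_map (prod_topology ?T ?T) ?T (\<lambda>(x, y). x + y)"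
    unfolding continuous_map_componentwise_UNIV
    using continuous_map_add[OF 1 2] by (simp add: case_prod_unfold)
  show "continuous_map (prod_topology euclideanreal ?T) ?T (\<lambda>(r, x). r *\<^sub>R x)"
    unfolding continuous_map_componentwise_UNIV
    using continuous_map_real_mult[OF continuous_map_fst 2] by (simp add: case_prod_unfold scaleR_fun_def)
  fix U assume U: "openin ?T U \<and> 0 \<in> U"
  obtain J e where J: "finite J" "e > 0" "{\<Phi>. \<forall>i\<in>J. \<bar>\<Phi> i\<bar> < e} \<subseteq> U"
    by (rule real_product_topology_nbhd[OF conjunct1[OF U] conjunct2[OF U]])
  have "convex {\<Phi> :: 'i \<Rightarrow> real. \<forall>i\<in>J. \<bar>\<Phi> i\<bar> < e}"
  proof (rule convexI, clarify)
    fix x y :: "'i \<Rightarrow> real" and u v :: real and i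
    assume "\<forall>i\<in>J. \<bar>x i\<bar> < e" "\<forall>i\<in>J. \<bar>y i\<bar> < e" "0 \<le> u" "0 \<le> v" "u + v = 1" "i \<in> J"
    then have "x i \<in> {- e<..<e}" "y i \<in> {- e<..<e}" by force+
    then have "u *\<^sub>R x i + v *\<^sub>R y i \<in> {- e<..<e}"
      using \<open>0 \<le> u\<close> \<open>0 \<le> v\<close> \<open>u + v = 1\<close> by (intro convexD) auto
    then show "\<bar>(u *\<^sub>R x + v *\<^sub>R y) i\<bar> < e" by (auto simp: scaleR_fun_def)
  qed
  moreover have "0 \<in> {\<Phi> :: 'i \<Rightarrow> real. \<forall>i\<in>J. \<bar>\<Phi> i\<bar> < e}" using J by simp
  ultimately show "\<exists>V. openin ?T V \<and> 0 \<in> V \<and> convex V \<and> V \<subseteq> U"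
    using openin_real_product_topology_nbhd[OF J(1)] J(3) by blast
qed

text \<open>A continuous functional is bounded on a basic neighbourhood, which restricts finitely
  many coordinates; by scaling, these coordinates control it. Cobounded type on the product space
  thus reduces to finitely many test functions.\<close>

lemma real_product_dual_bound:
  assumes "l \<in> topological_dual (powertop_real UNIV)"
  shows "\<exists>J c. finite J \<and> c \<ge> 0 \<and> (\<forall>\<Phi>. \<bar>l \<Phi>\<bar> \<le> c * (\<Sum>i\<in>J. \<bar>\<Phi> i\<bar>))"
proof -
  have lin: "linear l" and cont: "continuous_map (powertop_real UNIV) euclideanreal l"
    using assms by (auto simp: topological_dual_def)
  have 1: "openin (powertop_real UNIV) {\<Phi> \<in> topspace (powertop_real UNIV). l \<Phi> \<in> {-1<..<1}}"
    by (rule openin_continuous_map_preimage[OF cont]) auto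
  have 2: "0 \<in> {\<Phi> \<in> topspace (powertop_real UNIV). l \<Phi> \<in> {-1<..<1}}"
    using lin by (simp add: linear_0)
  obtain J e where J: "finite J" "e > 0"
    "{\<Phi>. \<forall>i\<in>J. \<bar>\<Phi> i\<bar> < e} \<subseteq> {\<Phi> \<in> topspace (powertop_real UNIV). l \<Phi> \<in> {-1<..<1}}"
    by (rule real_product_topology_nbhd[OF 1 2])
  have small: "\<bar>l \<Phi>\<bar> \<le> 1" if "\<And>i. i \<in> J \<Longrightarrow> \<bar>\<Phi> i\<bar> < e" for \<Phi>
  proof -
    have "\<Phi> \<in> {\<Phi>. \<forall>i\<in>J. \<bar>\<Phi> i\<bar> < e}" using that by simp
    then have "l \<Phi> \<in> {-1<..<1}" using J(3) by blast
    then show ?thesis by (simp add: abs_le_iff)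
  qed
  have "\<bar>l \<Phi>\<bar> \<le> (1/e) * (\<Sum>i\<in>J. \<bar>\<Phi> i\<bar>)" for \<Phi>
  proof (rule field_le_epsilon)
    fix d :: real assume "d > 0"
    \<comment> \<open>The extra term keeps s positive and strictly above each coordinate; it
      contributes only the arbitrary d to the final bound.\<close>
    define s where "s = (\<Sum>i\<in>J. \<bar>\<Phi> i\<bar>) + e * d"
    have s: "s > 0" using J(2) \<open>d > 0\<close> by (simp add: s_def add_nonneg_pos sum_nonneg)
    have "\<bar>l ((e/s) *\<^sub>R \<Phi>)\<bar> \<le> 1"
    proof (rule small)
      fix i assume "i \<in> J"
      then have "\<bar>\<Phi> i\<bar> \<le> (\<Sum>i\<in>J. \<bar>\<Phi> i\<bar>)" using J(1) by (intro member_le_sum) auto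
      then have "\<bar>\<Phi> i\<bar> < s" using mult_pos_pos[OF J(2) \<open>d > 0\<close>] unfolding s_def by linarith
      then show "\<bar>((e/s) *\<^sub>R \<Phi>) i\<bar> < e"
        using s J(2) by (simp add: scaleR_fun_def abs_mult field_simps)
    qed
    then have "(e/s) * \<bar>l \<Phi>\<bar> \<le> 1" using lin s J(2) by (simp add: linear_cmul abs_mult)
    then have "\<bar>l \<Phi>\<bar> \<le> s / e" using s J(2) by (simp add: field_simps)
    also have "s / e = (1/e) * (\<Sum>i\<in>J. \<bar>\<Phi> i\<bar>) + d" using J(2) by (simp add: s_def field_simps)
    finally show "\<bar>l \<Phi>\<bar> \<le> (1/e) * (\<Sum>i\<in>J. \<bar>\<Phi> i\<bar>) + d" .
  qed
  then show ?thesis using J(1,2) by (intro exI[of _ J] exI[of _ "1/e"]) auto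
qed

lemma real_product_projection_dual: "(\<lambda>\<Phi>. \<Phi> i) \<in> topological_dual (powertop_real UNIV)"
proof -
  have "linear (\<lambda>\<Phi> :: 'a \<Rightarrow> real. \<Phi> i)" by (rule linearI) (simp_all add: scaleR_fun_def)
  then show ?thesis
    by (auto simp: topological_dual_def intro: continuous_map_product_projection)
qed

text \<open>Monotonicity between - c s and c s, where s is the sum of the translates of
  \<open>f\<close>. Thus the values at translates of \<open>f\<close> control all others.\<close>

lemma positive_functional_bound:
  assumes G: "group G" and top: "topspace T = carrier G"
    and conj: "\<And>g. g \<in> carrier G \<Longrightarrow> continuous_map T T (\<lambda>x. g \<otimes>\<^bsub>G\<^esub> x \<otimes>\<^bsub>G\<^esub> inv\<^bsub>G\<^esub> g)"
    and f: "ruc G T f" "\<And>x. x \<in> carrier G \<Longrightarrow> 0 \<le> f x"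
    and J: "positive_functional G T f J" and \<phi>: "ruc G T \<phi>" and 1: "c \<ge> 0" "set gs \<subseteq> carrier G"
    "\<And>x. x \<in> carrier G \<Longrightarrow> \<bar>\<phi> x\<bar> \<le> c * (\<Sum>g\<leftarrow>gs. f (g \<otimes>\<^bsub>G\<^esub> x))"
  shows "\<bar>J \<phi>\<bar> \<le> c * (\<Sum>g\<leftarrow>gs. J (left_translate G g f))"
proof -
  interpret group G by fact
  have \<phi>D: "\<phi> \<in> dominated G T f" using \<phi> 1 unfolding dominated_def by blast
  have D: "left_translate G g f \<in> dominated G T f" if "g \<in> set gs" for g
    using that 1(2) by (intro dominated_left_translate[OF G top _ conj self_dominated[OF G f]]) auto
  define s where "s x = (\<Sum>g\<leftarrow>gs. left_translate G g f x)" for x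
  have s: "s \<in> dominated G T f" "J s = (\<Sum>g\<leftarrow>gs. J (left_translate G g f))"
    using positive_functional_sum_list[OF G J f(2,1), of gs "\<lambda>g. left_translate G g f"] D
    by (simp_all add: s_def[abs_def])
  have le: "\<bar>\<phi> x\<bar> \<le> c * s x" if "x \<in> carrier G" for x
    using 1(3)[OF that] that by (simp add: s_def left_translate_def)
  have "J \<phi> \<le> J (\<lambda>x. c * s x)"
    using le by (intro positive_functional_mono[OF G J f(2) \<phi>D dominated_scale[OF s(1)]]) (auto simp: abs_le_iff)
  moreover have "J (\<lambda>x. - c * s x) \<le> J \<phi>"
  proof (rule positive_functional_mono[OF G J f(2) dominated_scale[OF s(1)] \<phi>D])
    show "- c * s x \<le> \<phi> x" if "x \<in> carrier G" for x using abs_le_D2[OF le[OF that]] by simp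
  qed
  ultimately show ?thesis
    unfolding positive_functional_scale[OF J s(1)] s(2) by (simp add: abs_le_iff)
qed

text \<open>The inequality for the inverse of g, applied to the translated function, gives the
  converse, and a general function is a difference of two non-negative dominated ones. A limit of
  almost invariant functionals delivers only the hypothesis in this one-sided form.\<close>

lemma left_invariantI:
  assumes G: "group G" and top: "topspace T = carrier G"
    and conj: "\<And>g. g \<in> carrier G \<Longrightarrow> continuous_map T T (\<lambda>x. g \<otimes>\<^bsub>G\<^esub> x \<otimes>\<^bsub>G\<^esub> inv\<^bsub>G\<^esub> g)"
    and f: "ruc G T f" "\<And>x. x \<in> carrier G \<Longrightarrow> 0 \<le> f x"
    and J: "positive_functional G T f J"
    and le: "\<And>\<phi> g. \<phi> \<in> dominated G T f \<Longrightarrow> (\<And>x. x \<in> carrier G \<Longrightarrow> 0 \<le> \<phi> x) \<Longrightarrow> g \<in> carrier G \<Longrightarrow>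
      J (left_translate G g \<phi>) \<le> J \<phi>"
  shows "left_invariant G T f J"
  unfolding left_invariant_def
proof (intro ballI)
  interpret group G by fact
  let ?L = "left_translate G"
  have LD: "?L g \<phi> \<in> dominated G T f" if "g \<in> carrier G" "\<phi> \<in> dominated G T f" for g \<phi>
    by (rule dominated_left_translate[OF G top that(1) conj[OF that(1)] that(2)])
  have eq: "J (?L g \<phi>) = J \<phi>"
    if D: "\<phi> \<in> dominated G T f" and nonneg: "\<And>x. x \<in> carrier G \<Longrightarrow> 0 \<le> \<phi> x" and g: "g \<in> carrier G" for \<phi> g
  proof (rule antisym[OF le[OF D nonneg g]])
    have "?L (inv\<^bsub>G\<^esub> g) (?L g \<phi>) = \<phi>"
      using g by (auto simp: left_translate_def m_assoc[symmetric])
    then show "J \<phi> \<le> J (?L g \<phi>)"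
      using le[OF LD[OF g D] _ inv_closed[OF g]] nonneg g by (simp add: left_translate_def)
  qed
  fix \<phi> g assume D: "\<phi> \<in> dominated G T f" and g: "g \<in> carrier G"
  obtain c gs where 1: "c \<ge> 0" "set gs \<subseteq> carrier G"
    "\<And>x. x \<in> carrier G \<Longrightarrow> \<bar>\<phi> x\<bar> \<le> c * (\<Sum>g\<leftarrow>gs. f (g \<otimes>\<^bsub>G\<^esub> x))"
    using D unfolding dominated_def by auto
  \<comment> \<open>\<open>c * s\<close> majorises \<bar>\<phi>\<bar>, so \<phi> is the difference
    of the non-negative dominated functions \<phi> + c s and c s.\<close>
  define s where "s x = (\<Sum>g\<leftarrow>gs. ?L g f x)" for x
  have "?L h f \<in> dominated G T f" if "h \<in> set gs" for h
    using that 1(2) by (intro LD self_dominated[OF G f]) auto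
  then have "s \<in> dominated G T f"
    using positive_functional_sum_list[OF G J f(2,1), of gs "\<lambda>g. ?L g f"] by (simp add: s_def[abs_def])
  then have cs: "(\<lambda>x. c * s x) \<in> dominated G T f" by (rule dominated_scale)
  have s_eq: "c * s x = c * (\<Sum>g\<leftarrow>gs. f (g \<otimes>\<^bsub>G\<^esub> x))" if "x \<in> carrier G" for x
    using that by (simp add: s_def left_translate_def)
  have cs_nonneg: "0 \<le> c * s x" if "x \<in> carrier G" for x
    unfolding s_eq[OF that] using 1(3)[OF that] by linarith
  have sum_nonneg: "0 \<le> \<phi> x + c * s x" if "x \<in> carrier G" for x
    unfolding s_eq[OF that] using abs_le_D2[OF 1(3)[OF that]] by linarith
  have sum_D: "(\<lambda>x. \<phi> x + c * s x) \<in> dominated G T f" by (rule dominated_add[OF G f(2) D cs])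
  have "?L g (\<lambda>x. \<phi> x + c * s x) = (\<lambda>x. ?L g \<phi> x + ?L g (\<lambda>x. c * s x) x)"
    by (auto simp: left_translate_def)
  then have "J (?L g \<phi>) + J (?L g (\<lambda>x. c * s x)) = J (?L g (\<lambda>x. \<phi> x + c * s x))"
    using positive_functional_add[OF J LD[OF g D] LD[OF g cs]] by simp
  also have "\<dots> = J (\<lambda>x. \<phi> x + c * s x)" by (rule eq[OF sum_D sum_nonneg g])
  also have "\<dots> = J \<phi> + J (\<lambda>x. c * s x)" by (rule positive_functional_add[OF J D cs])
  also have "J (?L g (\<lambda>x. c * s x)) = J (\<lambda>x. c * s x)" by (rule eq[OF cs cs_nonneg g])
  finally show "J (?L g \<phi>) = J \<phi>" by simp
qed

text \<open>The property is applied to the cone of positive functionals on the dominated functions.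
  Evaluation at a point where \<open>f\<close> is non-zero is the bounded uniformly continuous
  vector, and \<Phi> \<mapsto> \<Phi> f is the functional for cobounded type.\<close>

lemma fixed_point_property_imp_invariant_functionals:
  fixes G :: "('g, 'b) monoid_scheme" and T :: "'g topology"
  assumes G: "group G" and top: "topspace T = carrier G"
    and conj: "\<And>g. g \<in> carrier G \<Longrightarrow> continuous_map T T (\<lambda>x. g \<otimes>\<^bsub>G\<^esub> x \<otimes>\<^bsub>G\<^esub> inv\<^bsub>G\<^esub> g)"
    and fpp: "fixed_point_property_for_cones TYPE(('g \<Rightarrow> real) \<Rightarrow> real) G T"
  shows "invariant_functionals G T"
  unfolding invariant_functionals_def
proof (intro allI impI, elim conjE)
  interpret group G by fact
  fix f assume f: "ruc G T f" and "\<forall>x\<in>carrier G. 0 \<le> f x" "\<exists>x\<in>carrier G. f x \<noteq> 0"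
  then obtain x1 where x1: "x1 \<in> carrier G" "f x1 \<noteq> 0" and f_nonneg: "\<And>x. x \<in> carrier G \<Longrightarrow> 0 \<le> f x"
    by blast
  let ?D = "dominated G T f" and ?L = "left_translate G"
  let ?E = "powertop_real UNIV :: (('g \<Rightarrow> real) \<Rightarrow> real) topology"
  \<comment> \<open>Prescribing 0 off the dominated functions removes all freedom there; otherwise
    the cone could contain whole lines.\<close>
  define C where "C = {\<Phi>. (\<forall>\<phi>. \<phi> \<notin> ?D \<longrightarrow> \<Phi> \<phi> = 0) \<and> positive_functional G T f \<Phi>}"
  \<comment> \<open>No inverse appears: translating a function by g and then by h is translation by
    g h, so precomposition reverses the order once more and gives a left action.\<close>
  define \<pi> where "\<pi> g \<Phi> = (\<lambda>\<phi>. \<Phi> (?L g \<phi>))" for g and \<Phi> :: "('g \<Rightarrow> real) \<Rightarrow> real"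
  note D_add = dominated_add[OF G f_nonneg] and D_scale = dominated_scale
  have f_D: "f \<in> ?D" by (rule self_dominated[OF G f f_nonneg])
  have L_D: "?L g \<phi> \<in> ?D" if "g \<in> carrier G" "\<phi> \<in> ?D" for g \<phi>
    using that by (intro dominated_left_translate[OF G top _ conj])
  have L_L: "?L h (?L g \<phi>) = ?L (g \<otimes>\<^bsub>G\<^esub> h) \<phi>" if "g \<in> carrier G" "h \<in> carrier G" for g h \<phi>
    using that by (auto simp: left_translate_def m_assoc)
  have L_one: "?L \<one>\<^bsub>G\<^esub> \<phi> = \<phi>" for \<phi> by (auto simp: left_translate_def)
  have bound: "\<exists>c\<ge>0. \<exists>gs. set gs \<subseteq> carrier G \<and> (\<forall>\<Phi>\<in>C. \<bar>\<Phi> \<phi>\<bar> \<le> c * (\<Sum>g\<leftarrow>gs. \<Phi> (?L g f)))" for \<phi>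
  proof (cases "\<phi> \<in> ?D")
    case True
    then obtain c gs where 1: "c \<ge> 0" "set gs \<subseteq> carrier G"
      "\<And>x. x \<in> carrier G \<Longrightarrow> \<bar>\<phi> x\<bar> \<le> c * (\<Sum>g\<leftarrow>gs. f (g \<otimes>\<^bsub>G\<^esub> x))"
      unfolding dominated_def by auto
    have "\<bar>\<Phi> \<phi>\<bar> \<le> c * (\<Sum>g\<leftarrow>gs. \<Phi> (?L g f))" if "\<Phi> \<in> C" for \<Phi>
      using that True
      by (intro positive_functional_bound[OF G top conj f f_nonneg _ _ 1]) (auto simp: C_def dominated_def)
    with 1(1,2) show ?thesis by blast
  next
    case False
    then have "\<forall>\<Phi>\<in>C. \<bar>\<Phi> \<phi>\<bar> \<le> 0 * (\<Sum>g\<leftarrow>[]. \<Phi> (?L g f))" by (simp add: C_def)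
    moreover have "set [] \<subseteq> carrier G" by simp
    ultimately show ?thesis by (metis order_refl)
  qed
  have C_nonneg: "0 \<le> \<Phi> (?L g f)" if "\<Phi> \<in> C" "g \<in> carrier G" for \<Phi> g
  proof -
    have "positive_functional G T f \<Phi>" using that by (simp add: C_def)
    from positive_functional_nonneg[OF this L_D[OF that(2) f_D]] show ?thesis
      using that(2) f_nonneg by (simp add: left_translate_def)
  qed
  \<comment> \<open>The translates of \<open>f\<close> detect every member of the cone. This gives
    properness, and later that the fixed point does not vanish at \<open>f\<close>.\<close>
  have C_zero: "\<Phi> = 0" if "\<Phi> \<in> C" "\<And>g. g \<in> carrier G \<Longrightarrow> \<Phi> (?L g f) = 0" for \<Phi>
  proof
    fix \<phi>
    obtain c gs where gs: "set gs \<subseteq> carrier G" "\<bar>\<Phi> \<phi>\<bar> \<le> c * (\<Sum>g\<leftarrow>gs. \<Phi> (?L g f))"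
      using bound[of \<phi>] \<open>\<Phi> \<in> C\<close> by blast
    have "(\<Sum>g\<leftarrow>gs. \<Phi> (?L g f)) = (\<Sum>g\<leftarrow>gs. 0)"
      using gs(1) that(2) by (intro arg_cong[of _ _ sum_list] map_cong refl) auto
    with gs(2) show "\<Phi> \<phi> = 0 \<phi>" by simp
  qed
  have cone: "convex_cone C"
    unfolding convex_cone_iff
  proof (intro conjI ballI allI impI)
    show "0 \<in> C" by (simp add: C_def positive_functional_def)
    show "\<Phi> + \<Psi> \<in> C" if "\<Phi> \<in> C" "\<Psi> \<in> C" for \<Phi> \<Psi>
      using that by (auto simp: C_def positive_functional_def algebra_simps)
    show "c *\<^sub>R \<Phi> \<in> C" if "\<Phi> \<in> C" "0 \<le> c" for \<Phi> and c :: real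
      using that by (auto simp: C_def positive_functional_def scaleR_fun_def algebra_simps)
  qed
  have proper: "proper_cone C"
    unfolding proper_cone_def
  proof (intro conjI cone equalityI subsetI)
    fix \<Phi> assume "\<Phi> \<in> C \<inter> uminus ` C"
    then have \<Phi>: "\<Phi> \<in> C" "- \<Phi> \<in> C" by auto
    have "\<Phi> = 0"
    proof (rule C_zero[OF \<Phi>(1)])
      fix g assume "g \<in> carrier G"
      then show "\<Phi> (?L g f) = 0" using C_nonneg[OF \<Phi>(1)] C_nonneg[OF \<Phi>(2)] by force
    qed
    then show "\<Phi> \<in> {0}" by simp
  next
    fix \<Phi> :: "('g \<Rightarrow> real) \<Rightarrow> real" assume "\<Phi> \<in> {0}"
    moreover have "0 \<in> C" using cone by (simp add: convex_cone_iff)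
    ultimately show "\<Phi> \<in> C \<inter> uminus ` C" by (auto intro: image_eqI[of _ _ 0])
  qed
  have complete: "weakly_complete ?E C"
    unfolding weakly_complete_def complete_subset_def
  proof (intro allI impI, elim conjE)
    fix F assume F: "F \<noteq> bot" "F \<le> principal C" "cauchy_filter_on (weak_topology ?E) F"
    \<comment> \<open>Evaluation at \<phi> is a continuous functional, so a weakly Cauchy filter is
      Cauchy in each coordinate and converges there by completeness of the reals.\<close>
    have "\<exists>r. ((\<lambda>\<Phi>. \<Phi> \<phi>) \<longlongrightarrow> r) F" for \<phi>
    proof -
      have "cauchy_filter (filtermap (\<lambda>\<Phi>. \<Phi> \<phi>) F)"
        unfolding cauchy_filter_def le_filter_def
      proof (intro allI impI)
        fix P :: "real \<times> real \<Rightarrow> bool" assume "eventually P uniformity"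
        then obtain e where e: "e > 0" "\<And>x y. dist x y < e \<Longrightarrow> P (x, y)"
          unfolding eventually_uniformity_metric by blast
        let ?U = "(\<lambda>\<Phi> :: ('g \<Rightarrow> real) \<Rightarrow> real. \<Phi> \<phi>) -` ball 0 e"
        have "openin (weak_topology ?E) ?U"
          by (intro openin_weak_topology_vimage real_product_projection_dual) simp
        moreover have "0 \<in> ?U" using e by simp
        ultimately have "\<forall>\<^sub>F (x, y) in F \<times>\<^sub>F F. x - y \<in> ?U"
          using F(3) unfolding cauchy_filter_on_def by blast
        then obtain Q where Q: "eventually Q F" "\<And>x y. Q x \<Longrightarrow> Q y \<Longrightarrow> x - y \<in> ?U"
          unfolding eventually_prod_same by auto
        show "eventually P (filtermap (\<lambda>\<Phi>. \<Phi> \<phi>) F \<times>\<^sub>F filtermap (\<lambda>\<Phi>. \<Phi> \<phi>) F)"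
          unfolding eventually_prod_same eventually_filtermap
        proof (intro exI[of _ "\<lambda>r. \<exists>\<Phi>. Q \<Phi> \<and> r = \<Phi> \<phi>"] conjI allI impI)
          show "\<forall>\<^sub>F x in F. \<exists>\<Phi>. Q \<Phi> \<and> x \<phi> = \<Phi> \<phi>" using Q(1) by (rule eventually_mono) blast
          fix r s assume "\<exists>\<Phi>. Q \<Phi> \<and> r = \<Phi> \<phi>" "\<exists>\<Phi>. Q \<Phi> \<and> s = \<Phi> \<phi>"
          then show "P (r, s)" using Q(2) e(2) by (auto simp: dist_real_def)
        qed
      qed
      moreover have "filtermap (\<lambda>\<Phi>. \<Phi> \<phi>) F \<noteq> bot" using F(1) by (simp add: filtermap_bot_iff)
      ultimately show ?thesis
        using complete_UNIV[where 'a = real] unfolding complete_uniform filterlim_def by auto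
    qed
    then obtain \<Phi> where lim: "\<And>\<phi>. ((\<lambda>\<Psi>. \<Psi> \<phi>) \<longlongrightarrow> \<Phi> \<phi>) F" by metis
    have ev: "eventually (\<lambda>\<Psi>. \<Psi> \<in> C) F" using F(2) by (simp add: le_principal)
    \<comment> \<open>Each instance of a law defining \<open>C\<close> involves finitely many
      coordinates, so it survives pointwise limits.\<close>
    have "\<Phi> \<in> C"
    proof -
      have pf: "eventually (\<lambda>\<Psi>. positive_functional G T f \<Psi>) F"
        using ev by (rule eventually_mono) (simp add: C_def)
      have "\<Phi> \<phi> = 0" if "\<phi> \<notin> ?D" for \<phi>
      proof (rule tendsto_unique[OF F(1) lim])
        show "((\<lambda>\<Psi>. \<Psi> \<phi>) \<longlongrightarrow> 0) F"
          using ev that by (intro tendsto_eventually) (auto elim!: eventually_mono simp: C_def)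
      qed
      moreover have "\<Phi> (\<lambda>x. \<phi> x + \<psi> x) = \<Phi> \<phi> + \<Phi> \<psi>" if "\<phi> \<in> ?D" "\<psi> \<in> ?D" for \<phi> \<psi>
      proof (rule tendsto_unique[OF F(1) lim])
        show "((\<lambda>\<Psi>. \<Psi> (\<lambda>x. \<phi> x + \<psi> x)) \<longlongrightarrow> \<Phi> \<phi> + \<Phi> \<psi>) F"
        proof (rule Lim_transform_eventually[OF tendsto_add[OF lim[of \<phi>] lim[of \<psi>]]])
          show "\<forall>\<^sub>F \<Psi> in F. \<Psi> \<phi> + \<Psi> \<psi> = \<Psi> (\<lambda>x. \<phi> x + \<psi> x)"
            using pf by (rule eventually_mono) (simp add: positive_functional_add that)
        qed
      qed
      moreover have "\<Phi> (\<lambda>x. c * \<phi> x) = c * \<Phi> \<phi>" if "\<phi> \<in> ?D" for \<phi> c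
      proof (rule tendsto_unique[OF F(1) lim])
        show "((\<lambda>\<Psi>. \<Psi> (\<lambda>x. c * \<phi> x)) \<longlongrightarrow> c * \<Phi> \<phi>) F"
        proof (rule Lim_transform_eventually[OF tendsto_mult_left[OF lim[of \<phi>]]])
          show "\<forall>\<^sub>F \<Psi> in F. c * \<Psi> \<phi> = \<Psi> (\<lambda>x. c * \<phi> x)"
            using pf by (rule eventually_mono) (simp add: positive_functional_scale that)
        qed
      qed
      moreover have "0 \<le> \<Phi> \<phi>" if "\<phi> \<in> ?D" "\<forall>x\<in>carrier G. 0 \<le> \<phi> x" for \<phi>
      proof (rule tendsto_lowerbound[OF lim _ F(1)])
        show "\<forall>\<^sub>F \<Psi> in F. 0 \<le> \<Psi> \<phi>"
          using pf by (rule eventually_mono) (use that positive_functional_nonneg in blast)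
      qed
      ultimately show ?thesis unfolding C_def positive_functional_def by blast
    qed
    moreover have "limitin (weak_topology ?E) (\<lambda>x. x) \<Phi> F"
      unfolding limitin_def
    proof (intro conjI allI impI)
      have "openin (weak_topology ?E) ((\<lambda>\<Phi>. \<Phi> f) -` UNIV)"
        by (intro openin_weak_topology_vimage real_product_projection_dual) simp
      then show "\<Phi> \<in> topspace (weak_topology ?E)" using openin_subset by fastforce
      have limE: "limitin ?E (\<lambda>x. x) \<Phi> F"
        using lim by (simp add: limitin_componentwise)
      fix U assume "openin (weak_topology ?E) U \<and> \<Phi> \<in> U"
      then obtain L e where L: "finite L" "L \<subseteq> topological_dual ?E" "e > 0"
        "\<And>y. (\<forall>l\<in>L. \<bar>l y - l \<Phi>\<bar> < e) \<Longrightarrow> y \<in> U"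
        using openin_weak_topology_contains_basic[of ?E U \<Phi>] by blast
      have "\<forall>\<^sub>F y in F. \<bar>l y - l \<Phi>\<bar> < e" if "l \<in> L" for l
      proof -
        have "continuous_map ?E euclideanreal l" using that L(2) by (auto simp: topological_dual_def)
        from continuous_map_limit[OF this limE] have "(l \<longlongrightarrow> l \<Phi>) F" by (simp add: o_def)
        from tendstoD[OF this L(3)] show ?thesis by (simp add: dist_real_def)
      qed
      then have "\<forall>\<^sub>F y in F. \<forall>l\<in>L. \<bar>l y - l \<Phi>\<bar> < e" by (simp add: eventually_ball_finite L(1))
      then show "\<forall>\<^sub>F y in F. y \<in> U" by (rule eventually_mono) (rule L(4))
    qed
    ultimately show "\<exists>c\<in>C. limitin (weak_topology ?E) (\<lambda>x. x) c F" by blast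
  qed
  have rep: "cone_representation G ?E C \<pi>"
    unfolding cone_representation_def
  proof (intro conjI ballI allI)
    fix g assume g: "g \<in> carrier G"
    show "linear (\<pi> g)" by (rule linearI) (simp_all add: \<pi>_def scaleR_fun_def fun_eq_iff)
    show "continuous_map ?E ?E (\<pi> g)"
      unfolding continuous_map_componentwise_UNIV \<pi>_def
      by (intro allI continuous_map_product_projection) simp
    show "\<pi> g ` C \<subseteq> C"
    proof clarify
      fix \<Phi> assume \<Phi>: "\<Phi> \<in> C"
      then have pf: "positive_functional G T f \<Phi>" by (simp add: C_def)
      \<comment> \<open>Translation by the inverse would bring \<phi> back among the dominated
        functions; so the action respects the prescribed zeros.\<close>
      have "?L g \<phi> \<notin> ?D" if "\<phi> \<notin> ?D" for \<phi>
      proof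
        assume "?L g \<phi> \<in> ?D"
        from L_D[OF inv_closed[OF g] this] show False
          using that g by (simp add: L_L L_one)
      qed
      then have "\<forall>\<phi>. \<phi> \<notin> ?D \<longrightarrow> \<pi> g \<Phi> \<phi> = 0" using \<Phi> by (simp add: C_def \<pi>_def)
      moreover have "positive_functional G T f (\<pi> g \<Phi>)"
        unfolding positive_functional_def
      proof (intro conjI ballI allI impI)
        fix \<phi> assume \<phi>: "\<phi> \<in> ?D"
        show "\<pi> g \<Phi> (\<lambda>x. \<phi> x + \<psi> x) = \<pi> g \<Phi> \<phi> + \<pi> g \<Phi> \<psi>" if \<psi>: "\<psi> \<in> ?D" for \<psi>
        proof -
          have "?L g (\<lambda>x. \<phi> x + \<psi> x) = (\<lambda>x. ?L g \<phi> x + ?L g \<psi> x)" by (auto simp: left_translate_def)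
          then show ?thesis
            unfolding \<pi>_def using positive_functional_add[OF pf L_D[OF g \<phi>] L_D[OF g \<psi>]] by simp
        qed
        show "\<pi> g \<Phi> (\<lambda>x. c * \<phi> x) = c * \<pi> g \<Phi> \<phi>" for c
        proof -
          have "?L g (\<lambda>x. c * \<phi> x) = (\<lambda>x. c * ?L g \<phi> x)" by (auto simp: left_translate_def)
          then show ?thesis
            unfolding \<pi>_def using positive_functional_scale[OF pf L_D[OF g \<phi>]] by simp
        qed
        show "0 \<le> \<pi> g \<Phi> \<phi>" if "\<forall>x\<in>carrier G. 0 \<le> \<phi> x"
          unfolding \<pi>_def using that g
          by (intro positive_functional_nonneg[OF pf L_D[OF g \<phi>]]) (simp add: left_translate_def)
      qed
      ultimately show "\<pi> g \<Phi> \<in> C" by (simp add: C_def)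
    qed
    show "\<pi> (g \<otimes>\<^bsub>G\<^esub> h) \<Phi> = \<pi> g (\<pi> h \<Phi>)" if "h \<in> carrier G" for h \<Phi>
      using g that by (simp add: \<pi>_def L_L)
  qed (simp add: \<pi>_def L_one)
  have ruc: "locally_bounded_ruc G T ?E C \<pi>"
    unfolding locally_bounded_ruc_def
  proof (intro bexI conjI allI impI)
    \<comment> \<open>Evaluation at \<open>x1\<close>, cut off outside the dominated functions. Its
      translate by g is evaluation at g x1, so boundedness and uniform continuity of the orbit are
      those of the individual functions \<phi>.\<close>
    define \<Phi>0 where "\<Phi>0 \<phi> = (if \<phi> \<in> ?D then \<phi> x1 else 0)" for \<phi>
    have \<pi>0: "\<pi> g \<Phi>0 \<phi> = (if \<phi> \<in> ?D then \<phi> (g \<otimes>\<^bsub>G\<^esub> x1) else 0)" if g: "g \<in> carrier G" for g \<phi>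
    proof (cases "\<phi> \<in> ?D")
      case True
      then show ?thesis using x1(1) L_D[OF g] by (simp add: \<pi>_def \<Phi>0_def left_translate_def)
    next
      case False
      have "?L g \<phi> \<notin> ?D"
      proof
        assume "?L g \<phi> \<in> ?D"
        from L_D[OF inv_closed[OF g] this] show False using False g by (simp add: L_L L_one)
      qed
      with False show ?thesis by (simp add: \<pi>_def \<Phi>0_def)
    qed
    show "\<Phi>0 \<in> C"
      unfolding C_def positive_functional_def \<Phi>0_def using x1(1) by (auto simp: D_add D_scale)
    show "\<Phi>0 \<noteq> 0" using x1(2) f_D by (metis \<Phi>0_def zero_fun_apply)
    show "bounded_subset ?E ((\<lambda>g. \<pi> g \<Phi>0) ` carrier G)"
      unfolding bounded_subset_def
    proof (intro allI impI, elim conjE)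
      fix U assume U: "openin ?E U" "0 \<in> U"
      obtain J e where J: "finite J" "e > 0" "{\<Phi>. \<forall>i\<in>J. \<bar>\<Phi> i\<bar> < e} \<subseteq> U"
        by (rule real_product_topology_nbhd[OF U])
      have "\<exists>b\<ge>0. \<forall>g\<in>carrier G. \<bar>\<pi> g \<Phi>0 \<phi>\<bar> \<le> b" for \<phi>
      proof (cases "\<phi> \<in> ?D")
        case True
        then obtain B where B: "\<And>x. x \<in> carrier G \<Longrightarrow> \<bar>\<phi> x\<bar> \<le> B"
          unfolding dominated_def ruc_def by blast
        then have "\<forall>g\<in>carrier G. \<bar>\<pi> g \<Phi>0 \<phi>\<bar> \<le> B" using x1(1) True by (simp add: \<pi>0)
        moreover have "B \<ge> 0" using B[OF x1(1)] by linarith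
        ultimately show ?thesis by blast
      qed (auto simp: \<pi>0)
      then obtain b where b: "\<And>\<phi>. b \<phi> \<ge> 0" "\<And>\<phi> g. g \<in> carrier G \<Longrightarrow> \<bar>\<pi> g \<Phi>0 \<phi>\<bar> \<le> b \<phi>" by metis
      \<comment> \<open>The product e s exceeds the bound of every coordinate in \<open>J\<close>;
        the summand 1 makes this strict.\<close>
      define s where "s = (\<Sum>\<phi>\<in>J. b \<phi>) / e + 1"
      have "s > 0" using b(1) J(2) by (simp add: s_def add_nonneg_pos sum_nonneg)
      moreover have "(\<lambda>g. \<pi> g \<Phi>0) ` carrier G \<subseteq> (\<lambda>x. t *\<^sub>R x) ` U" if t: "t \<ge> s" for t
      proof clarify
        fix g assume g: "g \<in> carrier G"
        have "t > 0" using t \<open>s > 0\<close> by linarith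
        have "(1/t) *\<^sub>R \<pi> g \<Phi>0 \<in> U"
        proof (rule subsetD[OF J(3)], clarify)
          fix \<phi> assume "\<phi> \<in> J"
          have "\<bar>\<pi> g \<Phi>0 \<phi>\<bar> \<le> b \<phi>" by (rule b(2)[OF g])
          also have "\<dots> \<le> (\<Sum>\<phi>\<in>J. b \<phi>)" using b(1) J(1) \<open>\<phi> \<in> J\<close> by (intro member_le_sum) auto
          also have "\<dots> < e * s" using J(2) by (simp add: s_def field_simps)
          also have "\<dots> \<le> e * t" using t J(2) by simp
          finally show "\<bar>((1/t) *\<^sub>R \<pi> g \<Phi>0) \<phi>\<bar> < e"
            using \<open>t > 0\<close> by (simp add: scaleR_fun_def field_simps abs_divide)
        qed
        then show "\<pi> g \<Phi>0 \<in> (\<lambda>x. t *\<^sub>R x) ` U"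
          using \<open>t > 0\<close> by (intro image_eqI[of _ _ "(1/t) *\<^sub>R \<pi> g \<Phi>0"]) simp_all
      qed
      ultimately show "\<exists>s>0. \<forall>t\<ge>s. (\<lambda>g. \<pi> g \<Phi>0) ` carrier G \<subseteq> (\<lambda>x. t *\<^sub>R x) ` U" by blast
    qed
    fix U assume U: "openin ?E U \<and> 0 \<in> U"
    obtain J e where J: "finite J" "e > 0" "{\<Phi>. \<forall>i\<in>J. \<bar>\<Phi> i\<bar> < e} \<subseteq> U"
      by (rule real_product_topology_nbhd[OF conjunct1[OF U] conjunct2[OF U]])
    have "\<exists>V. openin T V \<and> \<one>\<^bsub>G\<^esub> \<in> V \<and>
        (\<forall>a\<in>V. \<forall>g\<in>carrier G. \<forall>\<phi>\<in>J. \<bar>\<pi> (a \<otimes>\<^bsub>G\<^esub> g) \<Phi>0 \<phi> - \<pi> g \<Phi>0 \<phi>\<bar> < e)"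
      using J(1)
    proof induction
      case empty
      have "openin T (carrier G)" using openin_topspace[of T] by (simp add: top)
      then show ?case by blast
    next
      case (insert \<phi> J)
      then obtain V where V: "openin T V" "\<one>\<^bsub>G\<^esub> \<in> V"
        "\<And>a g \<phi>. a \<in> V \<Longrightarrow> g \<in> carrier G \<Longrightarrow> \<phi> \<in> J \<Longrightarrow> \<bar>\<pi> (a \<otimes>\<^bsub>G\<^esub> g) \<Phi>0 \<phi> - \<pi> g \<Phi>0 \<phi>\<bar> < e" by blast
      obtain W where W: "openin T W" "\<one>\<^bsub>G\<^esub> \<in> W"
        "\<And>a g. a \<in> W \<Longrightarrow> g \<in> carrier G \<Longrightarrow> \<bar>\<pi> (a \<otimes>\<^bsub>G\<^esub> g) \<Phi>0 \<phi> - \<pi> g \<Phi>0 \<phi>\<bar> < e"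
      proof (cases "\<phi> \<in> ?D")
        case True
        then have "ruc G T \<phi>" by (simp add: dominated_def)
        from rucD[OF this J(2)] obtain W where W: "openin T W" "\<one>\<^bsub>G\<^esub> \<in> W"
          "\<And>a x. a \<in> W \<Longrightarrow> x \<in> carrier G \<Longrightarrow> \<bar>\<phi> (a \<otimes>\<^bsub>G\<^esub> x) - \<phi> x\<bar> < e"
          by blast
        show ?thesis
        proof (rule that[OF W(1,2)])
          fix a g assume that: "a \<in> W" "g \<in> carrier G"
          have "a \<in> carrier G" using that(1) openin_subset[OF W(1)] top by auto
          then show "\<bar>\<pi> (a \<otimes>\<^bsub>G\<^esub> g) \<Phi>0 \<phi> - \<pi> g \<Phi>0 \<phi>\<bar> < e"
            using that W(3)[OF that(1), of "g \<otimes>\<^bsub>G\<^esub> x1"] x1(1) True by (simp add: \<pi>0 m_assoc)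
        qed
      next
        \<comment> \<open>Off the dominated functions the coordinate vanishes along the whole orbit,
          so the neighbourhood already found will do.\<close>
        case False
        show ?thesis
        proof (rule that[OF V(1,2)])
          fix a g assume that: "a \<in> V" "g \<in> carrier G"
          have "a \<in> carrier G" using that(1) openin_subset[OF V(1)] top by auto
          then show "\<bar>\<pi> (a \<otimes>\<^bsub>G\<^esub> g) \<Phi>0 \<phi> - \<pi> g \<Phi>0 \<phi>\<bar> < e" using that J(2) False by (simp add: \<pi>0)
        qed
      qed
      show ?case
        using openin_Int[OF V(1) W(1)] V(2,3) W(2,3) by (intro exI[of _ "V \<inter> W"]) blast
    qed
    then obtain V where V: "openin T V" "\<one>\<^bsub>G\<^esub> \<in> V"
      "\<And>a g \<phi>. a \<in> V \<Longrightarrow> g \<in> carrier G \<Longrightarrow> \<phi> \<in> J \<Longrightarrow> \<bar>\<pi> (a \<otimes>\<^bsub>G\<^esub> g) \<Phi>0 \<phi> - \<pi> g \<Phi>0 \<phi>\<bar> < e" by blast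
    have "\<pi> (a \<otimes>\<^bsub>G\<^esub> g) \<Phi>0 - \<pi> g \<Phi>0 \<in> U" if "a \<in> V" "g \<in> carrier G" for a g
      by (rule subsetD[OF J(3)]) (use V(3)[OF that] in simp)
    with V(1,2) show "\<exists>V. openin T V \<and> \<one>\<^bsub>G\<^esub> \<in> V \<and>
        (\<forall>a\<in>V. \<forall>g\<in>carrier G. \<pi> (a \<otimes>\<^bsub>G\<^esub> g) \<Phi>0 - \<pi> g \<Phi>0 \<in> U)" by blast
  qed
  have cob: "cobounded_type G ?E C \<pi>"
    unfolding cobounded_type_def
  proof (intro bexI[of _ "\<lambda>\<Phi>. \<Phi> f"] ballI)
    show "(\<lambda>\<Phi>. \<Phi> f) \<in> topological_dual ?E" by (rule real_product_projection_dual)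
    fix l assume "l \<in> topological_dual ?E"
    then obtain J c where J: "finite J" "c \<ge> 0" "\<And>\<Phi>. \<bar>l \<Phi>\<bar> \<le> c * (\<Sum>\<phi>\<in>J. \<bar>\<Phi> \<phi>\<bar>)"
      using real_product_dual_bound by blast
    have "\<exists>gs. set gs \<subseteq> carrier G \<and> (\<forall>\<Phi>\<in>C. c * (\<Sum>\<phi>\<in>J. \<bar>\<Phi> \<phi>\<bar>) \<le> (\<Sum>g\<leftarrow>gs. \<Phi> (?L g f)))"
      using J(1)
    proof induction
      case empty
      then show ?case by (intro exI[of _ "[]"]) simp
    next
      case (insert \<phi> J)
      then obtain gs where gs: "set gs \<subseteq> carrier G"
        "\<And>\<Phi>. \<Phi> \<in> C \<Longrightarrow> c * (\<Sum>\<phi>\<in>J. \<bar>\<Phi> \<phi>\<bar>) \<le> (\<Sum>g\<leftarrow>gs. \<Phi> (?L g f))" by blast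
      obtain c' hs where hs: "c' \<ge> 0" "set hs \<subseteq> carrier G"
        "\<And>\<Phi>. \<Phi> \<in> C \<Longrightarrow> \<bar>\<Phi> \<phi>\<bar> \<le> c' * (\<Sum>g\<leftarrow>hs. \<Phi> (?L g f))" using bound[of \<phi>] by blast
      obtain n where n: "c * c' \<le> real n" using real_arch_simple by blast
      \<comment> \<open>Cobounded type admits sums of translates but no coefficients, so the factor
        c c' is rounded up to an integer and realised by repetition.\<close>
      define ks where "ks = concat (replicate n hs)"
      have sum_ks: "(\<Sum>g\<leftarrow>ks. F g) = real n * (\<Sum>g\<leftarrow>hs. F g)" for F :: "'g \<Rightarrow> real"
        unfolding ks_def by (induction n) (simp_all add: algebra_simps)
      have "c * (\<Sum>\<phi>\<in>insert \<phi> J. \<bar>\<Phi> \<phi>\<bar>) \<le> (\<Sum>g\<leftarrow>gs @ ks. \<Phi> (?L g f))" if \<Phi>: "\<Phi> \<in> C" for \<Phi>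
      proof -
        have nn: "0 \<le> (\<Sum>g\<leftarrow>hs. \<Phi> (?L g f))"
          using hs(2) C_nonneg[OF \<Phi>] by (intro sum_list_nonneg) auto
        have "c * \<bar>\<Phi> \<phi>\<bar> \<le> c * (c' * (\<Sum>g\<leftarrow>hs. \<Phi> (?L g f)))"
          using J(2) hs(3)[OF \<Phi>] by (rule mult_left_mono[rotated])
        also have "\<dots> \<le> real n * (\<Sum>g\<leftarrow>hs. \<Phi> (?L g f))"
          using mult_right_mono[OF n nn] by (simp add: mult.assoc)
        finally show ?thesis
          using gs(2)[OF \<Phi>] insert.hyps by (simp add: sum_ks distrib_left)
      qed
      moreover have "set (gs @ ks) \<subseteq> carrier G" using gs(1) hs(2) by (auto simp: ks_def)
      ultimately show ?case by blast
    qed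
    then obtain gs where gs: "set gs \<subseteq> carrier G"
      "\<And>\<Phi>. \<Phi> \<in> C \<Longrightarrow> c * (\<Sum>\<phi>\<in>J. \<bar>\<Phi> \<phi>\<bar>) \<le> (\<Sum>g\<leftarrow>gs. \<Phi> (?L g f))" by blast
    \<comment> \<open>The adjoint action contains an inverse, which inverting the list
      compensates.\<close>
    let ?hs = "map (\<lambda>g. inv\<^bsub>G\<^esub> g) gs"
    have "(\<Sum>g\<leftarrow>?hs. adjoint_rep G \<pi> g (\<lambda>\<Phi>. \<Phi> f)) \<Phi> = (\<Sum>g\<leftarrow>gs. \<Phi> (?L g f))" for \<Phi>
      unfolding sum_list_fun_apply map_map o_def adjoint_rep_def \<pi>_def
      using gs(1) by (intro arg_cong[of _ _ sum_list] map_cong refl) auto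
    then have "\<bar>l \<Phi>\<bar> \<le> (\<Sum>g\<leftarrow>?hs. adjoint_rep G \<pi> g (\<lambda>\<Phi>. \<Phi> f)) \<Phi>" if "\<Phi> \<in> C" for \<Phi>
      using J(3)[of \<Phi>] gs(2)[OF that] by simp
    then have "dual_le C l (\<Sum>g\<leftarrow>?hs. adjoint_rep G \<pi> g (\<lambda>\<Phi>. \<Phi> f))"
      "dual_le C (- l) (\<Sum>g\<leftarrow>?hs. adjoint_rep G \<pi> g (\<lambda>\<Phi>. \<Phi> f))"
      by (auto simp: dual_le_def abs_le_iff)
    moreover have "set ?hs \<subseteq> carrier G" using gs(1) by auto
    ultimately show "\<exists>gs. set gs \<subseteq> carrier G \<and>
        dual_le C l (\<Sum>g\<leftarrow>gs. adjoint_rep G \<pi> g (\<lambda>\<Phi>. \<Phi> f)) \<and>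
        dual_le C (- l) (\<Sum>g\<leftarrow>gs. adjoint_rep G \<pi> g (\<lambda>\<Phi>. \<Phi> f))" by blast
  qed
  obtain \<Phi> where \<Phi>: "\<Phi> \<in> C" "\<Phi> \<noteq> 0" "\<And>g. g \<in> carrier G \<Longrightarrow> \<pi> g \<Phi> = \<Phi>"
    using fpp[unfolded fixed_point_property_for_cones_def, rule_format, of ?E C \<pi>]
      locally_convex_real_product_topology[where 'i = "'g \<Rightarrow> real"] proper complete rep ruc cob by auto
  have inv: "\<Phi> (?L g \<phi>) = \<Phi> \<phi>" if "g \<in> carrier G" for g \<phi>
    using \<Phi>(3)[OF that] by (metis \<pi>_def)
  have pf: "positive_functional G T f \<Phi>" using \<Phi>(1) by (simp add: C_def)
  \<comment> \<open>By invariance a zero at \<open>f\<close> would be a zero at all translates of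
    \<open>f\<close>, forcing \<Phi> = 0.\<close>
  have "\<Phi> f \<noteq> 0" using C_zero[OF \<Phi>(1)] \<Phi>(2) inv by auto
  moreover have "\<Phi> f \<ge> 0" using f_nonneg by (intro positive_functional_nonneg[OF pf f_D])
  ultimately have "\<Phi> f > 0" by simp
  then have "positive_functional G T f (\<lambda>\<phi>. \<Phi> \<phi> / \<Phi> f)" "left_invariant G T f (\<lambda>\<phi>. \<Phi> \<phi> / \<Phi> f)"
    using pf inv by (auto simp: positive_functional_def left_invariant_def add_divide_distrib)
  then show "\<exists>J. positive_functional G T f J \<and> left_invariant G T f J \<and> J f = 1"
    using \<open>\<Phi> f > 0\<close> by (intro exI[of _ "\<lambda>\<phi>. \<Phi> \<phi> / \<Phi> f"]) simp
qed

subsection \<open>Means on compact groups\<close>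

locale topological_group_on = group G for G (structure) +
  fixes T
  assumes topological_group: "topological_group G T"
begin

lemma topspace: "topspace T = carrier G"
  using topological_group by (simp add: topological_group_def)

lemma continuous_mult:
  assumes "continuous_map X T f" "continuous_map X T g"
  shows "continuous_map X T (\<lambda>x. f x \<otimes> g x)"
proof -
  have "continuous_map X (prod_topology T T) (\<lambda>x. (f x, g x))"
    using assms by (rule continuous_map_pairedI)
  moreover have "continuous_map (prod_topology T T) T (\<lambda>(x, y). x \<otimes> y)"
    using topological_group by (simp add: topological_group_def)
  ultimately have "continuous_map X T ((\<lambda>(x, y). x \<otimes> y) \<circ> (\<lambda>x. (f x, g x)))"
    by (rule continuous_map_compose)
  then show ?thesis by (simp add: o_def)
qed

lemma continuous_inv:
  assumes "continuous_map X T f"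
  shows "continuous_map X T (\<lambda>x. inv (f x))"
proof -
  have "continuous_map T T (\<lambda>x. inv x)"
    using topological_group by (simp add: topological_group_def)
  with assms have "continuous_map X T ((\<lambda>x. inv x) \<circ> f)" by (rule continuous_map_compose)
  then show ?thesis by (simp add: o_def)
qed

lemma continuous_left_mult: "y \<in> carrier G \<Longrightarrow> continuous_map T T (\<lambda>x. y \<otimes> x)"
  by (intro continuous_mult) (auto simp: topspace)

lemma continuous_right_mult: "y \<in> carrier G \<Longrightarrow> continuous_map T T (\<lambda>x. x \<otimes> y)"
  by (intro continuous_mult) (auto simp: topspace)

lemma continuous_conjugation: "g \<in> carrier G \<Longrightarrow> continuous_map T T (\<lambda>x. g \<otimes> x \<otimes> inv g)"
  by (intro continuous_mult) (auto simp: topspace)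

lemma openin_left_mult_vimage:
  "openin T V \<Longrightarrow> y \<in> carrier G \<Longrightarrow> openin T {x \<in> carrier G. y \<otimes> x \<in> V}"
  using openin_continuous_map_preimage[OF continuous_left_mult] by (simp add: topspace)

text \<open>The open translates y V with y in \<open>C\<close> cover \<open>C\<close>, since \<one>
  lies in \<open>V\<close>.\<close>

lemma compact_finite_translates:
  assumes C: "compactin T C" and V: "openin T V" "\<one> \<in> V"
  shows "\<exists>ys. set ys \<subseteq> C \<and> (\<forall>x\<in>C. \<exists>y\<in>set ys. inv y \<otimes> x \<in> V)"
proof -
  have CG: "C \<subseteq> carrier G" using compactin_subset_topspace[OF C] by (simp add: topspace)
  let ?U = "\<lambda>y. {x \<in> carrier G. inv y \<otimes> x \<in> V}"
  have op: "\<forall>U\<in>?U ` C. openin T U"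
    using CG by (auto intro!: openin_left_mult_vimage V(1))
  have cov: "C \<subseteq> \<Union> (?U ` C)"
  proof
    fix x assume x: "x \<in> C"
    then have "x \<in> ?U x" using CG V(2) by (auto simp: subset_iff)
    with x show "x \<in> \<Union> (?U ` C)" by blast
  qed
  from C op cov obtain \<F> where \<F>: "finite \<F>" "\<F> \<subseteq> ?U ` C" "C \<subseteq> \<Union> \<F>"
    unfolding compactin_def by (metis (no_types, lifting))
  from finite_subset_image[OF \<F>(1,2)] obtain Y where Y: "Y \<subseteq> C" "finite Y" "\<F> = ?U ` Y"
    by blast
  obtain ys where ys: "set ys = Y" using finite_list[OF Y(2)] by blast
  have "\<forall>x\<in>C. \<exists>y\<in>set ys. inv y \<otimes> x \<in> V"
    using \<F>(3) Y(3) ys by auto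
  with ys Y(1) show ?thesis by blast
qed

text \<open>The tube lemma around C \<times> {\<one>} gives one neighbourhood for all x in
  \<open>C\<close>. The small factor stands on the right, opposite to \<open>ruc\<close>, so that
  left averages inherit the same modulus.\<close>

lemma uniformly_continuous_on_compact:
  fixes f :: "'a \<Rightarrow> real"
  assumes C: "compactin T C" and f: "continuous_map T euclideanreal f" and "e > 0"
  shows "\<exists>V. openin T V \<and> \<one> \<in> V \<and> (\<forall>x\<in>C. \<forall>v\<in>V. \<bar>f (x \<otimes> v) - f x\<bar> < e)"
proof -
  have CG: "C \<subseteq> carrier G" using compactin_subset_topspace[OF C] by (simp add: topspace)
  let ?P = "prod_topology T T"
  have "continuous_map ?P euclideanreal (f \<circ> (\<lambda>p. fst p \<otimes> snd p))"
    by (intro continuous_map_compose[OF _ f] continuous_mult continuous_map_fst continuous_map_snd)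
  moreover have "continuous_map ?P euclideanreal (f \<circ> fst)"
    by (intro continuous_map_compose[OF continuous_map_fst f])
  ultimately have "continuous_map ?P euclideanreal (\<lambda>p. f (fst p \<otimes> snd p) - f (fst p))"
    by (intro continuous_map_diff) (simp_all add: o_def)
  then have "openin ?P {p \<in> topspace ?P. f (fst p \<otimes> snd p) - f (fst p) \<in> {- e<..<e}}" (is "openin _ ?W")
    by (rule openin_continuous_map_preimage) simp
  moreover have "C \<times> {\<one>} \<subseteq> ?W" using CG \<open>e > 0\<close> by (auto simp: topspace subset_iff)
  ultimately have "\<exists>U V. openin T U \<and> openin T V \<and> C \<subseteq> U \<and> \<one> \<in> V \<and> U \<times> V \<subseteq> ?W"
    by (intro tube_lemma_left[OF _ C]) (auto simp: topspace)
  then obtain U V where UV: "openin T V" "C \<subseteq> U" "\<one> \<in> V" "U \<times> V \<subseteq> ?W" by blast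
  have "\<bar>f (x \<otimes> v) - f x\<bar> < e" if "x \<in> C" "v \<in> V" for x v
  proof -
    have "(x, v) \<in> ?W" using UV that by blast
    then show ?thesis by (auto simp: abs_less_iff)
  qed
  with UV show ?thesis by blast
qed

text \<open>Near x, write y = (y x^-1) x and use the uniform estimate for the left factor.\<close>

lemma ruc_continuous:
  assumes "ruc G T \<phi>"
  shows "continuous_map T euclideanreal \<phi>"
proof -
  have "openin T {y \<in> topspace T. \<phi> y \<in> S}" if S: "open S" for S
  proof (subst openin_subopen, intro ballI)
    fix x assume "x \<in> {y \<in> topspace T. \<phi> y \<in> S}"
    then have x: "x \<in> carrier G" "\<phi> x \<in> S" by (auto simp: topspace)
    obtain e where e: "e > 0" "ball (\<phi> x) e \<subseteq> S" using openE[OF S x(2)] by blast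
    obtain V where V: "openin T V" "\<one> \<in> V"
      "\<And>a y. a \<in> V \<Longrightarrow> y \<in> carrier G \<Longrightarrow> \<bar>\<phi> (a \<otimes> y) - \<phi> y\<bar> < e"
      using rucD[OF assms e(1)] by blast
    define W where "W = {y \<in> topspace T. y \<otimes> inv x \<in> V}"
    have "openin T W"
      unfolding W_def using x(1) by (intro openin_continuous_map_preimage[OF continuous_right_mult V(1)]) auto
    moreover have "x \<in> W" using x V(2) by (simp add: W_def topspace)
    moreover have "W \<subseteq> {y \<in> topspace T. \<phi> y \<in> S}"
    proof
      fix y assume "y \<in> W"
      then have y: "y \<in> carrier G" "y \<otimes> inv x \<in> V" by (auto simp: W_def topspace)
      have "y \<otimes> inv x \<otimes> x = y" using x(1) y(1) by (simp add: m_assoc)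
      then have "\<bar>\<phi> y - \<phi> x\<bar> < e" using V(3)[OF y(2) x(1)] by simp
      then show "y \<in> {y \<in> topspace T. \<phi> y \<in> S}"
        using e(2) y(1) by (auto simp: topspace dist_real_def abs_minus_commute subset_iff)
    qed
    ultimately show "\<exists>W. openin T W \<and> x \<in> W \<and> W \<subseteq> {y \<in> topspace T. \<phi> y \<in> S}" by blast
  qed
  then show ?thesis by (simp add: continuous_map_def)
qed

lemma dominated_continuous: "\<phi> \<in> dominated G T f \<Longrightarrow> continuous_map T euclideanreal \<phi>"
  by (simp add: dominated_def ruc_continuous)

lemma compactin_set_mult:
  assumes "compactin T A" "compactin T B"
  shows "compactin T (A <#> B)"
proof -
  have "continuous_map (prod_topology T T) T (\<lambda>p. fst p \<otimes> snd p)"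
    by (intro continuous_mult continuous_map_fst continuous_map_snd)
  moreover have "compactin (prod_topology T T) (A \<times> B)"
    using assms by (simp add: compactin_Times)
  ultimately have "compactin T ((\<lambda>p. fst p \<otimes> snd p) ` (A \<times> B))" by (rule image_compactin[rotated])
  moreover have "(\<lambda>p. fst p \<otimes> snd p) ` (A \<times> B) = A <#> B"
    by (force simp: set_mult_def)
  ultimately show ?thesis by simp
qed

lemma compactin_set_power: "compactin T A \<Longrightarrow> compactin T (set_power G A n)"
  by (induction n) (auto intro: compactin_set_mult simp: topspace)

text \<open>Powers grow by factors on the right, so a factor on the left has to be carried through
  by associativity. This inclusion is what makes the weights on the powers of \<open>A\<close>
  almost invariant.\<close>

lemma left_mult_set_power:
  assumes "A \<subseteq> carrier G" "g \<in> A" "x \<in> set_power G A n"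
  shows "g \<otimes> x \<in> set_power G A (Suc n) \<and> x \<in> carrier G"
  using assms(3)
proof (induction n arbitrary: x)
  case 0
  then show ?case using assms(1,2) by (auto simp: set_mult_def subset_iff intro!: bexI[of _ g])
next
  case (Suc n)
  then obtain y a where ya: "y \<in> set_power G A n" "a \<in> A" "x = y \<otimes> a" by (auto simp: set_mult_def)
  then have "g \<otimes> y \<in> set_power G A (Suc n)" "y \<in> carrier G" using Suc.IH by auto
  moreover have gaG: "g \<in> carrier G" "a \<in> carrier G" using ya(2) assms(1,2) by auto
  moreover from calculation have "g \<otimes> x = (g \<otimes> y) \<otimes> a" using ya(3) by (simp add: m_assoc)
  ultimately show ?case
    using ya(2,3) unfolding set_power.simps(2)[of G A "Suc n"] by (auto simp: set_mult_def simp del: set_power.simps)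
qed

end

section \<open>The invariant mean of a compact group by averaging over finite lists of
  translates\<close>

locale compact_topological_group = topological_group_on +
  assumes compact: "compact_space T"
begin

text \<open>As in von Neumann's construction of the mean, no measure is involved. Entries may
  repeat, so such averages are the convex combinations of translates with rational
  coefficients.\<close>

definition left_average :: "'a list \<Rightarrow> ('a \<Rightarrow> real) \<Rightarrow> 'a \<Rightarrow> real" where
  "left_average as f x = (\<Sum>a\<leftarrow>as. f (a \<otimes> x)) / real (length as)"

definition right_average :: "'a list \<Rightarrow> ('a \<Rightarrow> real) \<Rightarrow> 'a \<Rightarrow> real" where
  "right_average bs f x = (\<Sum>b\<leftarrow>bs. f (x \<otimes> b)) / real (length bs)"

definition weights :: "'a list set" where
  "weights = {as. as \<noteq> [] \<and> set as \<subseteq> carrier G}"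

text \<open>Such a constant exists by compactness; it is unique by comparison with its right-handed
  counterpart.\<close>

definition left_mean :: "('a \<Rightarrow> real) \<Rightarrow> real \<Rightarrow> bool" where
  "left_mean f c \<longleftrightarrow> (\<forall>e>0. \<exists>as\<in>weights. \<forall>x\<in>carrier G. \<bar>left_average as f x - c\<bar> \<le> e)"

definition right_mean :: "('a \<Rightarrow> real) \<Rightarrow> real \<Rightarrow> bool" where
  "right_mean f c \<longleftrightarrow> (\<forall>e>0. \<exists>bs\<in>weights. \<forall>x\<in>carrier G. \<bar>right_average bs f x - c\<bar> \<le> e)"

abbreviation cont :: "('a \<Rightarrow> real) \<Rightarrow> bool" where
  "cont f \<equiv> continuous_map T euclideanreal f"

lemma list_average_le:
  assumes "as \<noteq> []" "\<And>a. a \<in> set as \<Longrightarrow> g a \<le> t"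
  shows "(\<Sum>a\<leftarrow>as. g a) / real (length as) \<le> t"
proof -
  have "(\<Sum>a\<leftarrow>as. g a) \<le> (\<Sum>a\<leftarrow>as. t)" using assms(2) by (rule sum_list_mono)
  then show ?thesis using assms(1) by (simp add: sum_list_triv field_simps)
qed

lemma list_average_ge:
  assumes "as \<noteq> []" "\<And>a. a \<in> set as \<Longrightarrow> t \<le> g a"
  shows "t \<le> (\<Sum>a\<leftarrow>as. g a) / real (length as)"
proof -
  have "(\<Sum>a\<leftarrow>as. t) \<le> (\<Sum>a\<leftarrow>as. g a)" using assms(2) by (rule sum_list_mono)
  then show ?thesis using assms(1) by (simp add: sum_list_triv field_simps)
qed

lemma left_average_le:
  "as \<in> weights \<Longrightarrow> (\<And>y. y \<in> carrier G \<Longrightarrow> f y \<le> t) \<Longrightarrow> x \<in> carrier G \<Longrightarrow> left_average as f x \<le> t"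
  unfolding left_average_def by (rule list_average_le) (auto simp: weights_def)

lemma left_average_ge:
  "as \<in> weights \<Longrightarrow> (\<And>y. y \<in> carrier G \<Longrightarrow> t \<le> f y) \<Longrightarrow> x \<in> carrier G \<Longrightarrow> t \<le> left_average as f x"
  unfolding left_average_def by (rule list_average_ge) (auto simp: weights_def)

lemma left_average_near:
  assumes "as \<in> weights" "\<And>y. y \<in> carrier G \<Longrightarrow> \<bar>f y - c\<bar> \<le> e" "x \<in> carrier G"
  shows "\<bar>left_average as f x - c\<bar> \<le> e"
proof -
  have "f y \<le> c + e" "c - e \<le> f y" if "y \<in> carrier G" for y
    using assms(2)[OF that] by (auto simp: abs_le_iff)
  then have "left_average as f x \<le> c + e" "c - e \<le> left_average as f x"
    using assms(1,3) by (auto intro: left_average_le left_average_ge)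
  then show ?thesis by (simp add: abs_le_iff)
qed

lemma right_average_near:
  assumes "bs \<in> weights" "\<And>y. y \<in> carrier G \<Longrightarrow> \<bar>f y - c\<bar> \<le> e" "x \<in> carrier G"
  shows "\<bar>right_average bs f x - c\<bar> \<le> e"
proof -
  have "f y \<le> c + e" "c - e \<le> f y" if "y \<in> carrier G" for y
    using assms(2)[OF that] by (auto simp: abs_le_iff)
  then have "right_average bs f x \<le> c + e" "c - e \<le> right_average bs f x"
    unfolding right_average_def using assms(1,3)
    by (auto simp: weights_def intro!: list_average_le list_average_ge)
  then show ?thesis by (simp add: abs_le_iff)
qed

text \<open>Averaging the average evaluates f at a (b x), so the combined list consists of the
  products a b in this order.\<close>

lemma left_average_comp:
  assumes "as \<in> weights" "bs \<in> weights"
  shows "\<exists>cs\<in>weights. \<forall>f. \<forall>x\<in>carrier G. left_average cs f x = left_average bs (left_average as f) x"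
proof -
  define cs where "cs = concat (map (\<lambda>b. map (\<lambda>a. a \<otimes> b) as) bs)"
  have "cs \<in> weights" using assms by (auto simp: weights_def cs_def subset_iff)
  moreover have "left_average cs f x = left_average bs (left_average as f) x" if x: "x \<in> carrier G" for f x
  proof -
    have len: "length cs = length bs * length as"
      unfolding cs_def by (induction bs) auto
    have "(\<Sum>c\<leftarrow>concat (map (\<lambda>b. map (\<lambda>a. a \<otimes> b) as) bs). f (c \<otimes> x)) =
        (\<Sum>b\<leftarrow>bs. \<Sum>a\<leftarrow>as. f (a \<otimes> b \<otimes> x))"
      by (induction bs) (simp_all add: o_def)
    also have "\<dots> = (\<Sum>b\<leftarrow>bs. \<Sum>a\<leftarrow>as. f (a \<otimes> (b \<otimes> x)))"
      using assms x
      by (intro arg_cong[of _ _ sum_list] map_cong refl) (auto simp: weights_def m_assoc subset_iff)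
    finally have sum: "(\<Sum>c\<leftarrow>cs. f (c \<otimes> x)) = (\<Sum>b\<leftarrow>bs. \<Sum>a\<leftarrow>as. f (a \<otimes> (b \<otimes> x)))"
      by (simp add: cs_def)
    have "left_average bs (left_average as f) x =
        (\<Sum>b\<leftarrow>bs. (\<Sum>a\<leftarrow>as. f (a \<otimes> (b \<otimes> x))) * (1 / real (length as))) / real (length bs)"
      by (simp add: left_average_def)
    then show ?thesis
      unfolding sum_list_mult_const by (simp add: left_average_def sum len)
  qed
  ultimately show ?thesis by blast
qed

text \<open>Left and right multiplications commute by associativity. Uniqueness and invariance of
  the mean both rest on this.\<close>

lemma left_right_average_commute:
  assumes "as \<in> weights" "bs \<in> weights" "x \<in> carrier G"
  shows "right_average bs (left_average as f) x = left_average as (right_average bs f) x"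
proof -
  have swap: "(\<Sum>b\<leftarrow>bs. \<Sum>a\<leftarrow>as. F a b) = (\<Sum>a\<leftarrow>as. \<Sum>b\<leftarrow>bs. F a b)" for F :: "'a \<Rightarrow> 'a \<Rightarrow> real"
    by (induction bs) (simp_all add: sum_list_addf)
  have "(\<Sum>b\<leftarrow>bs. \<Sum>a\<leftarrow>as. f (a \<otimes> (x \<otimes> b))) = (\<Sum>b\<leftarrow>bs. \<Sum>a\<leftarrow>as. f (a \<otimes> x \<otimes> b))"
    using assms
    by (intro arg_cong[of _ _ sum_list] map_cong refl) (auto simp: weights_def m_assoc subset_iff)
  then have eq: "(\<Sum>b\<leftarrow>bs. \<Sum>a\<leftarrow>as. f (a \<otimes> (x \<otimes> b))) = (\<Sum>a\<leftarrow>as. \<Sum>b\<leftarrow>bs. f (a \<otimes> x \<otimes> b))"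
    by (simp only: swap)
  have "right_average bs (left_average as f) x =
      (\<Sum>b\<leftarrow>bs. (\<Sum>a\<leftarrow>as. f (a \<otimes> (x \<otimes> b))) * (1 / real (length as))) / real (length bs)"
    by (simp add: right_average_def left_average_def)
  moreover have "left_average as (right_average bs f) x =
      (\<Sum>a\<leftarrow>as. (\<Sum>b\<leftarrow>bs. f (a \<otimes> x \<otimes> b)) * (1 / real (length bs))) / real (length as)"
    by (simp add: right_average_def left_average_def)
  ultimately show ?thesis
    unfolding sum_list_mult_const by (simp add: eq)
qed

lemma cont_left_translate: "cont f \<Longrightarrow> a \<in> carrier G \<Longrightarrow> cont (\<lambda>x. f (a \<otimes> x))"
  using continuous_map_compose[OF continuous_left_mult, of a euclideanreal f] by (simp add: o_def)

lemma cont_left_average: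
  assumes "cont f" "as \<in> weights"
  shows "cont (left_average as f)"
proof -
  have "cont (\<lambda>x. \<Sum>a\<leftarrow>as. f (a \<otimes> x))" if "set as \<subseteq> carrier G" for as
    using that by (induction as) (auto intro!: continuous_map_add cont_left_translate assms(1))
  then have "cont (\<lambda>x. \<Sum>a\<leftarrow>as. f (a \<otimes> x))" using assms(2) by (simp add: weights_def)
  from continuous_map_real_mult[OF this, of "\<lambda>_. 1 / real (length as)"]
  show ?thesis by (simp add: left_average_def[abs_def])
qed

lemma compactin_carrier: "compactin T (carrier G)"
  using compact by (simp add: compact_space_def topspace)

lemma cont_bounded:
  assumes "cont f"
  shows "\<exists>B. \<forall>x\<in>carrier G. \<bar>f x\<bar> \<le> B"
proof -
  have "compact (f ` carrier G)"
    using image_compactin[OF compactin_carrier assms] by simp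
  then have "bounded (f ` carrier G)" by (rule compact_imp_bounded)
  then show ?thesis by (auto simp: bounded_iff)
qed

text \<open>Averaging over finitely many translates that move a small set around the whole group lowers
  the supremum by a fixed amount unless the function is nearly constant.\<close>

lemma left_mean_exists:
  assumes f: "cont f"
  shows "\<exists>c. left_mean f c"
proof -
  \<comment> \<open>\<open>S\<close> collects the upper bounds attained by left averages of f; its
    infimum turns out to be the mean.\<close>
  define S where "S = {t. \<exists>as\<in>weights. \<forall>x\<in>carrier G. left_average as f x \<le> t}"
  obtain B where B: "\<And>x. x \<in> carrier G \<Longrightarrow> \<bar>f x\<bar> \<le> B" using cont_bounded[OF f] by blast
  have one: "[\<one>] \<in> weights" by (simp add: weights_def)
  have "B \<in> S"
    unfolding S_def using B by (auto intro!: bexI[OF _ one] left_average_le[OF one] simp: abs_le_iff)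
  have bdd: "bdd_below S"
  proof (rule bdd_belowI)
    fix t assume "t \<in> S"
    then obtain as where "as \<in> weights" "left_average as f \<one> \<le> t" unfolding S_def by auto
    moreover from this(1) have "- B \<le> left_average as f \<one>"
      using B by (intro left_average_ge) (auto simp: abs_le_iff minus_le_iff)
    ultimately show "- B \<le> t" by linarith
  qed
  define s where "s = Inf S"
  have s_le: "s \<le> t" if "t \<in> S" for t unfolding s_def using that bdd by (rule cInf_lower)
  have "left_mean f s"
    unfolding left_mean_def
  proof (intro allI impI)
    fix e :: real assume "e > 0"
    then have "e/2 > 0" by simp
    obtain V where V: "openin T V" "\<one> \<in> V"
      "\<And>x v. x \<in> carrier G \<Longrightarrow> v \<in> V \<Longrightarrow> \<bar>f (x \<otimes> v) - f x\<bar> < e/2"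
      using uniformly_continuous_on_compact[OF compactin_carrier f \<open>e/2 > 0\<close>] by blast
    obtain ys where ys: "set ys \<subseteq> carrier G" "\<And>x. x \<in> carrier G \<Longrightarrow> \<exists>y\<in>set ys. inv y \<otimes> x \<in> V"
      using compact_finite_translates[OF compactin_carrier V(1,2)] by blast
    have "ys \<noteq> []" using ys(2)[OF one_closed] by auto
    define n where "n = real (length ys)"
    have n: "n \<ge> 1" using \<open>ys \<noteq> []\<close> by (cases ys) (auto simp: n_def)
    \<comment> \<open>In an average over n translates one term falls below s by at least e/2 while
      the others exceed s by at most \<eta>; \<eta> n \<le> e/4 leaves a total gain of e/4. The
      bound \<eta> \<le> e serves the upper estimate.\<close>
    define \<eta> where "\<eta> = min e (e / (4 * n))"
    have \<eta>: "\<eta> > 0" "\<eta> \<le> e" "\<eta> * n \<le> e / 4"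
      using \<open>e > 0\<close> n by (auto simp: \<eta>_def min_def field_simps)
    have "s < s + \<eta>" using \<eta> by simp
    then obtain t where "t \<in> S" "t < s + \<eta>"
      using cInf_less_iff[OF _ bdd] \<open>B \<in> S\<close> unfolding s_def by blast
    then obtain as where as: "as \<in> weights" "\<And>x. x \<in> carrier G \<Longrightarrow> left_average as f x \<le> s + \<eta>"
      unfolding S_def by fastforce
    define h where "h = left_average as f"
    have "s - e \<le> h x0" if x0: "x0 \<in> carrier G" for x0
    proof (rule ccontr)
      assume "\<not> s - e \<le> h x0"
      then have hx0: "h x0 < s - e" by simp
      have VG: "V \<subseteq> carrier G" using openin_subset[OF V(1)] by (simp add: topspace)
      \<comment> \<open>Left averaging keeps the right-hand modulus of f, so a low value of h at x0
        persists on x0 V.\<close>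
      have near: "h (x0 \<otimes> v) < s - e/2" if v: "v \<in> V" for v
      proof -
        have "(\<Sum>a\<leftarrow>as. f (a \<otimes> (x0 \<otimes> v)) - f (a \<otimes> x0)) / real (length as) \<le> e/2"
        proof (rule list_average_le)
          show "as \<noteq> []" using as(1) by (simp add: weights_def)
          fix a assume "a \<in> set as"
          then have "a \<in> carrier G" using as(1) by (auto simp: weights_def)
          then have "\<bar>f (a \<otimes> x0 \<otimes> v) - f (a \<otimes> x0)\<bar> < e/2" using x0 v by (intro V(3)) auto
          moreover have "a \<otimes> x0 \<otimes> v = a \<otimes> (x0 \<otimes> v)"
            using \<open>a \<in> carrier G\<close> x0 v VG by (intro m_assoc) auto
          ultimately show "f (a \<otimes> (x0 \<otimes> v)) - f (a \<otimes> x0) \<le> e/2"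
            by (simp only: abs_less_iff) linarith
        qed
        then have "h (x0 \<otimes> v) - h x0 \<le> e/2"
          by (simp add: h_def left_average_def sum_list_subtractf diff_divide_distrib)
        with hx0 show ?thesis by linarith
      qed
      \<comment> \<open>If x lies in y V, then x0 y^-1 carries it into x0 V, where h is low; so
        every x has a low term in its average.\<close>
      define bs where "bs = map (\<lambda>y. x0 \<otimes> inv y) ys"
      have bs: "bs \<in> weights" using ys(1) \<open>ys \<noteq> []\<close> x0 by (auto simp: weights_def bs_def)
      have len: "real (length bs) = n" by (simp add: bs_def n_def)
      have "left_average bs h x \<le> s - e / (4 * n)" if x: "x \<in> carrier G" for x
      proof -
        obtain y where y: "y \<in> set ys" "inv y \<otimes> x \<in> V" using ys(2)[OF x] by blast
        then have yG: "y \<in> carrier G" using ys(1) by auto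
        define b where "b = x0 \<otimes> inv y"
        have b: "b \<in> set bs" using y(1) by (simp add: bs_def b_def)
        have "b \<otimes> x = x0 \<otimes> (inv y \<otimes> x)" using x0 yG x by (simp add: b_def m_assoc)
        then have hb: "h (b \<otimes> x) \<le> s - e/2" using near[OF y(2)] by simp
        have le: "h (a \<otimes> x) \<le> s + \<eta>" if "a \<in> set bs" for a
          using as(2) that bs x by (auto simp: h_def weights_def subset_iff)
        obtain us vs where split: "bs = us @ b # vs" using b by (meson split_list)
        have "(\<Sum>a\<leftarrow>us @ vs. h (a \<otimes> x)) \<le> (\<Sum>a\<leftarrow>us @ vs. s + \<eta>)"
          using le split by (intro sum_list_mono) auto
        also have "\<dots> = real (length (us @ vs)) * (s + \<eta>)" by (rule sum_list_triv)
        also have "real (length (us @ vs)) = n - 1" using len split by simp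
        finally have "(\<Sum>a\<leftarrow>us @ vs. h (a \<otimes> x)) \<le> (n - 1) * (s + \<eta>)" .
        then have "(\<Sum>a\<leftarrow>bs. h (a \<otimes> x)) \<le> (n - 1) * (s + \<eta>) + (s - e/2)"
          using hb split by simp
        also have "\<dots> = n * s + n * \<eta> - \<eta> - e/2" by (simp add: algebra_simps)
        also have "\<dots> \<le> n * s - e/4" using \<eta> by (simp add: algebra_simps)
        finally have "left_average bs h x \<le> (n * s - e/4) / n"
          unfolding left_average_def len using n by (intro divide_right_mono) auto
        also have "\<dots> = s - e / (4 * n)" using n by (simp add: field_simps)
        finally show ?thesis .
      qed
      moreover obtain cs where cs: "cs \<in> weights"
        "\<And>x. x \<in> carrier G \<Longrightarrow> left_average cs f x = left_average bs h x"
        using left_average_comp[OF as(1) bs] unfolding h_def by blast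
      ultimately have "s - e / (4 * n) \<in> S"
        unfolding S_def by (intro CollectI bexI[OF _ cs(1)]) (simp add: cs(2))
      from s_le[OF this] show False using \<open>e > 0\<close> n by (simp add: field_simps)
    qed
    then have "\<bar>left_average as f x - s\<bar> \<le> e" if "x \<in> carrier G" for x
      using as(2)[OF that] \<eta>(2) that unfolding h_def by (fastforce simp: abs_le_iff)
    with as(1) show "\<exists>as\<in>weights. \<forall>x\<in>carrier G. \<bar>left_average as f x - s\<bar> \<le> e" by blast
  qed
  then show ?thesis by blast
qed

text \<open>Inversion exchanges left and right translates.\<close>

lemma right_mean_exists:
  assumes f: "cont f"
  shows "\<exists>c. right_mean f c"
proof -
  have "cont (\<lambda>x. f (inv x))"
    using continuous_map_compose[OF continuous_inv[OF continuous_map_id] f] by (simp add: o_def)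
  then obtain c where c: "left_mean (\<lambda>x. f (inv x)) c" using left_mean_exists by blast
  have "right_mean f c"
    unfolding right_mean_def
  proof (intro allI impI)
    fix e :: real assume "e > 0"
    then obtain as where as: "as \<in> weights"
      "\<And>x. x \<in> carrier G \<Longrightarrow> \<bar>left_average as (\<lambda>x. f (inv x)) x - c\<bar> \<le> e"
      using c unfolding left_mean_def by blast
    define bs where "bs = map (\<lambda>a. inv a) as"
    have "bs \<in> weights" using as(1) by (auto simp: weights_def bs_def)
    moreover have "\<bar>right_average bs f x - c\<bar> \<le> e" if x: "x \<in> carrier G" for x
    proof -
      have "(\<Sum>a\<leftarrow>as. f (inv (a \<otimes> inv x))) = (\<Sum>a\<leftarrow>as. f (x \<otimes> inv a))"
        using as(1) x
        by (intro arg_cong[of _ _ sum_list] map_cong refl) (auto simp: weights_def inv_mult_group subset_iff)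
      then have "right_average bs f x = left_average as (\<lambda>x. f (inv x)) (inv x)"
        by (simp add: right_average_def left_average_def bs_def o_def)
      then show ?thesis using as(2)[of "inv x"] x by simp
    qed
    ultimately show "\<exists>bs\<in>weights. \<forall>x\<in>carrier G. \<bar>right_average bs f x - c\<bar> \<le> e" by blast
  qed
  then show ?thesis by blast
qed

text \<open>Apply a left and a right average together. As they commute and do not disturb closeness
  to a constant, one number lies within e of both c and d, where 2 e < \<bar>c - d\<bar>.\<close>

lemma left_mean_eq_right_mean:
  assumes "left_mean f c" "right_mean f d"
  shows "c = d"
proof (rule ccontr)
  assume "c \<noteq> d"
  define e where "e = \<bar>c - d\<bar> / 3"
  have "e > 0" using \<open>c \<noteq> d\<close> by (simp add: e_def)
  obtain as where as: "as \<in> weights" "\<And>x. x \<in> carrier G \<Longrightarrow> \<bar>left_average as f x - c\<bar> \<le> e"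
    using assms(1) \<open>e > 0\<close> unfolding left_mean_def by blast
  obtain bs where bs: "bs \<in> weights" "\<And>x. x \<in> carrier G \<Longrightarrow> \<bar>right_average bs f x - d\<bar> \<le> e"
    using assms(2) \<open>e > 0\<close> unfolding right_mean_def by blast
  have "\<bar>right_average bs (left_average as f) \<one> - c\<bar> \<le> e"
    by (rule right_average_near[OF bs(1) as(2)]) auto
  moreover have "\<bar>left_average as (right_average bs f) \<one> - d\<bar> \<le> e"
    by (rule left_average_near[OF as(1) bs(2)]) auto
  ultimately have "\<bar>c - d\<bar> \<le> e + e"
    unfolding left_right_average_commute[OF as(1) bs(1) one_closed]
    by (simp only: abs_le_iff) linarith
  then show False using \<open>e > 0\<close> by (simp add: e_def)
qed

text \<open>The right-handed characterisation is chosen because right averages commute with left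
  translations, from which left invariance is read off.\<close>

definition mean :: "('a \<Rightarrow> real) \<Rightarrow> real" where
  "mean f = (THE c. right_mean f c)"

lemma mean_eqI:
  assumes "cont f" "right_mean f c"
  shows "mean f = c"
  unfolding mean_def
  using assms left_mean_exists[OF assms(1)] left_mean_eq_right_mean by (intro the_equality) blast+

lemma right_mean_mean: "cont f \<Longrightarrow> right_mean f (mean f)"
  using right_mean_exists mean_eqI by blast

lemma left_mean_mean: "cont f \<Longrightarrow> left_mean f (mean f)"
  using left_mean_exists right_mean_mean left_mean_eq_right_mean by metis

text \<open>The right averages that nearly flatten f also nearly flatten its left average: the two
  operations commute, and left averaging preserves closeness to a constant.\<close>

lemma mean_left_average:
  assumes f: "cont f" and as: "as \<in> weights"
  shows "mean (left_average as f) = mean f"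
proof (rule mean_eqI[OF cont_left_average[OF f as]])
  show "right_mean (left_average as f) (mean f)"
    unfolding right_mean_def
  proof (intro allI impI)
    fix e :: real assume "e > 0"
    then obtain bs where bs: "bs \<in> weights" "\<And>x. x \<in> carrier G \<Longrightarrow> \<bar>right_average bs f x - mean f\<bar> \<le> e"
      using right_mean_mean[OF f] unfolding right_mean_def by blast
    have "\<bar>right_average bs (left_average as f) x - mean f\<bar> \<le> e" if "x \<in> carrier G" for x
      unfolding left_right_average_commute[OF as bs(1) that] by (rule left_average_near[OF as bs(2) that])
    with bs(1) show "\<exists>bs\<in>weights. \<forall>x\<in>carrier G. \<bar>right_average bs (left_average as f) x - mean f\<bar> \<le> e"
      by blast
  qed
qed

lemma mean_left_translate:
  assumes f: "cont f" and a: "a \<in> carrier G"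
  shows "mean (\<lambda>x. f (a \<otimes> x)) = mean f"
  using mean_left_average[OF f, of "[a]"] a by (simp add: left_average_def[abs_def] weights_def)

text \<open>One list must serve both summands. After averaging for f, the averaged g still has mean
  \<open>mean g\<close>; a second averaging chosen for it leaves f close to its mean.\<close>

lemma mean_add:
  assumes f: "cont f" and g: "cont g"
  shows "mean (\<lambda>x. f x + g x) = mean f + mean g"
proof -
  have fg: "cont (\<lambda>x. f x + g x)" by (rule continuous_map_add[OF f g])
  have "left_mean (\<lambda>x. f x + g x) (mean f + mean g)"
    unfolding left_mean_def
  proof (intro allI impI)
    fix e :: real assume "e > 0"
    then have "e/2 > 0" by simp
    obtain as where as: "as \<in> weights" "\<And>x. x \<in> carrier G \<Longrightarrow> \<bar>left_average as f x - mean f\<bar> \<le> e/2"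
      using left_mean_mean[OF f] \<open>e/2 > 0\<close> unfolding left_mean_def by blast
    have "left_mean (left_average as g) (mean g)"
      using left_mean_mean[OF cont_left_average[OF g as(1)]] mean_left_average[OF g as(1)] by simp
    then obtain bs where bs: "bs \<in> weights"
      "\<And>x. x \<in> carrier G \<Longrightarrow> \<bar>left_average bs (left_average as g) x - mean g\<bar> \<le> e/2"
      using \<open>e/2 > 0\<close> unfolding left_mean_def by blast
    obtain cs where cs: "cs \<in> weights"
      "\<And>f x. x \<in> carrier G \<Longrightarrow> left_average cs f x = left_average bs (left_average as f) x"
      using left_average_comp[OF as(1) bs(1)] by blast
    have "\<bar>left_average cs (\<lambda>x. f x + g x) x - (mean f + mean g)\<bar> \<le> e" if x: "x \<in> carrier G" for x
    proof -
      have "left_average cs (\<lambda>x. f x + g x) x = left_average cs f x + left_average cs g x"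
        by (simp add: left_average_def sum_list_addf add_divide_distrib)
      moreover have "\<bar>left_average cs f x - mean f\<bar> \<le> e/2"
        unfolding cs(2)[OF x] by (rule left_average_near[OF bs(1) as(2) x])
      moreover have "\<bar>left_average cs g x - mean g\<bar> \<le> e/2"
        unfolding cs(2)[OF x] by (rule bs(2)[OF x])
      ultimately show ?thesis by (simp only: abs_le_iff) linarith
    qed
    with cs(1) show "\<exists>as\<in>weights. \<forall>x\<in>carrier G.
        \<bar>left_average as (\<lambda>x. f x + g x) x - (mean f + mean g)\<bar> \<le> e" by blast
  qed
  from left_mean_eq_right_mean[OF this right_mean_mean[OF fg]] show ?thesis by simp
qed

lemma mean_ge:
  assumes f: "cont f" and ge: "\<And>x. x \<in> carrier G \<Longrightarrow> t \<le> f x"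
  shows "t \<le> mean f"
proof (rule field_le_epsilon)
  fix e :: real assume "e > 0"
  then obtain as where as: "as \<in> weights" "\<And>x. x \<in> carrier G \<Longrightarrow> \<bar>left_average as f x - mean f\<bar> \<le> e"
    using left_mean_mean[OF f] unfolding left_mean_def by blast
  have "t \<le> left_average as f \<one>" by (rule left_average_ge[OF as(1) ge]) auto
  then show "t \<le> mean f + e" using as(2)[OF one_closed] by (simp add: abs_le_iff)
qed

lemma mean_scale:
  assumes f: "cont f"
  shows "mean (\<lambda>x. r * f x) = r * mean f"
proof -
  have rf: "cont (\<lambda>x. r * f x)" using f by (intro continuous_map_real_mult) auto
  have "left_mean (\<lambda>x. r * f x) (r * mean f)"
    unfolding left_mean_def
  proof (intro allI impI)
    fix e :: real assume "e > 0"
    then have "e / (\<bar>r\<bar> + 1) > 0" by simp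
    then obtain as where as: "as \<in> weights"
      "\<And>x. x \<in> carrier G \<Longrightarrow> \<bar>left_average as f x - mean f\<bar> \<le> e / (\<bar>r\<bar> + 1)"
      using left_mean_mean[OF f] unfolding left_mean_def by blast
    have "\<bar>left_average as (\<lambda>x. r * f x) x - r * mean f\<bar> \<le> e" if x: "x \<in> carrier G" for x
    proof -
      have "left_average as (\<lambda>x. r * f x) x = r * left_average as f x"
        by (simp add: left_average_def sum_list_const_mult)
      then have "\<bar>left_average as (\<lambda>x. r * f x) x - r * mean f\<bar> = \<bar>r\<bar> * \<bar>left_average as f x - mean f\<bar>"
        by (simp add: abs_mult[symmetric] right_diff_distrib)
      also have "\<dots> \<le> (\<bar>r\<bar> + 1) * (e / (\<bar>r\<bar> + 1))"
        using as(2)[OF x] by (intro mult_mono) auto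
      also have "\<dots> = e" by (simp add: field_simps add_nonneg_pos)
      finally show ?thesis .
    qed
    with as(1) show "\<exists>as\<in>weights. \<forall>x\<in>carrier G. \<bar>left_average as (\<lambda>x. r * f x) x - r * mean f\<bar> \<le> e"
      by blast
  qed
  from left_mean_eq_right_mean[OF this right_mean_mean[OF rf]] show ?thesis by simp
qed

lemma mean_le:
  assumes f: "cont f" and le: "\<And>x. x \<in> carrier G \<Longrightarrow> f x \<le> t"
  shows "mean f \<le> t"
proof -
  have "cont (\<lambda>x. - 1 * f x)" using f by (intro continuous_map_real_mult) auto
  then have "- t \<le> mean (\<lambda>x. - 1 * f x)" using le by (intro mean_ge) auto
  then show ?thesis using mean_scale[OF f, of "- 1"] by simp
qed

text \<open>Finitely many translates of the open set where f > \<delta> cover the group, so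
  averaging over them yields a function bounded below by a positive constant with the same
  mean.\<close>

lemma mean_pos:
  assumes f: "cont f" and nonneg: "\<And>x. x \<in> carrier G \<Longrightarrow> 0 \<le> f x"
    and x0: "x0 \<in> carrier G" "f x0 > 0"
  shows "mean f > 0"
proof -
  define \<delta> where "\<delta> = f x0 / 2"
  have "\<delta> > 0" using x0 by (simp add: \<delta>_def)
  have "openin T {x \<in> topspace T. f x \<in> {\<delta><..}}" by (rule openin_continuous_map_preimage[OF f]) simp
  then have U: "openin T {x \<in> carrier G. f x > \<delta>}" by (simp add: topspace)
  define V where "V = {v \<in> carrier G. x0 \<otimes> v \<in> {x \<in> carrier G. f x > \<delta>}}"
  have V: "openin T V" unfolding V_def by (rule openin_left_mult_vimage[OF U x0(1)])
  have V1: "\<one> \<in> V" using x0 by (simp add: V_def \<delta>_def)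
  obtain ys where ys: "set ys \<subseteq> carrier G" "\<And>x. x \<in> carrier G \<Longrightarrow> \<exists>y\<in>set ys. inv y \<otimes> x \<in> V"
    using compact_finite_translates[OF compactin_carrier V V1] by blast
  have "ys \<noteq> []" using ys(2)[OF one_closed] by auto
  define bs where "bs = map (\<lambda>y. x0 \<otimes> inv y) ys"
  have bs: "bs \<in> weights" using ys(1) \<open>ys \<noteq> []\<close> x0(1) by (auto simp: weights_def bs_def)
  have "\<delta> / real (length bs) \<le> left_average bs f x" if x: "x \<in> carrier G" for x
  proof -
    obtain y where y: "y \<in> set ys" "inv y \<otimes> x \<in> V" using ys(2)[OF x] by blast
    then have yG: "y \<in> carrier G" using ys(1) by auto
    have "(x0 \<otimes> inv y) \<otimes> x = x0 \<otimes> (inv y \<otimes> x)" using x0 yG x by (simp add: m_assoc)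
    then have "\<delta> \<le> f ((x0 \<otimes> inv y) \<otimes> x)" using y(2) by (simp add: V_def)
    also have "\<dots> \<le> (\<Sum>b\<leftarrow>bs. f (b \<otimes> x))"
    proof -
      have "x0 \<otimes> inv y \<in> set bs" using y(1) by (simp add: bs_def)
      then obtain us vs where split: "bs = us @ (x0 \<otimes> inv y) # vs" by (meson split_list)
      have "0 \<le> (\<Sum>b\<leftarrow>us @ vs. f (b \<otimes> x))"
        using bs split x nonneg by (intro sum_list_nonneg) (auto simp: weights_def)
      then show ?thesis by (simp add: split)
    qed
    finally show ?thesis unfolding left_average_def by (intro divide_right_mono) auto
  qed
  then have "\<delta> / real (length bs) \<le> mean (left_average bs f)"
    by (rule mean_ge[OF cont_left_average[OF f bs]])
  moreover have "\<delta> / real (length bs) > 0"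
    using \<open>\<delta> > 0\<close> bs by (simp add: weights_def)
  ultimately show ?thesis using mean_left_average[OF f bs] by simp
qed

lemma mean_diff_le:
  assumes f: "cont f" and g: "cont g" and le: "\<And>x. x \<in> carrier G \<Longrightarrow> \<bar>f x - g x\<bar> \<le> e"
  shows "\<bar>mean f - mean g\<bar> \<le> e"
proof -
  have g': "cont (\<lambda>x. - 1 * g x)" using g by (intro continuous_map_real_mult) auto
  have fg: "cont (\<lambda>x. f x + - 1 * g x)" by (rule continuous_map_add[OF f g'])
  have bd: "- e \<le> f x + - 1 * g x" "f x + - 1 * g x \<le> e" if "x \<in> carrier G" for x
    using le[OF that] by (auto simp: abs_le_iff)
  have "mean (\<lambda>x. f x + - 1 * g x) = mean f - mean g"
    unfolding mean_add[OF f g'] mean_scale[OF g] by simp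
  with mean_ge[OF fg bd(1)] mean_le[OF fg bd(2)] show ?thesis by (simp add: abs_le_iff)
qed

text \<open>The mean is applied to functions on the whole type, but depends on their values on the
  carrier only.\<close>

lemma mean_cong:
  assumes f: "cont f" and eq: "\<And>x. x \<in> carrier G \<Longrightarrow> f x = g x"
  shows "mean f = mean g"
proof -
  have "cont g" using eq by (intro continuous_map_eq[OF f]) (simp add: topspace)
  from mean_diff_le[OF f this, of 0] eq show ?thesis by simp
qed

lemma mean_sum_list:
  assumes "\<And>i. i \<in> set is \<Longrightarrow> cont (f i)"
  shows "cont (\<lambda>x. \<Sum>i\<leftarrow>is. f i x) \<and> mean (\<lambda>x. \<Sum>i\<leftarrow>is. f i x) = (\<Sum>i\<leftarrow>is. mean (f i))"
  using assms
proof (induction "is")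
  case Nil
  have "cont (\<lambda>x. 0)" by simp
  from mean_scale[OF this, of 0] show ?case by simp
next
  case (Cons i "is")
  then have "cont (f i)" "cont (\<lambda>x. \<Sum>i\<leftarrow>is. f i x)"
    "mean (\<lambda>x. \<Sum>i\<leftarrow>is. f i x) = (\<Sum>i\<leftarrow>is. mean (f i))" by auto
  then show ?case using mean_add[of "f i" "\<lambda>x. \<Sum>i\<leftarrow>is. f i x"] by (simp add: continuous_map_add)
qed

end

subsection \<open>Compact normal subgroups\<close>

lemma topological_group_subgroup:
  assumes "topological_group G T" "subgroup N G"
  shows "topological_group (G\<lparr>carrier := N\<rparr>) (subtopology T N)"
proof -
  have "group G" using assms(1) by (simp add: topological_group_def)
  interpret topological_group_on G T
    by (intro topological_group_on.intro topological_group_on_axioms.intro assms(1) \<open>group G\<close>)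
  interpret subgroup N G by fact
  have inc: "continuous_map (subtopology T N) T (\<lambda>x. x)" by (rule continuous_map_from_subtopology) simp
  have "continuous_map (prod_topology (subtopology T N) (subtopology T N)) T (\<lambda>p. fst p \<otimes>\<^bsub>G\<^esub> snd p)"
    using continuous_map_compose[OF continuous_map_fst inc] continuous_map_compose[OF continuous_map_snd inc]
    by (intro continuous_mult) (simp_all add: o_def)
  then have "continuous_map (prod_topology (subtopology T N) (subtopology T N)) (subtopology T N)
      (\<lambda>(x, y). x \<otimes>\<^bsub>G\<^esub> y)"
    by (auto simp: continuous_map_in_subtopology case_prod_unfold)
  moreover have "continuous_map (subtopology T N) (subtopology T N) (\<lambda>x. inv\<^bsub>G\<lparr>carrier := N\<rparr>\<^esub> x)"
  proof (rule continuous_map_eq)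
    show "continuous_map (subtopology T N) (subtopology T N) (\<lambda>x. inv\<^bsub>G\<^esub> x)"
      using continuous_inv[OF inc] by (auto simp: continuous_map_in_subtopology)
    show "inv\<^bsub>G\<^esub> x = inv\<^bsub>G\<lparr>carrier := N\<rparr>\<^esub> x" if "x \<in> topspace (subtopology T N)" for x
      using that m_inv_consistent[OF assms(2)] by simp
  qed
  ultimately show ?thesis
    using subgroup_imp_group[OF assms(2)] subset topspace
    by (auto simp: topological_group_def case_prod_unfold)
qed

section \<open>Averaging over the cosets of a compact normal subgroup\<close>

locale compact_normal_subgroup = topological_group_on G T + normal N G
  for G (structure) and T and N +
  assumes compact_normal: "compactin T N"
begin

sublocale N: compact_topological_group "G\<lparr>carrier := N\<rparr>" "subtopology T N"
proof (intro compact_topological_group.intro compact_topological_group_axioms.intro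
    topological_group_on.intro topological_group_on_axioms.intro)
  show "group (G\<lparr>carrier := N\<rparr>)" by (rule subgroup_imp_group[OF subgroup_axioms])
  show "topological_group (G\<lparr>carrier := N\<rparr>) (subtopology T N)"
    by (rule topological_group_subgroup[OF topological_group subgroup_axioms])
  show "compact_space (subtopology T N)"
    using compact_normal by (simp add: compactin_subspace)
qed

abbreviation Q :: "'a set monoid" where "Q \<equiv> G Mod N"

abbreviation TQ :: "'a set topology" where "TQ \<equiv> coset_topology G T N"

declare mult_FactGroup [simp del] one_FactGroup [simp del]

lemma coset_in_Q: "x \<in> carrier G \<Longrightarrow> N #> x \<in> carrier Q"
  by (simp add: carrier_FactGroup)

lemma mult_Q: "x \<in> carrier G \<Longrightarrow> y \<in> carrier G \<Longrightarrow> (N #> x) \<otimes>\<^bsub>Q\<^esub> (N #> y) = N #> (x \<otimes> y)"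
  by (simp add: FactGroup_def rcos_sum)

lemma one_Q: "\<one>\<^bsub>Q\<^esub> = N #> \<one>"
  using coset_mult_one[OF subset] by (simp add: FactGroup_def)

lemma group_Q: "group Q"
  by (rule factorgroup_is_group)

lemma inv_Q: "x \<in> carrier G \<Longrightarrow> inv\<^bsub>Q\<^esub> (N #> x) = N #> inv x"
  by (intro group.inv_equality[OF group_Q]) (simp_all add: mult_Q one_Q coset_in_Q)

lemma topspace_TQ: "topspace TQ = carrier Q"
  by (simp add: coset_topology_def carrier_FactGroup topspace)

lemma quotient_map_TQ: "quotient_map T TQ (\<lambda>x. N #> x)"
  unfolding coset_topology_def by (rule quotient_map_quotient_topology)

text \<open>Conjugation descends from the group through the quotient map. The results on translates
  require of the quotient topology just this continuity, besides its underlying set.\<close>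

lemma continuous_conjugation_Q:
  assumes "A \<in> carrier Q"
  shows "continuous_map TQ TQ (\<lambda>X. A \<otimes>\<^bsub>Q\<^esub> X \<otimes>\<^bsub>Q\<^esub> inv\<^bsub>Q\<^esub> A)"
proof -
  obtain g where g: "g \<in> carrier G" "A = N #> g" using assms by (auto simp: carrier_FactGroup)
  have "continuous_map T TQ ((\<lambda>x. N #> x) \<circ> (\<lambda>x. g \<otimes> x \<otimes> inv g))"
    by (rule continuous_map_compose[OF continuous_conjugation[OF g(1)] quotient_imp_continuous_map[OF quotient_map_TQ]])
  then have "continuous_map T TQ ((\<lambda>X. A \<otimes>\<^bsub>Q\<^esub> X \<otimes>\<^bsub>Q\<^esub> inv\<^bsub>Q\<^esub> A) \<circ> (\<lambda>x. N #> x))"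
    by (rule continuous_map_eq) (simp add: topspace g mult_Q inv_Q)
  then show ?thesis by (rule continuous_compose_quotient_map[OF quotient_map_TQ])
qed

text \<open>The elements of \<open>N\<close> are multiplied from the right, so that averaging
  commutes with left translation. The representative is arbitrary, by normality and invariance of
  the mean on \<open>N\<close>.\<close>

definition coset_mean :: "('a \<Rightarrow> real) \<Rightarrow> 'a set \<Rightarrow> real" where
  "coset_mean \<phi> X = (if X \<in> carrier Q then N.mean (\<lambda>n. \<phi> ((SOME x. x \<in> X) \<otimes> n)) else 0)"

lemma cont_coset:
  assumes "continuous_map T euclideanreal \<phi>" "x \<in> carrier G"
  shows "N.cont (\<lambda>n. \<phi> (x \<otimes> n))"
proof -
  have "continuous_map T euclideanreal (\<phi> \<circ> (\<lambda>n. x \<otimes> n))"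
    by (rule continuous_map_compose[OF continuous_left_mult[OF assms(2)] assms(1)])
  then show ?thesis by (auto simp: o_def intro: continuous_map_from_subtopology)
qed

text \<open>Another representative n x of the right coset equals x k with k = x^-1 n x in
  \<open>N\<close>, and the mean on \<open>N\<close> absorbs the left factor k.\<close>

lemma coset_mean_eq:
  assumes \<phi>: "continuous_map T euclideanreal \<phi>" and x: "x \<in> carrier G"
  shows "coset_mean \<phi> (N #> x) = N.mean (\<lambda>n. \<phi> (x \<otimes> n))"
proof -
  let ?y = "SOME y. y \<in> N #> x"
  have "?y \<in> N #> x" using rcos_self[OF x subgroup_axioms] by (rule someI)
  then obtain n where n: "n \<in> N" "?y = n \<otimes> x" by (auto simp: r_coset_def)
  have nG: "n \<in> carrier G" using n(1) subset by auto
  define k where "k = inv x \<otimes> n \<otimes> x"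
  have k: "k \<in> N" unfolding k_def by (rule inv_op_closed1[OF x n(1)])
  have kG: "k \<in> carrier G" using k subset by auto
  have xk: "x \<otimes> k = n \<otimes> x" using x nG by (simp add: k_def m_assoc[symmetric])
  have "N.mean (\<lambda>m. \<phi> (?y \<otimes> m)) = N.mean (\<lambda>m. \<phi> (x \<otimes> (k \<otimes> m)))"
  proof (rule N.mean_cong[OF cont_coset[OF \<phi>]])
    show "?y \<in> carrier G" using n nG x by simp
    fix m assume "m \<in> carrier (G\<lparr>carrier := N\<rparr>)"
    then have "m \<in> carrier G" using subset by auto
    then have "?y \<otimes> m = x \<otimes> (k \<otimes> m)" using n(2) xk x kG by (simp add: m_assoc[symmetric])
    then show "\<phi> (?y \<otimes> m) = \<phi> (x \<otimes> (k \<otimes> m))" by simp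
  qed
  also have "\<dots> = N.mean (\<lambda>m. \<phi> (x \<otimes> m))"
    using N.mean_left_translate[OF cont_coset[OF \<phi> x], of k] k by simp
  finally show ?thesis using x by (simp add: coset_mean_def coset_in_Q)
qed

lemma coset_mean_add:
  assumes \<phi>: "continuous_map T euclideanreal \<phi>" and \<psi>: "continuous_map T euclideanreal \<psi>"
  shows "coset_mean (\<lambda>x. \<phi> x + \<psi> x) = (\<lambda>X. coset_mean \<phi> X + coset_mean \<psi> X)"
proof
  fix X
  show "coset_mean (\<lambda>x. \<phi> x + \<psi> x) X = coset_mean \<phi> X + coset_mean \<psi> X"
  proof (cases "X \<in> carrier Q")
    case True
    then obtain x where x: "x \<in> carrier G" "X = N #> x" by (auto simp: carrier_FactGroup)
    show ?thesis
      unfolding x(2) coset_mean_eq[OF continuous_map_add[OF \<phi> \<psi>] x(1)] coset_mean_eq[OF \<phi> x(1)]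
        coset_mean_eq[OF \<psi> x(1)]
      by (rule N.mean_add[OF cont_coset[OF \<phi> x(1)] cont_coset[OF \<psi> x(1)]])
  qed (simp add: coset_mean_def)
qed

lemma coset_mean_scale:
  assumes \<phi>: "continuous_map T euclideanreal \<phi>"
  shows "coset_mean (\<lambda>x. c * \<phi> x) = (\<lambda>X. c * coset_mean \<phi> X)"
proof
  fix X
  have c\<phi>: "continuous_map T euclideanreal (\<lambda>x. c * \<phi> x)"
    using \<phi> by (intro continuous_map_real_mult) auto
  show "coset_mean (\<lambda>x. c * \<phi> x) X = c * coset_mean \<phi> X"
  proof (cases "X \<in> carrier Q")
    case True
    then obtain x where x: "x \<in> carrier G" "X = N #> x" by (auto simp: carrier_FactGroup)
    show ?thesis
      unfolding x(2) coset_mean_eq[OF c\<phi> x(1)] coset_mean_eq[OF \<phi> x(1)]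
      by (rule N.mean_scale[OF cont_coset[OF \<phi> x(1)]])
  qed (simp add: coset_mean_def)
qed

lemma coset_mean_nonneg:
  assumes \<phi>: "continuous_map T euclideanreal \<phi>" and nonneg: "\<And>x. x \<in> carrier G \<Longrightarrow> 0 \<le> \<phi> x"
    and X: "X \<in> carrier Q"
  shows "0 \<le> coset_mean \<phi> X"
proof -
  obtain x where x: "x \<in> carrier G" "X = N #> x" using X by (auto simp: carrier_FactGroup)
  show ?thesis
    unfolding x(2) coset_mean_eq[OF \<phi> x(1)]
    using nonneg x(1) subset by (intro N.mean_ge cont_coset \<phi>) auto
qed

text \<open>Left translation commutes with right multiplication by \<open>N\<close>. Equality also
  holds off the carrier of the quotient: there \<open>coset_mean\<close> has its default 0, and
  \<open>left_translate\<close> leaves it alone.\<close>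

lemma coset_mean_left_translate:
  assumes \<phi>: "continuous_map T euclideanreal \<phi>" and g: "g \<in> carrier G"
    and L\<phi>: "continuous_map T euclideanreal (left_translate G g \<phi>)"
  shows "coset_mean (left_translate G g \<phi>) = left_translate Q (N #> g) (coset_mean \<phi>)"
proof
  fix X
  show "coset_mean (left_translate G g \<phi>) X = left_translate Q (N #> g) (coset_mean \<phi>) X"
  proof (cases "X \<in> carrier Q")
    case True
    then obtain x where x: "x \<in> carrier G" "X = N #> x" by (auto simp: carrier_FactGroup)
    have gx: "g \<otimes> x \<in> carrier G" using g x by simp
    have "left_translate Q (N #> g) (coset_mean \<phi>) X = coset_mean \<phi> (N #> (g \<otimes> x))"
      using x g by (simp add: left_translate_def coset_in_Q mult_Q)
    also have "\<dots> = N.mean (\<lambda>n. \<phi> (g \<otimes> x \<otimes> n))" by (rule coset_mean_eq[OF \<phi> gx])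
    also have "\<dots> = N.mean (\<lambda>n. left_translate G g \<phi> (x \<otimes> n))"
      using g x(1) subset
      by (intro N.mean_cong[OF cont_coset[OF \<phi> gx]]) (auto simp: left_translate_def m_assoc subset_iff)
    also have "\<dots> = coset_mean (left_translate G g \<phi>) X"
      unfolding x(2) by (rule coset_mean_eq[OF L\<phi> x(1), symmetric])
    finally show ?thesis ..
  qed (simp add: coset_mean_def left_translate_def)
qed

text \<open>The estimate for a left factor in \<open>V\<close> is uniform along cosets and survives
  the mean. The image of \<open>V\<close> is open because its preimage is a union of translates of
  \<open>V\<close> by elements of \<open>N\<close>.\<close>

lemma ruc_coset_mean:
  assumes "ruc G T \<phi>"
  shows "ruc Q TQ (coset_mean \<phi>)"
  unfolding ruc_def
proof (intro conjI allI impI)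
  have \<phi>: "continuous_map T euclideanreal \<phi>" by (rule ruc_continuous[OF assms])
  obtain B where B: "\<And>x. x \<in> carrier G \<Longrightarrow> \<bar>\<phi> x\<bar> \<le> B" using assms by (auto simp: ruc_def)
  have "\<bar>coset_mean \<phi> X\<bar> \<le> B" if "X \<in> carrier Q" for X
  proof -
    obtain x where x: "x \<in> carrier G" "X = N #> x" using \<open>X \<in> carrier Q\<close> by (auto simp: carrier_FactGroup)
    have "- B \<le> \<phi> (x \<otimes> n)" "\<phi> (x \<otimes> n) \<le> B" if "n \<in> N" for n
      using B[of "x \<otimes> n"] that x(1) subset by (auto simp: abs_le_iff)
    then show ?thesis
      unfolding x(2) coset_mean_eq[OF \<phi> x(1)]
      using N.mean_ge[OF cont_coset[OF \<phi> x(1)], of "- B"] N.mean_le[OF cont_coset[OF \<phi> x(1)], of B]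
      by (simp add: abs_le_iff)
  qed
  then show "\<exists>B. \<forall>X\<in>carrier Q. \<bar>coset_mean \<phi> X\<bar> \<le> B" by blast
  fix e :: real assume "e > 0"
  \<comment> \<open>Means preserve only weak inequalities; halving restores a strict one.\<close>
  then have "e/2 > 0" by simp
  obtain V where V: "openin T V" "\<one> \<in> V"
    "\<And>a x. a \<in> V \<Longrightarrow> x \<in> carrier G \<Longrightarrow> \<bar>\<phi> (a \<otimes> x) - \<phi> x\<bar> < e/2"
    using rucD[OF assms \<open>e/2 > 0\<close>] by blast
  have VG: "V \<subseteq> carrier G" using openin_subset[OF V(1)] by (simp add: topspace)
  let ?W = "(\<lambda>x. N #> x) ` V"
  have "openin TQ ?W"
    unfolding coset_topology_def openin_quotient_topology
  proof
    show "?W \<subseteq> (\<lambda>x. N #> x) ` topspace T" using VG by (auto simp: topspace)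
    have "{x \<in> topspace T. N #> x \<in> ?W} = (\<Union>n\<in>N. {x \<in> carrier G. n \<otimes> x \<in> V})"
    proof (intro equalityI subsetI)
      fix x assume "x \<in> {x \<in> topspace T. N #> x \<in> ?W}"
      then obtain v where v: "x \<in> carrier G" "v \<in> V" "N #> x = N #> v" by (auto simp: topspace)
      then have "v \<in> N #> x" using rcos_self[OF _ subgroup_axioms, of v] VG by auto
      then obtain n where "n \<in> N" "v = n \<otimes> x" by (auto simp: r_coset_def)
      with v show "x \<in> (\<Union>n\<in>N. {x \<in> carrier G. n \<otimes> x \<in> V})" by auto
    next
      fix x assume "x \<in> (\<Union>n\<in>N. {x \<in> carrier G. n \<otimes> x \<in> V})"
      then obtain n where n: "n \<in> N" "x \<in> carrier G" "n \<otimes> x \<in> V" by auto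
      then have "n \<otimes> x \<in> N #> x" by (auto simp: r_coset_def)
      then have "N #> (n \<otimes> x) = N #> x"
        using repr_independence[OF _ _ subgroup_axioms] n(2) by metis
      with n show "x \<in> {x \<in> topspace T. N #> x \<in> ?W}" by (metis (mono_tags, lifting) imageI mem_Collect_eq topspace)
    qed
    also have "openin T \<dots>"
      using subset by (intro openin_Union) (auto intro!: openin_left_mult_vimage V(1))
    finally show "openin T {x \<in> topspace T. N #> x \<in> ?W}" .
  qed
  moreover have "\<one>\<^bsub>Q\<^esub> \<in> ?W" using V(2) by (simp add: one_Q)
  moreover have "\<bar>coset_mean \<phi> (A \<otimes>\<^bsub>Q\<^esub> X) - coset_mean \<phi> X\<bar> < e" if A: "A \<in> ?W" and X: "X \<in> carrier Q" for A X
  proof -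
    obtain x where x: "x \<in> carrier G" "X = N #> x" using X by (auto simp: carrier_FactGroup)
    obtain a where a: "a \<in> V" "A = N #> a" using A by auto
    have aG: "a \<in> carrier G" using a VG by auto
    have ax: "a \<otimes> x \<in> carrier G" using aG x by simp
    have "\<bar>N.mean (\<lambda>n. \<phi> (a \<otimes> x \<otimes> n)) - N.mean (\<lambda>n. \<phi> (x \<otimes> n))\<bar> \<le> e/2"
    proof (rule N.mean_diff_le[OF cont_coset[OF \<phi> ax] cont_coset[OF \<phi> x(1)]])
      fix n assume "n \<in> carrier (G\<lparr>carrier := N\<rparr>)"
      then have n: "n \<in> carrier G" using subset by auto
      then show "\<bar>\<phi> (a \<otimes> x \<otimes> n) - \<phi> (x \<otimes> n)\<bar> \<le> e/2"
        using V(3)[OF a(1), of "x \<otimes> n"] x(1) aG by (simp add: m_assoc)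
    qed
    then show ?thesis
      using \<open>e > 0\<close> aG x(1)
      by (simp add: a(2) x(2) mult_Q coset_mean_eq[OF \<phi> ax] coset_mean_eq[OF \<phi> x(1)])
  qed
  ultimately show "\<exists>W. openin TQ W \<and> \<one>\<^bsub>Q\<^esub> \<in> W \<and>
      (\<forall>A\<in>W. \<forall>X\<in>carrier Q. \<bar>coset_mean \<phi> (A \<otimes>\<^bsub>Q\<^esub> X) - coset_mean \<phi> X\<bar> < e)" by blast
qed

text \<open>The mean is linear and positive, so it can be applied to both sides of the domination; a
  translate by g turns into a translate by the coset of g.\<close>

lemma coset_mean_dominated:
  assumes f: "ruc G T f" and D: "\<phi> \<in> dominated G T f"
  shows "coset_mean \<phi> \<in> dominated Q TQ (coset_mean f)"
proof -
  have f': "continuous_map T euclideanreal f" by (rule ruc_continuous[OF f])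
  have \<phi>: "continuous_map T euclideanreal \<phi>" by (rule dominated_continuous[OF D])
  obtain c gs where 1: "c \<ge> 0" "set gs \<subseteq> carrier G"
    "\<And>x. x \<in> carrier G \<Longrightarrow> \<bar>\<phi> x\<bar> \<le> c * (\<Sum>g\<leftarrow>gs. f (g \<otimes> x))"
    using D unfolding dominated_def by blast
  let ?hs = "map (\<lambda>g. N #> g) gs"
  have "\<bar>coset_mean \<phi> X\<bar> \<le> c * (\<Sum>A\<leftarrow>?hs. coset_mean f (A \<otimes>\<^bsub>Q\<^esub> X))" if X: "X \<in> carrier Q" for X
  proof -
    obtain x where x: "x \<in> carrier G" "X = N #> x" using X by (auto simp: carrier_FactGroup)
    let ?h = "\<lambda>n. \<Sum>g\<leftarrow>gs. f (g \<otimes> x \<otimes> n)"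
    have gx: "g \<otimes> x \<in> carrier G" if "g \<in> set gs" for g using that 1(2) x(1) by auto
    have h: "N.cont ?h" "N.mean ?h = (\<Sum>g\<leftarrow>gs. N.mean (\<lambda>n. f (g \<otimes> x \<otimes> n)))"
      using N.mean_sum_list[of gs "\<lambda>g n. f (g \<otimes> x \<otimes> n)"] cont_coset[OF f' gx] by auto
    have ch: "N.cont (\<lambda>n. c * ?h n)" using h(1) by (intro continuous_map_real_mult) auto
    have le: "\<bar>\<phi> (x \<otimes> n)\<bar> \<le> c * ?h n" if "n \<in> N" for n
    proof -
      have n: "n \<in> carrier G" using that subset by auto
      have "(\<Sum>g\<leftarrow>gs. f (g \<otimes> (x \<otimes> n))) = ?h n"
        using n x(1) 1(2) by (intro arg_cong[of _ _ sum_list] map_cong refl) (auto simp: m_assoc subset_iff)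
      then show ?thesis using 1(3)[of "x \<otimes> n"] n x(1) by simp
    qed
    have \<phi>x: "N.cont (\<lambda>n. \<phi> (x \<otimes> n))" by (rule cont_coset[OF \<phi> x(1)])
    have "0 \<le> N.mean (\<lambda>n. c * ?h n + - 1 * \<phi> (x \<otimes> n))"
      using le by (intro N.mean_ge continuous_map_add[OF ch] continuous_map_real_mult[OF _ \<phi>x])
        (auto simp: abs_le_iff)
    also have "\<dots> = c * N.mean ?h + - 1 * N.mean (\<lambda>n. \<phi> (x \<otimes> n))"
    proof -
      have "N.cont (\<lambda>n. - 1 * \<phi> (x \<otimes> n))" by (intro continuous_map_real_mult[OF _ \<phi>x]) simp
      from N.mean_add[OF ch this] show ?thesis by (simp only: N.mean_scale[OF h(1)] N.mean_scale[OF \<phi>x])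
    qed
    finally have up: "N.mean (\<lambda>n. \<phi> (x \<otimes> n)) \<le> c * N.mean ?h" by simp
    have "0 \<le> N.mean (\<lambda>n. c * ?h n + \<phi> (x \<otimes> n))"
    proof (rule N.mean_ge[OF continuous_map_add[OF ch \<phi>x]])
      fix n assume "n \<in> carrier (G\<lparr>carrier := N\<rparr>)"
      then have "- \<phi> (x \<otimes> n) \<le> c * ?h n" using abs_le_D2[OF le[of n]] by simp
      then show "0 \<le> c * ?h n + \<phi> (x \<otimes> n)" by linarith
    qed
    also have "\<dots> = c * N.mean ?h + N.mean (\<lambda>n. \<phi> (x \<otimes> n))"
      unfolding N.mean_add[OF ch \<phi>x] N.mean_scale[OF h(1)] ..
    finally have "\<bar>N.mean (\<lambda>n. \<phi> (x \<otimes> n))\<bar> \<le> c * N.mean ?h" using up by (simp add: abs_le_iff)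
    moreover have "(\<Sum>g\<leftarrow>gs. coset_mean f ((N #> g) \<otimes>\<^bsub>Q\<^esub> (N #> x))) = N.mean ?h"
      unfolding h(2) using 1(2) x(1)
      by (intro arg_cong[of _ _ sum_list] map_cong refl) (auto simp: mult_Q coset_mean_eq[OF f'] subset_iff)
    ultimately show ?thesis by (simp add: x(2) coset_mean_eq[OF \<phi> x(1)] o_def)
  qed
  moreover have "set ?hs \<subseteq> carrier Q" using 1(2) by (auto simp: coset_in_Q)
  moreover have "ruc Q TQ (coset_mean \<phi>)" using D by (auto simp: dominated_def intro: ruc_coset_mean)
  ultimately show ?thesis using 1(1) unfolding dominated_def by blast
qed

text \<open>\<open>coset_mean\<close> is linear and positive and intertwines left translations, so
  \<open>J\<close> composed with it inherits the laws. Strict positivity of the mean keeps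
  \<open>coset_mean f\<close> non-zero, as the choice of \<open>J\<close> requires.\<close>

lemma invariant_functionals_extension:
  assumes inv: "invariant_functionals Q TQ"
  shows "invariant_functionals G T"
  unfolding invariant_functionals_def
proof (intro allI impI, elim conjE)
  fix f assume f: "ruc G T f" and "\<forall>x\<in>carrier G. 0 \<le> f x" and "\<exists>x\<in>carrier G. f x \<noteq> 0"
  then obtain x0 where x0: "x0 \<in> carrier G" "f x0 > 0" and nonneg: "\<And>x. x \<in> carrier G \<Longrightarrow> 0 \<le> f x"
    by force
  have f': "continuous_map T euclideanreal f" by (rule ruc_continuous[OF f])
  have "N.mean (\<lambda>n. f (x0 \<otimes> n)) > 0"
    using x0 nonneg subset by (intro N.mean_pos[of _ \<one>] cont_coset f') auto
  then have "coset_mean f (N #> x0) \<noteq> 0" by (simp add: coset_mean_eq[OF f' x0(1)])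
  then have "\<exists>X\<in>carrier Q. coset_mean f X \<noteq> 0" using coset_in_Q[OF x0(1)] by blast
  moreover have "\<forall>X\<in>carrier Q. 0 \<le> coset_mean f X" using coset_mean_nonneg[OF f' nonneg] by blast
  ultimately obtain J where J: "positive_functional Q TQ (coset_mean f) J"
    "left_invariant Q TQ (coset_mean f) J" "J (coset_mean f) = 1"
    using inv ruc_coset_mean[OF f] unfolding invariant_functionals_def by blast
  have "positive_functional G T f (\<lambda>\<phi>. J (coset_mean \<phi>))"
    unfolding positive_functional_def
  proof (intro conjI ballI allI impI)
    fix \<phi> assume D: "\<phi> \<in> dominated G T f"
    have \<phi>: "continuous_map T euclideanreal \<phi>" by (rule dominated_continuous[OF D])
    note D' = coset_mean_dominated[OF f D]
    show "J (coset_mean (\<lambda>x. \<phi> x + \<psi> x)) = J (coset_mean \<phi>) + J (coset_mean \<psi>)"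
      if "\<psi> \<in> dominated G T f" for \<psi>
      unfolding coset_mean_add[OF \<phi> dominated_continuous[OF that]]
      by (rule positive_functional_add[OF J(1) D' coset_mean_dominated[OF f that]])
    show "J (coset_mean (\<lambda>x. c * \<phi> x)) = c * J (coset_mean \<phi>)" for c
      unfolding coset_mean_scale[OF \<phi>] by (rule positive_functional_scale[OF J(1) D'])
    show "0 \<le> J (coset_mean \<phi>)" if "\<forall>x\<in>carrier G. 0 \<le> \<phi> x"
      using that by (intro positive_functional_nonneg[OF J(1) D'] coset_mean_nonneg[OF \<phi>]) auto
  qed
  moreover have "left_invariant G T f (\<lambda>\<phi>. J (coset_mean \<phi>))"
    unfolding left_invariant_def
  proof (intro ballI)
    fix \<phi> g assume D: "\<phi> \<in> dominated G T f" and g: "g \<in> carrier G"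
    have "left_translate G g \<phi> \<in> dominated G T f"
      by (rule dominated_left_translate[OF is_group topspace g continuous_conjugation[OF g] D])
    from coset_mean_left_translate[OF dominated_continuous[OF D] g dominated_continuous[OF this]]
    show "J (coset_mean (left_translate G g \<phi>)) = J (coset_mean \<phi>)"
      using left_invariantD[OF J(2) coset_mean_dominated[OF f D] coset_in_Q[OF g]] by simp
  qed
  ultimately show "\<exists>J. positive_functional G T f J \<and> left_invariant G T f J \<and> J f = 1"
    using J(3) by blast
qed

end

lemma fixed_point_property_extension:
  fixes G :: "('g, 'b) monoid_scheme" and T :: "'g topology"
  assumes "topological_group G T" "N \<lhd> G" "compactin T N"
    and fpp: "fixed_point_property_for_cones TYPE(('g set \<Rightarrow> real) \<Rightarrow> real) (G Mod N) (coset_topology G T N)"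
  shows "fixed_point_property_for_cones TYPE('e::real_vector) G T"
proof -
  have "group G" using assms(1) by (simp add: topological_group_def)
  interpret compact_normal_subgroup G T N
    by (intro compact_normal_subgroup.intro topological_group_on.intro topological_group_on_axioms.intro
        compact_normal_subgroup_axioms.intro assms \<open>group G\<close>)
  have "invariant_functionals Q TQ"
    by (rule fixed_point_property_imp_invariant_functionals[OF group_Q topspace_TQ continuous_conjugation_Q fpp])
  then show ?thesis
    by (intro invariant_functionals_imp_fixed_point_property[OF \<open>group G\<close> topspace] invariant_functionals_extension)
qed

subsection \<open>Haar integrals with summable weights\<close>

locale haar_group = topological_group_on +
  fixes m
  assumes haar: "left_haar_measure G T m" and hausdorff: "Hausdorff_space T"
begin

lemma space_m: "space m = carrier G"
  using haar by (simp add: left_haar_measure_def topspace)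

lemma sets_m: "sets m = sigma_sets (carrier G) {U. openin T U}"
  using haar by (simp add: left_haar_measure_def topspace)

lemma open_in_sets: "openin T U \<Longrightarrow> U \<in> sets m"
  by (simp add: sets_m sigma_sets.Basic)

lemma compact_in_sets:
  assumes "compactin T C"
  shows "C \<in> sets m"
proof -
  have "closedin T C" by (rule compactin_imp_closedin[OF hausdorff assms])
  then have "openin T (carrier G - C)" "C \<subseteq> carrier G" by (simp_all add: closedin_def topspace)
  then have "space m - (carrier G - C) \<in> sets m"
    by (intro sets.compl_sets open_in_sets)
  moreover have "space m - (carrier G - C) = C" using \<open>C \<subseteq> carrier G\<close> by (auto simp: space_m)
  ultimately show ?thesis by simp
qed

lemma compact_finite_measure: "compactin T C \<Longrightarrow> emeasure m C < \<infinity>"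
  using haar by (simp add: left_haar_measure_def)

lemma continuous_measurable:
  fixes f :: "'a \<Rightarrow> real"
  assumes "continuous_map T euclideanreal f"
  shows "f \<in> borel_measurable m"
proof (rule borel_measurableI)
  fix S :: "real set" assume "open S"
  then have "openin T {x \<in> topspace T. f x \<in> S}"
    by (intro openin_continuous_map_preimage[OF assms]) simp
  moreover have "{x \<in> topspace T. f x \<in> S} = f -` S \<inter> space m" by (auto simp: topspace space_m)
  ultimately show "f -` S \<inter> space m \<in> sets m" using open_in_sets by simp
qed

lemma left_mult_measurable:
  assumes "g \<in> carrier G"
  shows "(\<lambda>x. g \<otimes> x) \<in> measurable m m"
proof (rule measurable_sigma_sets[OF sets_m])
  show "{U. openin T U} \<subseteq> Pow (carrier G)" using openin_subset[of T] by (auto simp: topspace)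
  show "(\<lambda>x. g \<otimes> x) \<in> space m \<rightarrow> carrier G" using assms by (simp add: space_m)
  fix U assume "U \<in> {U. openin T U}"
  then have "openin T {x \<in> carrier G. g \<otimes> x \<in> U}" using openin_left_mult_vimage assms by simp
  moreover have "{x \<in> carrier G. g \<otimes> x \<in> U} = (\<lambda>x. g \<otimes> x) -` U \<inter> space m" by (auto simp: space_m)
  ultimately show "(\<lambda>x. g \<otimes> x) -` U \<inter> space m \<in> sets m" using open_in_sets by simp
qed

lemma emeasure_left_translate:
  "g \<in> carrier G \<Longrightarrow> B \<in> sets m \<Longrightarrow> emeasure m (l_coset G g B) = emeasure m B"
  using haar by (simp add: left_haar_measure_def)

text \<open>The preimage of \<open>B\<close> under multiplication by g is its translate by g^-1, so
  invariance on sets becomes invariance under push-forward and hence of integrals.\<close>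

lemma distr_left_mult:
  assumes g: "g \<in> carrier G"
  shows "distr m m (\<lambda>x. g \<otimes> x) = m"
proof (rule measure_eqI)
  fix B assume "B \<in> sets (distr m m (\<lambda>x. g \<otimes> x))"
  then have B: "B \<in> sets m" by simp
  then have BG: "B \<subseteq> carrier G" using sets.sets_into_space[of B m] by (simp add: space_m)
  have "(\<lambda>x. g \<otimes> x) -` B \<inter> space m = l_coset G (inv g) B"
  proof (intro equalityI subsetI)
    fix x assume "x \<in> (\<lambda>x. g \<otimes> x) -` B \<inter> space m"
    then have "x \<in> carrier G" "g \<otimes> x \<in> B" by (auto simp: space_m)
    moreover from this g have "x = inv g \<otimes> (g \<otimes> x)" by (simp add: m_assoc[symmetric])
    ultimately show "x \<in> l_coset G (inv g) B" unfolding l_coset_def by blast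
  next
    fix x assume "x \<in> l_coset G (inv g) B"
    then obtain b where b: "b \<in> B" "x = inv g \<otimes> b" by (auto simp: l_coset_def)
    moreover from this BG g have "g \<otimes> x = b" by (auto simp: m_assoc[symmetric])
    ultimately show "x \<in> (\<lambda>x. g \<otimes> x) -` B \<inter> space m" using BG g by (auto simp: space_m)
  qed
  then show "emeasure (distr m m (\<lambda>x. g \<otimes> x)) B = emeasure m B"
    using emeasure_left_translate[OF inv_closed[OF g] B]
    by (simp add: emeasure_distr[OF left_mult_measurable[OF g] B])
qed simp

lemma integral_left_translate:
  fixes f :: "'a \<Rightarrow> real"
  assumes "g \<in> carrier G" "f \<in> borel_measurable m"
  shows "(\<integral>x. f (g \<otimes> x) \<partial>m) = (\<integral>x. f x \<partial>m)"
  using integral_distr[OF left_mult_measurable[OF assms(1)] assms(2)] by (simp add: distr_left_mult[OF assms(1)])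

text \<open>Finitely many translates of \<open>V\<close> cover the compact set \<open>C\<close>; if
  \<open>V\<close> were null, so would be \<open>C\<close>.\<close>

lemma emeasure_open_pos:
  assumes C: "compactin T C" "emeasure m C \<noteq> 0" and V: "openin T V" "\<one> \<in> V"
  shows "emeasure m V > 0"
proof (rule ccontr)
  assume "\<not> emeasure m V > 0"
  then have V0: "emeasure m V = 0" by simp
  have CG: "C \<subseteq> carrier G" using compactin_subset_topspace[OF C(1)] by (simp add: topspace)
  have VG: "V \<subseteq> carrier G" using openin_subset[OF V(1)] by (simp add: topspace)
  obtain ys where ys: "set ys \<subseteq> C" "\<forall>x\<in>C. \<exists>y\<in>set ys. inv y \<otimes> x \<in> V"
    using compact_finite_translates[OF C(1) V] by blast
  have null: "l_coset G y V \<in> null_sets m" if "y \<in> set ys" for y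
  proof
    have y: "y \<in> carrier G" using that ys(1) CG by auto
    show "emeasure m (l_coset G y V) = 0"
      using emeasure_left_translate[OF y open_in_sets[OF V(1)]] V0 by simp
    have "l_coset G y V = {x \<in> carrier G. inv y \<otimes> x \<in> V}"
    proof (intro equalityI subsetI)
      fix x assume "x \<in> l_coset G y V"
      then obtain v where v: "v \<in> V" "x = y \<otimes> v" by (auto simp: l_coset_def)
      then have "inv y \<otimes> x = v" using y VG by (auto simp: m_assoc[symmetric])
      then show "x \<in> {x \<in> carrier G. inv y \<otimes> x \<in> V}" using v VG y by auto
    next
      fix x assume "x \<in> {x \<in> carrier G. inv y \<otimes> x \<in> V}"
      then have x: "x \<in> carrier G" "inv y \<otimes> x \<in> V" by auto
      then have "x = y \<otimes> (inv y \<otimes> x)" using y by (simp add: m_assoc[symmetric])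
      then show "x \<in> l_coset G y V" using x(2) unfolding l_coset_def by blast
    qed
    then show "l_coset G y V \<in> sets m" using open_in_sets[OF openin_left_mult_vimage[OF V(1) inv_closed[OF y]]] by simp
  qed
  have "(\<Union>y\<in>set ys. l_coset G y V) \<in> null_sets m" using null by (intro null_sets_UN' countable_finite) auto
  moreover have "C \<subseteq> (\<Union>y\<in>set ys. l_coset G y V)"
  proof
    fix x assume x: "x \<in> C"
    then obtain y where y: "y \<in> set ys" "inv y \<otimes> x \<in> V" using ys(2) by blast
    then have "x = y \<otimes> (inv y \<otimes> x)" using x CG ys(1) by (auto simp: m_assoc[symmetric] subset_iff)
    then show "x \<in> (\<Union>y\<in>set ys. l_coset G y V)" using y unfolding l_coset_def by blast
  qed
  ultimately have "C \<in> null_sets m" by (intro null_sets_subset[OF _ compact_in_sets[OF C(1)]])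
  then show False using C(2) by auto
qed

end

text \<open>For \<open>A\<close> containing \<open>g\<close>, left translation by \<open>g\<close> maps \<open>A\<^sup>n\<close> into \<open>A\<^sup>n\<^sup>+\<^sup>1\<close> and thus changes the
  weighted integral below by a factor of at most \<open>1/r\<close>; subexponential growth makes it converge
  for every \<open>r < 1\<close>.\<close>

locale weighted_haar_group = haar_group +
  fixes A and r :: real
  assumes compact_A: "compactin T A" and nbhd_A: "\<exists>U. openin T U \<and> \<one> \<in> U \<and> U \<subseteq> A"
    and growth: "(\<lambda>n. root n (measure m (set_power G A n))) \<longlonglongrightarrow> 1"
    and r: "0 < r" "r < 1"
begin

abbreviation P :: "nat \<Rightarrow> 'a set" where "P n \<equiv> set_power G A n"

text \<open>The weighted integral is taken as a series of integrals over the powers of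
  \<open>A\<close>, which avoids interchanging sum and integral.\<close>

definition piece :: "nat \<Rightarrow> ('a \<Rightarrow> real) \<Rightarrow> real" where
  "piece n \<phi> = r ^ n * (\<integral>x. indicator (P n) x * \<phi> x \<partial>m)"

definition weighted_integral :: "('a \<Rightarrow> real) \<Rightarrow> real" where
  "weighted_integral \<phi> = (\<Sum>n. piece n \<phi>)"

definition bounded_continuous :: "('a \<Rightarrow> real) \<Rightarrow> bool" where
  "bounded_continuous \<phi> \<longleftrightarrow> continuous_map T euclideanreal \<phi> \<and> (\<exists>B. \<forall>x\<in>carrier G. \<bar>\<phi> x\<bar> \<le> B)"

lemma compactin_P: "compactin T (P n)"
  by (rule compactin_set_power[OF compact_A])

lemma P_carrier: "P n \<subseteq> carrier G"
  using compactin_subset_topspace[OF compactin_P] by (simp add: topspace)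

lemma P_in_sets: "P n \<in> sets m"
  by (rule compact_in_sets[OF compactin_P])

lemma A_carrier: "A \<subseteq> carrier G"
  using compactin_subset_topspace[OF compact_A] by (simp add: topspace)

lemma integrable_piece:
  assumes "bounded_continuous \<phi>"
  shows "integrable m (\<lambda>x. indicator (P n) x * \<phi> x)"
proof -
  obtain B where B: "\<And>x. x \<in> carrier G \<Longrightarrow> \<bar>\<phi> x\<bar> \<le> B"
    using assms by (auto simp: bounded_continuous_def)
  have "integrable m (\<lambda>x. indicator (P n) x *\<^sub>R \<phi> x)"
  proof (rule integrableI_bounded_set_indicator[OF P_in_sets])
    show "\<phi> \<in> borel_measurable m" using assms by (simp add: bounded_continuous_def continuous_measurable)
    show "emeasure m (P n) < \<infinity>" by (rule compact_finite_measure[OF compactin_P])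
    show "AE x in m. x \<in> P n \<longrightarrow> norm (\<phi> x) \<le> B" using B P_carrier by (intro AE_I2) auto
  qed
  then show ?thesis by simp
qed

lemma bounded_continuous_const: "bounded_continuous (\<lambda>x. c)"
  by (auto simp: bounded_continuous_def)

lemma bounded_continuous_add:
  assumes "bounded_continuous \<phi>" "bounded_continuous \<psi>"
  shows "bounded_continuous (\<lambda>x. \<phi> x + \<psi> x)"
proof -
  obtain B B' where "\<And>x. x \<in> carrier G \<Longrightarrow> \<bar>\<phi> x\<bar> \<le> B" "\<And>x. x \<in> carrier G \<Longrightarrow> \<bar>\<psi> x\<bar> \<le> B'"
    using assms by (auto simp: bounded_continuous_def)
  then have "\<bar>\<phi> x + \<psi> x\<bar> \<le> B + B'" if "x \<in> carrier G" for x
    by (meson that abs_triangle_ineq add_mono order_trans)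
  then show ?thesis using assms unfolding bounded_continuous_def by (blast intro: continuous_map_add)
qed

lemma bounded_continuous_scale:
  assumes "bounded_continuous \<phi>"
  shows "bounded_continuous (\<lambda>x. c * \<phi> x)"
proof -
  obtain B where "\<And>x. x \<in> carrier G \<Longrightarrow> \<bar>\<phi> x\<bar> \<le> B" using assms by (auto simp: bounded_continuous_def)
  then have "\<bar>c * \<phi> x\<bar> \<le> \<bar>c\<bar> * B" if "x \<in> carrier G" for x
    using that by (simp add: abs_mult mult_left_mono)
  moreover have "continuous_map T euclideanreal (\<lambda>x. c * \<phi> x)"
    using assms by (intro continuous_map_real_mult) (auto simp: bounded_continuous_def)
  ultimately show ?thesis unfolding bounded_continuous_def by blast
qed

lemma piece_add:
  "bounded_continuous \<phi> \<Longrightarrow> bounded_continuous \<psi> \<Longrightarrow> piece n (\<lambda>x. \<phi> x + \<psi> x) = piece n \<phi> + piece n \<psi>"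
  by (simp add: piece_def distrib_left Bochner_Integration.integral_add[OF integrable_piece integrable_piece])

lemma piece_scale: "piece n (\<lambda>x. c * \<phi> x) = c * piece n \<phi>"
  by (simp add: piece_def mult.left_commute[of _ c])

lemma piece_mono:
  assumes "bounded_continuous \<phi>" "bounded_continuous \<psi>" "\<And>x. x \<in> carrier G \<Longrightarrow> \<phi> x \<le> \<psi> x"
  shows "piece n \<phi> \<le> piece n \<psi>"
  unfolding piece_def using r assms
  by (intro mult_left_mono integral_mono integrable_piece) (auto simp: space_m)

lemma piece_const: "piece n (\<lambda>x. c) = c * (r ^ n * measure m (P n))"
proof -
  have "(\<integral>x. indicator (P n) x * c \<partial>m) = measure m (P n) * c"
    using P_in_sets sets.sets_into_space[OF P_in_sets[of n]] by (simp add: Int_absorb2)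
  then show ?thesis by (simp add: piece_def)
qed

text \<open>Root test: by the growth condition the n-th roots tend to r, which is less than
  1.\<close>

lemma summable_weights: "summable (\<lambda>n. r ^ n * measure m (P n))"
proof (rule root_test_convergence)
  have lim: "(\<lambda>n. r * root n (measure m (P n))) \<longlonglongrightarrow> r * 1" by (intro tendsto_mult growth tendsto_const)
  have "\<forall>\<^sub>F n in sequentially. r * root n (measure m (P n)) = root n (norm (r ^ n * measure m (P n)))"
    using eventually_gt_at_top[of 0]
  proof eventually_elim
    case (elim n)
    then show ?case using r by (simp add: real_root_mult real_root_power_cancel)
  qed
  from Lim_transform_eventually[OF lim this]
  show "(\<lambda>n. root n (norm (r ^ n * measure m (P n)))) \<longlonglongrightarrow> r" by simp
qed (rule r)

lemma summable_piece:
  assumes \<phi>: "bounded_continuous \<phi>"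
  shows "summable (\<lambda>n. piece n \<phi>)"
proof -
  obtain B where B: "\<And>x. x \<in> carrier G \<Longrightarrow> \<bar>\<phi> x\<bar> \<le> B"
    using \<phi> by (auto simp: bounded_continuous_def)
  have "norm (piece n \<phi>) \<le> B * (r ^ n * measure m (P n))" for n
  proof -
    have "- B \<le> \<phi> x" "\<phi> x \<le> B" if "x \<in> carrier G" for x using B[OF that] by (auto simp: abs_le_iff)
    then have "piece n (\<lambda>x. - B) \<le> piece n \<phi>" "piece n \<phi> \<le> piece n (\<lambda>x. B)"
      by (auto intro: piece_mono \<phi> bounded_continuous_const)
    then show ?thesis by (simp add: piece_const abs_le_iff)
  qed
  then show ?thesis
    by (intro summable_comparison_test'[OF summable_mult[OF summable_weights, of B], of 0])
qed

lemma weighted_integral_add: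
  assumes "bounded_continuous \<phi>" "bounded_continuous \<psi>"
  shows "weighted_integral (\<lambda>x. \<phi> x + \<psi> x) = weighted_integral \<phi> + weighted_integral \<psi>"
  unfolding weighted_integral_def suminf_add[OF summable_piece[OF assms(1)] summable_piece[OF assms(2)]]
  using assms by (simp add: piece_add)

lemma weighted_integral_scale:
  "bounded_continuous \<phi> \<Longrightarrow> weighted_integral (\<lambda>x. c * \<phi> x) = c * weighted_integral \<phi>"
  unfolding weighted_integral_def by (simp add: piece_scale suminf_mult summable_piece)

lemma weighted_integral_mono:
  assumes "bounded_continuous \<phi>" "bounded_continuous \<psi>" "\<And>x. x \<in> carrier G \<Longrightarrow> \<phi> x \<le> \<psi> x"
  shows "weighted_integral \<phi> \<le> weighted_integral \<psi>"
  unfolding weighted_integral_def by (intro suminf_le piece_mono summable_piece assms)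

lemma weighted_integral_const: "weighted_integral (\<lambda>x. c) = c * weighted_integral (\<lambda>x. 1)"
  using weighted_integral_scale[OF bounded_continuous_const[of 1], of c] by simp

lemma weighted_integral_nonneg:
  assumes "bounded_continuous \<phi>" "\<And>x. x \<in> carrier G \<Longrightarrow> 0 \<le> \<phi> x"
  shows "0 \<le> weighted_integral \<phi>"
  using weighted_integral_mono[OF bounded_continuous_const[of 0] assms] weighted_integral_const[of 0] by simp

lemma weighted_integral_cong:
  assumes \<phi>: "bounded_continuous \<phi>" and eq: "\<And>x. x \<in> carrier G \<Longrightarrow> \<phi> x = \<psi> x"
  shows "weighted_integral \<phi> = weighted_integral \<psi>"
proof -
  have "continuous_map T euclideanreal \<psi>"
  proof (rule continuous_map_eq)
    show "continuous_map T euclideanreal \<phi>" using \<phi> by (simp add: bounded_continuous_def)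
  qed (simp add: topspace eq)
  then have \<psi>: "bounded_continuous \<psi>" using \<phi> eq unfolding bounded_continuous_def by metis
  show ?thesis
    by (rule antisym; rule weighted_integral_mono[OF _ _ eq_refl]) (simp_all add: \<phi> \<psi> eq)
qed

lemma weighted_integral_diff_le:
  assumes \<phi>: "bounded_continuous \<phi>" and \<psi>: "bounded_continuous \<psi>"
    and le: "\<And>x. x \<in> carrier G \<Longrightarrow> \<bar>\<phi> x - \<psi> x\<bar> \<le> e"
  shows "\<bar>weighted_integral \<phi> - weighted_integral \<psi>\<bar> \<le> e * weighted_integral (\<lambda>x. 1)"
proof -
  note e = bounded_continuous_const[of e]
  have "\<phi> x \<le> \<psi> x + e" "\<psi> x \<le> \<phi> x + e" if "x \<in> carrier G" for x
    using le[OF that] by (auto simp: abs_le_iff)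
  then have "weighted_integral \<phi> \<le> weighted_integral (\<lambda>x. \<psi> x + e)"
    "weighted_integral \<psi> \<le> weighted_integral (\<lambda>x. \<phi> x + e)"
    by (auto intro!: weighted_integral_mono \<phi> \<psi> bounded_continuous_add e)
  then show ?thesis
    unfolding weighted_integral_add[OF \<phi> e] weighted_integral_add[OF \<psi> e] weighted_integral_const[of e]
    by (simp add: abs_le_iff)
qed

lemma bounded_continuous_sum_list:
  assumes "\<And>i. i \<in> set is \<Longrightarrow> bounded_continuous (\<phi> i)"
  shows "bounded_continuous (\<lambda>x. \<Sum>i\<leftarrow>is. \<phi> i x) \<and>
    weighted_integral (\<lambda>x. \<Sum>i\<leftarrow>is. \<phi> i x) = (\<Sum>i\<leftarrow>is. weighted_integral (\<phi> i))"
  using assms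
proof (induction "is")
  case Nil
  then show ?case using bounded_continuous_const[of 0] weighted_integral_const[of 0] by simp
next
  case (Cons i "is")
  then have "bounded_continuous (\<phi> i)" "bounded_continuous (\<lambda>x. \<Sum>i\<leftarrow>is. \<phi> i x)"
    "weighted_integral (\<lambda>x. \<Sum>i\<leftarrow>is. \<phi> i x) = (\<Sum>i\<leftarrow>is. weighted_integral (\<phi> i))" by auto
  then show ?case
    using weighted_integral_add[of "\<phi> i" "\<lambda>x. \<Sum>i\<leftarrow>is. \<phi> i x"]
      bounded_continuous_add[of "\<phi> i" "\<lambda>x. \<Sum>i\<leftarrow>is. \<phi> i x"] by simp
qed

lemma bounded_continuous_left_translate:
  assumes "bounded_continuous \<phi>" "g \<in> carrier G"
  shows "bounded_continuous (\<lambda>x. \<phi> (g \<otimes> x))"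
  using assms continuous_map_compose[OF continuous_left_mult[OF assms(2)], of euclideanreal \<phi>]
  by (auto simp: bounded_continuous_def o_def)

text \<open>Invariance of the measure and g A^n \<subseteq> A^(n+1) bound r times the n-th term for
  the translate by the (n+1)-st term for \<phi>. Summing shifts the index and drops only the
  non-negative term of index 0.\<close>

lemma weighted_integral_left_translate:
  assumes \<phi>: "bounded_continuous \<phi>" and nonneg: "\<And>x. x \<in> carrier G \<Longrightarrow> 0 \<le> \<phi> x" and g: "g \<in> A"
  shows "r * weighted_integral (\<lambda>x. \<phi> (g \<otimes> x)) \<le> weighted_integral \<phi>"
proof -
  have gG: "g \<in> carrier G" using g A_carrier by auto
  note g\<phi> = bounded_continuous_left_translate[OF \<phi> gG]
  have step: "r * piece n (\<lambda>x. \<phi> (g \<otimes> x)) \<le> piece (Suc n) \<phi>" for n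
  proof -
    let ?h = "\<lambda>y. indicator (P n) (inv g \<otimes> y) * \<phi> y"
    have meas: "?h \<in> borel_measurable m"
    proof -
      have "(\<lambda>y. indicator (P n) (inv g \<otimes> y) :: real) \<in> borel_measurable m"
        using measurable_compose[OF left_mult_measurable[OF inv_closed[OF gG]]
          borel_measurable_indicator[OF P_in_sets[of n]]] .
      moreover have "\<phi> \<in> borel_measurable m" using \<phi> by (simp add: bounded_continuous_def continuous_measurable)
      ultimately show ?thesis by (rule borel_measurable_times)
    qed
    have "(\<integral>x. indicator (P n) x * \<phi> (g \<otimes> x) \<partial>m) = (\<integral>x. ?h (g \<otimes> x) \<partial>m)"
      using gG by (intro Bochner_Integration.integral_cong refl) (simp add: space_m m_assoc[symmetric])
    also have "\<dots> = (\<integral>y. ?h y \<partial>m)" by (rule integral_left_translate[OF gG meas])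
    also have "\<dots> \<le> (\<integral>y. indicator (P (Suc n)) y * \<phi> y \<partial>m)"
    proof (rule integral_mono'[OF integrable_piece[OF \<phi>]])
      fix y assume "y \<in> space m"
      then have y: "y \<in> carrier G" by (simp add: space_m)
      then show "0 \<le> indicator (P (Suc n)) y * \<phi> y" using nonneg by (simp add: indicator_def)
      show "?h y \<le> indicator (P (Suc n)) y * \<phi> y"
      proof (cases "inv g \<otimes> y \<in> P n")
        case True
        have "g \<otimes> (inv g \<otimes> y) = y" using gG y by (simp add: m_assoc[symmetric])
        with left_mult_set_power[OF A_carrier g True] have "y \<in> P (Suc n)" by simp
        then show ?thesis using nonneg[OF y] by (simp add: indicator_def del: set_power.simps)
      next
        case False
        then show ?thesis using nonneg[OF y] by (simp add: indicator_def del: set_power.simps)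
      qed
    qed
    finally have "r ^ Suc n * (\<integral>x. indicator (P n) x * \<phi> (g \<otimes> x) \<partial>m) \<le>
        r ^ Suc n * (\<integral>y. indicator (P (Suc n)) y * \<phi> y \<partial>m)"
      using r by (intro mult_left_mono) auto
    then show ?thesis by (simp add: piece_def mult.assoc del: set_power.simps)
  qed
  have "r * weighted_integral (\<lambda>x. \<phi> (g \<otimes> x)) = (\<Sum>n. r * piece n (\<lambda>x. \<phi> (g \<otimes> x)))"
    unfolding weighted_integral_def by (rule suminf_mult[OF summable_piece[OF g\<phi>], symmetric])
  also have "\<dots> \<le> (\<Sum>n. piece (Suc n) \<phi>)"
    using summable_Suc_iff[of "\<lambda>n. piece n \<phi>"] summable_piece[OF \<phi>]
    by (intro suminf_le step summable_mult summable_piece g\<phi>) blast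
  also have "\<dots> = weighted_integral \<phi> - piece 0 \<phi>"
    unfolding weighted_integral_def by (rule suminf_split_head[OF summable_piece[OF \<phi>]])
  also have "piece 0 \<phi> \<ge> 0"
    using piece_mono[OF bounded_continuous_const[of 0] \<phi> nonneg] by (simp add: piece_const)
  then have "weighted_integral \<phi> - piece 0 \<phi> \<le> weighted_integral \<phi>" by simp
  finally show ?thesis .
qed

text \<open>\<open>A\<close> need not contain a neighbourhood of g, but it contains one of \<one>.
  So \<phi> is first translated by g, which makes it positive near \<one>, and the quasi-invariance
  inequality then leads back to \<phi>.\<close>

lemma weighted_integral_pos:
  assumes \<phi>: "bounded_continuous \<phi>" and nonneg: "\<And>x. x \<in> carrier G \<Longrightarrow> 0 \<le> \<phi> x"
    and g: "g \<in> A" "\<phi> g > 0"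
  shows "weighted_integral \<phi> > 0"
proof -
  have gG: "g \<in> carrier G" using g A_carrier by auto
  define \<delta> where "\<delta> = \<phi> g / 2"
  have \<delta>: "\<delta> > 0" "\<delta> < \<phi> g" using g(2) by (auto simp: \<delta>_def)
  have "openin T {x \<in> topspace T. \<phi> x \<in> {\<delta><..}}"
    using \<phi> by (intro openin_continuous_map_preimage[of T euclideanreal]) (auto simp: bounded_continuous_def)
  then have W: "openin T {x \<in> carrier G. \<phi> x > \<delta>}" by (simp add: topspace)
  obtain U where U: "openin T U" "\<one> \<in> U" "U \<subseteq> A" using nbhd_A by blast
  define V where "V = U \<inter> {v \<in> carrier G. g \<otimes> v \<in> {x \<in> carrier G. \<phi> x > \<delta>}}"
  have V: "openin T V" "\<one> \<in> V"
  proof -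
    show "openin T V" unfolding V_def by (rule openin_Int[OF U(1) openin_left_mult_vimage[OF W gG]])
    show "\<one> \<in> V" using U gG \<delta> by (simp add: V_def)
  qed
  \<comment> \<open>If all powers had measure 0, the roots would be 0 and could not tend to
    1.\<close>
  have "\<exists>n. measure m (P n) \<noteq> 0"
  proof (rule ccontr)
    assume "\<not> ?thesis"
    then have "(\<lambda>n. 0 :: real) \<longlonglongrightarrow> 1" using growth by simp
    then show False by (simp add: LIMSEQ_const_iff)
  qed
  then obtain n where "measure m (P n) \<noteq> 0" by blast
  then have "emeasure m (P n) \<noteq> 0" by (auto simp: measure_def)
  then have mV: "emeasure m V > 0" by (rule emeasure_open_pos[OF compactin_P _ V])
  have VA: "V \<subseteq> A" using U(3) by (auto simp: V_def)
  have Vm: "V \<in> sets m" by (rule open_in_sets[OF V(1)])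
  have "emeasure m V \<le> emeasure m A"
    by (rule emeasure_mono[OF VA compact_in_sets[OF compact_A]])
  then have "emeasure m V < \<infinity>" using compact_finite_measure[OF compact_A] by (rule le_less_trans)
  then have mV': "measure m V > 0" using mV by (simp add: measure_def enn2real_positive_iff)
  let ?\<psi> = "\<lambda>x. \<phi> (g \<otimes> x)"
  note g\<phi> = bounded_continuous_left_translate[OF \<phi> gG]
  have "0 < r * (\<delta> * measure m V)" using r \<delta> mV' by simp
  also have "\<dots> \<le> piece 1 ?\<psi>"
  proof -
    have P1: "P 1 = A" using A_carrier by (force simp: set_mult_def)
    have "(\<integral>x. \<delta> * indicator V x \<partial>m) \<le> (\<integral>x. indicator (P 1) x * ?\<psi> x \<partial>m)"
    proof (rule integral_mono'[OF integrable_piece[OF g\<phi>]])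
      fix x assume "x \<in> space m"
      then have x: "x \<in> carrier G" by (simp add: space_m)
      then have "0 \<le> ?\<psi> x" using nonneg gG by simp
      then show "0 \<le> indicator (P 1) x * ?\<psi> x" by (simp add: indicator_def)
      show "\<delta> * indicator V x \<le> indicator (P 1) x * ?\<psi> x"
        unfolding P1 using \<open>0 \<le> ?\<psi> x\<close> VA by (auto simp: indicator_def V_def)
    qed
    moreover have "V \<inter> space m = V" using sets.sets_into_space[OF Vm] by blast
    ultimately show ?thesis using r by (simp add: piece_def del: set_power.simps)
  qed
  also have "\<dots> \<le> weighted_integral ?\<psi>"
  proof -
    have "0 \<le> piece n ?\<psi>" for n
      using piece_mono[OF bounded_continuous_const[of 0] g\<phi>] nonneg gG by (simp add: piece_const)
    then have "(\<Sum>n\<in>{1}. piece n ?\<psi>) \<le> (\<Sum>n. piece n ?\<psi>)"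
      by (intro sum_le_suminf summable_piece g\<phi>) auto
    then show ?thesis by (simp add: weighted_integral_def)
  qed
  finally have "0 < r * weighted_integral ?\<psi>" using r by simp
  also have "\<dots> \<le> weighted_integral \<phi>" by (rule weighted_integral_left_translate[OF \<phi> nonneg g(1)])
  finally show ?thesis .
qed

end

subsection \<open>Direct products\<close>

lemma topological_group_DirProd:
  assumes H: "topological_group H TH" and S: "topological_group S TS"
  shows "topological_group (H \<times>\<times> S) (prod_topology TH TS)"
proof -
  have gH: "group H" and gS: "group S" using assms by (auto simp: topological_group_def)
  interpret H: topological_group_on H TH
    by (intro topological_group_on.intro topological_group_on_axioms.intro H gH)
  interpret S: topological_group_on S TS
    by (intro topological_group_on.intro topological_group_on_axioms.intro S gS)
  let ?P = "prod_topology TH TS"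
  have fst: "continuous_map ?P TH fst" and snd: "continuous_map ?P TS snd"
    by (rule continuous_map_fst, rule continuous_map_snd)
  have c1: "continuous_map (prod_topology ?P ?P) ?P fst" and c2: "continuous_map (prod_topology ?P ?P) ?P snd"
    by (rule continuous_map_fst, rule continuous_map_snd)
  have c: "continuous_map (prod_topology ?P ?P) TH (\<lambda>p. fst (fst p))"
    "continuous_map (prod_topology ?P ?P) TH (\<lambda>p. fst (snd p))"
    "continuous_map (prod_topology ?P ?P) TS (\<lambda>p. snd (fst p))"
    "continuous_map (prod_topology ?P ?P) TS (\<lambda>p. snd (snd p))"
    using continuous_map_compose[OF c1 fst] continuous_map_compose[OF c2 fst]
      continuous_map_compose[OF c1 snd] continuous_map_compose[OF c2 snd] by (simp_all add: o_def)
  have "continuous_map (prod_topology ?P ?P) ?P (\<lambda>(x, y). x \<otimes>\<^bsub>H \<times>\<times> S\<^esub> y)"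
    using continuous_map_pairedI[OF H.continuous_mult[OF c(1,2)] S.continuous_mult[OF c(3,4)]]
    by (simp add: case_prod_unfold mult_DirProd')
  moreover have "continuous_map ?P ?P (\<lambda>x. inv\<^bsub>H \<times>\<times> S\<^esub> x)"
  proof (rule continuous_map_eq[OF continuous_map_pairedI[OF H.continuous_inv[OF fst] S.continuous_inv[OF snd]]])
    fix x assume "x \<in> topspace ?P"
    then show "(inv\<^bsub>H\<^esub> (fst x), inv\<^bsub>S\<^esub> (snd x)) = inv\<^bsub>H \<times>\<times> S\<^esub> x"
      by (cases x) (simp add: H.topspace S.topspace inv_DirProd[OF gH gS])
  qed
  ultimately show ?thesis
    using DirProd_group[OF gH gS] by (simp add: topological_group_def H.topspace S.topspace)
qed

section \<open>Integration over the second factor of a product group\<close>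

locale slices = H: topological_group_on H TH + S: weighted_haar_group S TS m A r
  for H :: "('h, 'b) monoid_scheme" and TH :: "'h topology"
    and S :: "('s, 'c) monoid_scheme" and TS :: "'s topology" and m A r
begin

abbreviation G where "G \<equiv> H \<times>\<times> S"

abbreviation T where "T \<equiv> prod_topology TH TS"

sublocale G: topological_group_on G T
  by (intro topological_group_on.intro topological_group_on_axioms.intro topological_group_DirProd
      DirProd_group H.topological_group S.topological_group H.is_group S.is_group)

text \<open>The default 0 off the carrier turns the linearity rules into equalities of
  functions.\<close>

definition slice_integral :: "('h \<times> 's \<Rightarrow> real) \<Rightarrow> 'h \<Rightarrow> real" where
  "slice_integral \<phi> h = (if h \<in> carrier H then S.weighted_integral (\<lambda>s. \<phi> (h, s)) else 0)"

lemma slice_bounded_continuous: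
  assumes "ruc G T \<phi>" "h \<in> carrier H"
  shows "S.bounded_continuous (\<lambda>s. \<phi> (h, s))"
proof -
  have "continuous_map TS T (\<lambda>s. (h, s))"
    using assms(2) by (intro continuous_map_pairedI) (auto simp: H.topspace)
  from continuous_map_compose[OF this G.ruc_continuous[OF assms(1)]]
  have "continuous_map TS euclideanreal (\<lambda>s. \<phi> (h, s))" by (simp add: o_def)
  moreover obtain B where "\<forall>x\<in>carrier G. \<bar>\<phi> x\<bar> \<le> B" using ruc_bounded[OF assms(1)] by blast
  then have "\<forall>s\<in>carrier S. \<bar>\<phi> (h, s)\<bar> \<le> B" using assms(2) by simp
  ultimately show ?thesis by (auto simp: S.bounded_continuous_def)
qed

lemma slice_integral_add:
  "ruc G T \<phi> \<Longrightarrow> ruc G T \<psi> \<Longrightarrow>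
    slice_integral (\<lambda>x. \<phi> x + \<psi> x) = (\<lambda>h. slice_integral \<phi> h + slice_integral \<psi> h)"
  by (auto simp: slice_integral_def S.weighted_integral_add slice_bounded_continuous)

lemma slice_integral_scale:
  "ruc G T \<phi> \<Longrightarrow> slice_integral (\<lambda>x. c * \<phi> x) = (\<lambda>h. c * slice_integral \<phi> h)"
  by (auto simp: slice_integral_def S.weighted_integral_scale slice_bounded_continuous)

lemma slice_integral_nonneg:
  "ruc G T \<phi> \<Longrightarrow> (\<And>x. x \<in> carrier G \<Longrightarrow> 0 \<le> \<phi> x) \<Longrightarrow> h \<in> carrier H \<Longrightarrow> 0 \<le> slice_integral \<phi> h"
  by (simp add: slice_integral_def S.weighted_integral_nonneg slice_bounded_continuous)

lemma slice_integral_left_translate: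
  assumes \<phi>: "ruc G T \<phi>" and nonneg: "\<And>x. x \<in> carrier G \<Longrightarrow> 0 \<le> \<phi> x"
    and a: "a \<in> carrier H" and b: "b \<in> A" and h: "h \<in> carrier H"
  shows "r * S.weighted_integral (\<lambda>s. \<phi> (a \<otimes>\<^bsub>H\<^esub> h, b \<otimes>\<^bsub>S\<^esub> s)) \<le> slice_integral \<phi> (a \<otimes>\<^bsub>H\<^esub> h)"
  using S.weighted_integral_left_translate[OF slice_bounded_continuous[OF \<phi>], of "a \<otimes>\<^bsub>H\<^esub> h" b] nonneg a b h
  by (simp add: slice_integral_def)

lemma ruc_slice_integral:
  assumes \<phi>: "ruc G T \<phi>"
  shows "ruc H TH (slice_integral \<phi>)"
  unfolding ruc_def
proof (intro conjI allI impI)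
  let ?W = "S.weighted_integral (\<lambda>s. 1)"
  have W: "0 \<le> ?W" by (rule S.weighted_integral_nonneg[OF S.bounded_continuous_const]) simp
  obtain B where B: "\<And>x. x \<in> carrier G \<Longrightarrow> \<bar>\<phi> x\<bar> \<le> B" using ruc_bounded[OF \<phi>] by blast
  have "\<bar>slice_integral \<phi> h\<bar> \<le> B * ?W" if h: "h \<in> carrier H" for h
    using S.weighted_integral_diff_le[OF slice_bounded_continuous[OF \<phi> h] S.bounded_continuous_const[of 0], of B]
      B h S.weighted_integral_const[of 0] by (simp add: slice_integral_def)
  then show "\<exists>B. \<forall>h\<in>carrier H. \<bar>slice_integral \<phi> h\<bar> \<le> B" by blast
  fix e :: real assume "e > 0"
  \<comment> \<open>The 1 in the denominator avoids division by a zero total weight and makes the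
    resulting bound strict.\<close>
  define d where "d = e / (?W + 1)"
  have d: "d > 0" "d * ?W < e" using \<open>e > 0\<close> W by (auto simp: d_def field_simps add_nonneg_pos)
  obtain V where V: "openin T V" "\<one>\<^bsub>G\<^esub> \<in> V"
    "\<And>a x. a \<in> V \<Longrightarrow> x \<in> carrier G \<Longrightarrow> \<bar>\<phi> (a \<otimes>\<^bsub>G\<^esub> x) - \<phi> x\<bar> < d"
    using rucD[OF \<phi> d(1)] by blast
  \<comment> \<open>Only the first coordinate is moved, so the section of \<open>V\<close> at the
    unit of \<open>S\<close> is enough.\<close>
  define V' where "V' = {a \<in> topspace TH. (a, \<one>\<^bsub>S\<^esub>) \<in> V}"
  have "continuous_map TH T (\<lambda>a. (a, \<one>\<^bsub>S\<^esub>))"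
    by (intro continuous_map_pairedI) (auto simp: S.topspace)
  then have "openin TH V'" unfolding V'_def by (rule openin_continuous_map_preimage[OF _ V(1)])
  moreover have "\<one>\<^bsub>H\<^esub> \<in> V'" using V(2) by (simp add: V'_def H.topspace)
  moreover have "\<bar>slice_integral \<phi> (a \<otimes>\<^bsub>H\<^esub> h) - slice_integral \<phi> h\<bar> < e"
    if a: "a \<in> V'" and h: "h \<in> carrier H" for a h
  proof -
    have aH: "a \<in> carrier H" and aV: "(a, \<one>\<^bsub>S\<^esub>) \<in> V" using a by (auto simp: V'_def H.topspace)
    have ah: "a \<otimes>\<^bsub>H\<^esub> h \<in> carrier H" using aH h by simp
    have "\<bar>\<phi> (a \<otimes>\<^bsub>H\<^esub> h, s) - \<phi> (h, s)\<bar> \<le> d" if "s \<in> carrier S" for s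
      using V(3)[OF aV, of "(h, s)"] h that by simp
    from S.weighted_integral_diff_le[OF slice_bounded_continuous[OF \<phi> ah] slice_bounded_continuous[OF \<phi> h] this]
    show ?thesis using d(2) ah h by (simp add: slice_integral_def)
  qed
  ultimately show "\<exists>V. openin TH V \<and> \<one>\<^bsub>H\<^esub> \<in> V \<and>
      (\<forall>a\<in>V. \<forall>h\<in>carrier H. \<bar>slice_integral \<phi> (a \<otimes>\<^bsub>H\<^esub> h) - slice_integral \<phi> h\<bar> < e)" by blast
qed

text \<open>Explicit data for domination by translates of \<open>f\<close>, with second components
  in \<open>A\<close>: for these the weighted integral is quasi-invariant.\<close>

definition witness :: "('h \<times> 's \<Rightarrow> real) \<Rightarrow> ('h \<times> 's \<Rightarrow> real) \<Rightarrow> real \<Rightarrow> ('h \<times> 's) list \<Rightarrow> bool" where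
  "witness f \<phi> c gs \<longleftrightarrow> ruc G T \<phi> \<and> 0 \<le> c \<and> set gs \<subseteq> carrier H \<times> A \<and>
     (\<forall>x\<in>carrier G. \<bar>\<phi> x\<bar> \<le> c * (\<Sum>g\<leftarrow>gs. f (g \<otimes>\<^bsub>G\<^esub> x)))"

text \<open>Integrating over \<open>S\<close> turns a translate of \<open>f\<close> by (a, b) with b
  in \<open>A\<close> into a translate by a, at the cost of a factor 1/r. Domination on the product
  thus becomes domination on \<open>H\<close>.\<close>

lemma slice_integral_bound:
  assumes f: "ruc G T f" "\<And>x. x \<in> carrier G \<Longrightarrow> 0 \<le> f x" and w: "witness f \<phi> c gs" and h: "h \<in> carrier H"
  shows "\<bar>slice_integral \<phi> h\<bar> \<le> c / r * (\<Sum>a\<leftarrow>map fst gs. slice_integral f (a \<otimes>\<^bsub>H\<^esub> h))"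
proof -
  have \<phi>: "ruc G T \<phi>" and c: "0 \<le> c" and gs: "set gs \<subseteq> carrier H \<times> A"
    and le: "\<And>x. x \<in> carrier G \<Longrightarrow> \<bar>\<phi> x\<bar> \<le> c * (\<Sum>g\<leftarrow>gs. f (g \<otimes>\<^bsub>G\<^esub> x))"
    using w by (auto simp: witness_def)
  let ?F = "\<lambda>g s. f (fst g \<otimes>\<^bsub>H\<^esub> h, snd g \<otimes>\<^bsub>S\<^esub> s)"
  have gsD: "fst g \<in> carrier H" "snd g \<in> A" "snd g \<in> carrier S" if "g \<in> set gs" for g
  proof -
    have "g \<in> carrier H \<times> A" using that gs by blast
    then show "fst g \<in> carrier H" "snd g \<in> A" "snd g \<in> carrier S"
      using S.A_carrier by (auto simp: mem_Times_iff)
  qed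
  have bF: "S.bounded_continuous (?F g)" if "g \<in> set gs" for g
    using S.bounded_continuous_left_translate[OF slice_bounded_continuous[OF f(1)]] gsD[OF that] h by simp
  have sumF: "S.bounded_continuous (\<lambda>s. \<Sum>g\<leftarrow>gs. ?F g s)"
    "S.weighted_integral (\<lambda>s. \<Sum>g\<leftarrow>gs. ?F g s) = (\<Sum>g\<leftarrow>gs. S.weighted_integral (?F g))"
    using S.bounded_continuous_sum_list[of gs ?F] bF by auto
  have le': "\<bar>\<phi> (h, s)\<bar> \<le> c * (\<Sum>g\<leftarrow>gs. ?F g s)" if "s \<in> carrier S" for s
    using le[of "(h, s)"] h that by (simp add: mult_DirProd')
  note b\<phi> = slice_bounded_continuous[OF \<phi> h]
  have "S.weighted_integral (\<lambda>s. \<phi> (h, s)) \<le> S.weighted_integral (\<lambda>s. c * (\<Sum>g\<leftarrow>gs. ?F g s))"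
    using le' by (intro S.weighted_integral_mono b\<phi> S.bounded_continuous_scale sumF(1)) (auto simp: abs_le_iff)
  moreover have "S.weighted_integral (\<lambda>s. - c * (\<Sum>g\<leftarrow>gs. ?F g s)) \<le> S.weighted_integral (\<lambda>s. \<phi> (h, s))"
  proof (rule S.weighted_integral_mono[OF S.bounded_continuous_scale[OF sumF(1)] b\<phi>])
    fix s assume "s \<in> carrier S"
    from abs_le_D2[OF le'[OF this]] show "- c * (\<Sum>g\<leftarrow>gs. ?F g s) \<le> \<phi> (h, s)" by simp
  qed
  ultimately have "\<bar>slice_integral \<phi> h\<bar> \<le> c * (\<Sum>g\<leftarrow>gs. S.weighted_integral (?F g))"
    using h unfolding S.weighted_integral_scale[OF sumF(1)] sumF(2) by (simp add: slice_integral_def abs_le_iff)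
  also have "\<dots> \<le> c * (\<Sum>g\<leftarrow>gs. 1 / r * slice_integral f (fst g \<otimes>\<^bsub>H\<^esub> h))"
  proof (intro mult_left_mono c sum_list_mono)
    fix g assume g: "g \<in> set gs"
    from slice_integral_left_translate[OF f gsD(1,2)[OF g] h]
    show "S.weighted_integral (?F g) \<le> 1 / r * slice_integral f (fst g \<otimes>\<^bsub>H\<^esub> h)"
      using S.r by (simp add: field_simps)
  qed
  also have "\<dots> = c / r * (\<Sum>a\<leftarrow>map fst gs. slice_integral f (a \<otimes>\<^bsub>H\<^esub> h))"
    unfolding sum_list_const_mult by (simp add: o_def)
  finally show ?thesis .
qed

text \<open>The functional is \<open>J\<close> on \<open>H\<close> applied to the slice integrals,
  with \<open>J\<close> normalised at the slice integral of \<open>f\<close>. Since \<open>D\<close>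
  depends on \<open>A\<close>, a translate of a member may leave it, so membership of the translate
  is assumed. The explicit bound is what later provides compactness.\<close>

lemma approximate_functional:
  assumes inv: "invariant_functionals H TH"
    and f: "ruc G T f" "\<And>x. x \<in> carrier G \<Longrightarrow> 0 \<le> f x"
    and x0: "h0 \<in> carrier H" "s0 \<in> A" "f (h0, s0) \<noteq> 0"
  defines "D \<equiv> {\<phi>. \<exists>c gs. witness f \<phi> c gs}"
  shows "\<exists>J. J f = 1 \<and>
     (\<forall>\<phi>\<in>D. \<forall>\<psi>\<in>D. J (\<lambda>x. \<phi> x + \<psi> x) = J \<phi> + J \<psi>) \<and>
     (\<forall>\<phi>\<in>D. \<forall>c. J (\<lambda>x. c * \<phi> x) = c * J \<phi>) \<and>
     (\<forall>\<phi>\<in>D. (\<forall>x\<in>carrier G. 0 \<le> \<phi> x) \<longrightarrow> 0 \<le> J \<phi>) \<and>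
     (\<forall>\<phi> c gs. witness f \<phi> c gs \<longrightarrow> \<bar>J \<phi>\<bar> \<le> c / r * real (length gs)) \<and>
     (\<forall>\<phi>\<in>D. \<forall>g\<in>carrier H \<times> A. left_translate G g \<phi> \<in> D \<longrightarrow> (\<forall>x\<in>carrier G. 0 \<le> \<phi> x) \<longrightarrow>
        r * J (left_translate G g \<phi>) \<le> J \<phi>)"
proof -
  let ?I = slice_integral
  have rI: "ruc H TH (?I f)" by (rule ruc_slice_integral[OF f(1)])
  have I_nonneg: "0 \<le> ?I f h" if "h \<in> carrier H" for h by (rule slice_integral_nonneg[OF f that])
  \<comment> \<open>As s0 lies in \<open>A\<close>, the weighted integral detects this positive
    value, so the slice integral of \<open>f\<close> is not identically zero.\<close>
  have "0 < f (h0, s0)" using f(2)[of "(h0, s0)"] x0 S.A_carrier by force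
  then have "0 < S.weighted_integral (\<lambda>s. f (h0, s))"
    using f(2) x0(1) by (intro S.weighted_integral_pos[OF slice_bounded_continuous[OF f(1) x0(1)] _ x0(2)]) auto
  then have "\<exists>h\<in>carrier H. ?I f h \<noteq> 0" using x0(1) by (intro bexI[of _ h0]) (auto simp: slice_integral_def)
  then obtain J where J: "positive_functional H TH (?I f) J" "left_invariant H TH (?I f) J" "J (?I f) = 1"
    using inv[unfolded invariant_functionals_def, rule_format, of "?I f"] rI I_nonneg by blast
  have wr: "ruc G T \<phi>" if "witness f \<phi> c gs" for \<phi> c gs using that by (simp add: witness_def)
  have ruc: "ruc G T \<phi>" if "\<phi> \<in> D" for \<phi> using that wr by (auto simp: D_def)
  have gsH: "set (map fst gs) \<subseteq> carrier H" "0 \<le> c / r" if "witness f \<phi> c gs" for \<phi> c gs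
    using that S.r by (auto simp: witness_def)
  have wI: "?I \<phi> \<in> dominated H TH (?I f)" if w: "witness f \<phi> c gs" for \<phi> c gs
    using ruc_slice_integral[OF wr[OF w]] slice_integral_bound[OF f w] gsH[OF w]
    unfolding dominated_def by blast
  have DI: "?I \<phi> \<in> dominated H TH (?I f)" if "\<phi> \<in> D" for \<phi>
    using that wI unfolding D_def by blast
  have LI: "left_translate H a \<phi> \<in> dominated H TH (?I f)" if "a \<in> carrier H" "\<phi> \<in> dominated H TH (?I f)" for a \<phi>
    by (rule dominated_left_translate[OF H.is_group H.topspace that(1) H.continuous_conjugation[OF that(1)] that(2)])
  show ?thesis
  proof (intro exI[of _ "\<lambda>\<phi>. J (?I \<phi>)"] conjI ballI allI impI)
    show "J (?I f) = 1" by (rule J(3))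
    show "J (?I (\<lambda>x. \<phi> x + \<psi> x)) = J (?I \<phi>) + J (?I \<psi>)" if "\<phi> \<in> D" "\<psi> \<in> D" for \<phi> \<psi>
      unfolding slice_integral_add[OF ruc[OF that(1)] ruc[OF that(2)]]
      by (rule positive_functional_add[OF J(1) DI[OF that(1)] DI[OF that(2)]])
    show "J (?I (\<lambda>x. c * \<phi> x)) = c * J (?I \<phi>)" if "\<phi> \<in> D" for \<phi> c
      unfolding slice_integral_scale[OF ruc[OF that]]
      by (rule positive_functional_scale[OF J(1) DI[OF that]])
    show "0 \<le> J (?I \<phi>)" if "\<phi> \<in> D" "\<forall>x\<in>carrier G. 0 \<le> \<phi> x" for \<phi>
      using that(2)
      by (intro positive_functional_nonneg[OF J(1) DI[OF that(1)]] slice_integral_nonneg[OF ruc[OF that(1)]]) auto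
    show "\<bar>J (?I \<phi>)\<bar> \<le> c / r * real (length gs)" if w: "witness f \<phi> c gs" for \<phi> c gs
    proof -
      have "\<bar>J (?I \<phi>)\<bar> \<le> c / r * (\<Sum>a\<leftarrow>map fst gs. J (left_translate H a (?I f)))"
        by (rule positive_functional_bound[OF H.is_group H.topspace H.continuous_conjugation rI I_nonneg J(1)
              ruc_slice_integral[OF wr[OF w]] gsH(2,1)[OF w] slice_integral_bound[OF f w]])
      \<comment> \<open>By invariance on \<open>H\<close> each summand is 1, so the bound merely
        counts translates.\<close>
      also have "(\<Sum>a\<leftarrow>map fst gs. J (left_translate H a (?I f))) = (\<Sum>a\<leftarrow>map fst gs. 1)"
        using gsH(1)[OF w] self_dominated[OF H.is_group rI I_nonneg] J(3)
        by (intro arg_cong[of _ _ sum_list] map_cong refl) (auto simp: left_invariantD[OF J(2)] subset_iff)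
      also have "\<dots> = real (length gs)" by (simp add: sum_list_triv)
      finally show ?thesis .
    qed
    fix \<phi> g assume \<phi>: "\<phi> \<in> D" and g: "g \<in> carrier H \<times> A" and L\<phi>: "left_translate G g \<phi> \<in> D"
      and nonneg: "\<forall>x\<in>carrier G. 0 \<le> \<phi> x"
    obtain a b where ab: "g = (a, b)" "a \<in> carrier H" "b \<in> A" "b \<in> carrier S" using g S.A_carrier by auto
    have "r * J (?I (left_translate G g \<phi>)) = J (\<lambda>h. r * ?I (left_translate G g \<phi>) h)"
      by (rule positive_functional_scale[OF J(1) DI[OF L\<phi>], symmetric])
    also have "\<dots> \<le> J (left_translate H a (?I \<phi>))"
    proof (rule positive_functional_mono[OF H.is_group J(1) I_nonneg dominated_scale[OF DI[OF L\<phi>]] LI[OF ab(2) DI[OF \<phi>]]])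
      fix h assume h: "h \<in> carrier H"
      have "S.weighted_integral (\<lambda>s. left_translate G g \<phi> (h, s)) =
          S.weighted_integral (\<lambda>s. \<phi> (a \<otimes>\<^bsub>H\<^esub> h, b \<otimes>\<^bsub>S\<^esub> s))"
        using h ab
        by (intro S.weighted_integral_cong slice_bounded_continuous[OF ruc[OF L\<phi>]]) (simp_all add: left_translate_def)
      then show "r * ?I (left_translate G g \<phi>) h \<le> left_translate H a (?I \<phi>) h"
        using slice_integral_left_translate[OF ruc[OF \<phi>] _ ab(2,3) h] nonneg h
        by (simp add: slice_integral_def[of "left_translate G g \<phi>"] left_translate_def[of H])
    qed
    also have "\<dots> = J (?I \<phi>)" by (rule left_invariantD[OF J(2) DI[OF \<phi>] ab(2)])
    finally show "r * J (?I (left_translate G g \<phi>)) \<le> J (?I \<phi>)" .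
  qed
qed

end

text \<open>The limit runs over pairs (B, r), with B a finite subset of \<open>S\<close> and r < 1.
  At each index the laws are imposed only where the functionals of
  \<open>approximate_functional\<close> obey them; directedness and a bound independent of the index
  then yield one functional satisfying all of them.\<close>

lemma invariant_functionals_product:
  fixes H :: "('h, 'b) monoid_scheme" and TH :: "'h topology"
    and S :: "('s, 'c) monoid_scheme" and TS :: "'s topology"
  assumes H: "topological_group H TH" and inv: "invariant_functionals H TH"
    and S: "locally_compact_group S TS" and growth: "subexponential_growth S TS"
  shows "invariant_functionals (H \<times>\<times> S) (prod_topology TH TS)"
  unfolding invariant_functionals_def
proof (intro allI impI, elim conjE)
  let ?G = "H \<times>\<times> S" and ?T = "prod_topology TH TS"
  have tS: "topological_group S TS" and hS: "Hausdorff_space TS" and lS: "locally_compact_space TS"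
    using S by (auto simp: locally_compact_group_def)
  have gH: "group H" and gS: "group S" using H tS by (auto simp: topological_group_def)
  have tG: "topological_group ?G ?T" by (rule topological_group_DirProd[OF H tS])
  have gG: "group ?G" by (rule DirProd_group[OF gH gS])
  interpret H: topological_group_on H TH
    by (intro topological_group_on.intro topological_group_on_axioms.intro H gH)
  interpret S: topological_group_on S TS
    by (intro topological_group_on.intro topological_group_on_axioms.intro tS gS)
  interpret G: topological_group_on ?G ?T
    by (intro topological_group_on.intro topological_group_on_axioms.intro tG gG)
  obtain m where m: "left_haar_measure S TS m"
    "\<And>A. compactin TS A \<and> (\<exists>U. openin TS U \<and> \<one>\<^bsub>S\<^esub> \<in> U \<and> U \<subseteq> A) \<Longrightarrow>
      (\<lambda>n. root n (measure m (set_power S A n))) \<longlonglongrightarrow> 1"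
    using growth unfolding subexponential_growth_def by blast
  obtain U K where UK: "openin TS U" "compactin TS K" "\<one>\<^bsub>S\<^esub> \<in> U" "U \<subseteq> K"
    using lS S.one_closed unfolding locally_compact_space_def S.topspace by blast
  fix f assume f: "ruc ?G ?T f" and "\<forall>x\<in>carrier ?G. 0 \<le> f x" "\<exists>x\<in>carrier ?G. f x \<noteq> 0"
  then obtain h0 s0 where x0: "h0 \<in> carrier H" "s0 \<in> carrier S" "f (h0, s0) \<noteq> 0"
    and nonneg: "\<And>x. x \<in> carrier ?G \<Longrightarrow> 0 \<le> f x" by auto
  let ?D = "dominated ?G ?T f" and ?L = "left_translate ?G"
  have f_D: "f \<in> ?D" by (rule self_dominated[OF gG f nonneg])
  have LD: "?L g \<phi> \<in> ?D" if "g \<in> carrier ?G" "\<phi> \<in> ?D" for g \<phi>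
    by (rule dominated_left_translate[OF gG G.topspace that(1) G.continuous_conjugation[OF that(1)] that(2)])
  \<comment> \<open>One witness is fixed for each function once and for all, so that the bound
    \<open>b\<close> does not depend on the index.\<close>
  have "\<forall>\<phi>\<in>?D. \<exists>w. 0 \<le> fst w \<and> set (snd w) \<subseteq> carrier ?G \<and>
      (\<forall>x\<in>carrier ?G. \<bar>\<phi> x\<bar> \<le> fst w * (\<Sum>g\<leftarrow>snd w. f (g \<otimes>\<^bsub>?G\<^esub> x)))"
    unfolding dominated_def by simp
  from bchoice[OF this] obtain w where w: "\<And>\<phi>. \<phi> \<in> ?D \<Longrightarrow> 0 \<le> fst (w \<phi>) \<and> set (snd (w \<phi>)) \<subseteq> carrier ?G \<and>
      (\<forall>x\<in>carrier ?G. \<bar>\<phi> x\<bar> \<le> fst (w \<phi>) * (\<Sum>g\<leftarrow>snd (w \<phi>). f (g \<otimes>\<^bsub>?G\<^esub> x)))"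
    by blast
  define good where "good B = {\<phi> \<in> ?D. snd ` set (snd (w \<phi>)) \<subseteq> B}" for B
  have good_mono: "good B \<subseteq> good B'" if "B \<subseteq> B'" for B B' using that by (auto simp: good_def)
  have good_fin: "finite (snd ` set (snd (w \<phi>)))" "snd ` set (snd (w \<phi>)) \<subseteq> carrier S" if "\<phi> \<in> ?D" for \<phi>
    using w[OF that] by auto
  \<comment> \<open>The point s0 keeps the slice integral of \<open>f\<close> non-zero, and the
    components of the witness of \<open>f\<close> make \<open>f\<close> good at every index.\<close>
  define B0 where "B0 = insert s0 (snd ` set (snd (w f)))"
  have B0: "finite B0" "B0 \<subseteq> carrier S" "s0 \<in> B0" using good_fin[OF f_D] x0 by (auto simp: B0_def)
  \<comment> \<open>From r \<ge> 1/2 one gets c/r \<le> 2 c, hence the factor 2 in the common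
    bound.\<close>
  define I where "I = {(B, r :: real). finite B \<and> B0 \<subseteq> B \<and> B \<subseteq> carrier S \<and> 1/2 \<le> r \<and> r < 1}"
  define b where "b \<phi> = (if \<phi> \<in> ?D then 2 * fst (w \<phi>) * real (length (snd (w \<phi>))) else 0)" for \<phi>
  \<comment> \<open>The sum must be required to be good as well, because its chosen witness is
    unrelated to those of the summands.\<close>
  define adds where "adds B J \<longleftrightarrow> (\<forall>\<phi> \<psi>. \<phi> \<in> good B \<and> \<psi> \<in> good B \<and> (\<lambda>x. \<phi> x + \<psi> x) \<in> good B \<longrightarrow>
      J (\<lambda>x. \<phi> x + \<psi> x) = J \<phi> + J \<psi>)" for B and J :: "('h \<times> 's \<Rightarrow> real) \<Rightarrow> real"
  define scales where "scales B J \<longleftrightarrow> (\<forall>\<phi> c. \<phi> \<in> good B \<and> (\<lambda>x. c * \<phi> x) \<in> good B \<longrightarrow>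
      J (\<lambda>x. c * \<phi> x) = c * J \<phi>)" for B and J :: "('h \<times> 's \<Rightarrow> real) \<Rightarrow> real"
  define posit where "posit B J \<longleftrightarrow> (\<forall>\<phi>. \<phi> \<in> good B \<and> (\<forall>x\<in>carrier ?G. 0 \<le> \<phi> x) \<longrightarrow> 0 \<le> J \<phi>)"
    for B and J :: "('h \<times> 's \<Rightarrow> real) \<Rightarrow> real"
  define quasi where "quasi B r J \<longleftrightarrow> (\<forall>\<phi> g. \<phi> \<in> good B \<and> (\<forall>x\<in>carrier ?G. 0 \<le> \<phi> x) \<and>
      g \<in> carrier H \<times> B \<and> ?L g \<phi> \<in> good B \<longrightarrow> r * J (?L g \<phi>) \<le> J \<phi>)"
    for B and r :: real and J :: "('h \<times> 's \<Rightarrow> real) \<Rightarrow> real"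
  define Z where "Z = (\<lambda>(B, r). {J. (\<forall>\<phi>. \<bar>J \<phi>\<bar> \<le> b \<phi>) \<and> J f = 1 \<and> adds B J \<and> scales B J \<and> posit B J \<and> quasi B r J})"
  have "\<exists>J. \<forall>i\<in>I. J \<in> Z i"
  proof (rule directed_bounded_functions_Inter)
    have "(B0, 1/2) \<in> I" using B0 by (simp add: I_def)
    then show "I \<noteq> {}" by blast
  next
    fix i assume "i \<in> I"
    obtain B r where i: "i = (B, r)" by (cases i)
    have cont: "continuous_on UNIV (\<lambda>J. J \<phi>)" for \<phi> :: "'h \<times> 's \<Rightarrow> real"
      by (rule continuous_on_product_coordinates)
    have "closed {J. adds B J}" "closed {J. scales B J}" "closed {J. posit B J}" "closed {J. quasi B r J}"
      unfolding adds_def scales_def posit_def quasi_def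
      by (intro closed_Collect_all closed_Collect_imp open_Collect_const closed_Collect_eq closed_Collect_le
          continuous_on_add continuous_on_mult continuous_on_const cont)+
    moreover have "closed {J. \<forall>\<phi>. \<bar>J \<phi>\<bar> \<le> b \<phi>}"
      by (intro closed_Collect_all closed_Collect_le continuous_on_rabs continuous_on_const cont)
    moreover have "closed {J :: ('h \<times> 's \<Rightarrow> real) \<Rightarrow> real. J f = 1}"
      by (rule closed_Collect_eq[OF cont continuous_on_const])
    ultimately show "closed (Z i)"
      unfolding Z_def i prod.case by (intro closed_Collect_conj)
  next
    fix i J \<phi> assume "i \<in> I" "J \<in> Z i"
    then show "\<bar>J \<phi>\<bar> \<le> b \<phi>" by (cases i) (simp add: Z_def)
  next
    fix i j assume "i \<in> I" "j \<in> I"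
    obtain B r B' r' where ij: "i = (B, r)" "j = (B', r')" by (cases i, cases j)
    \<comment> \<open>Lowering t weakens quasi-invariance because, by \<open>posit\<close>, the
      value at the translate is non-negative.\<close>
    have mono: "Z (C, t) \<subseteq> Z (C', t')" if C: "C' \<subseteq> C" and CS: "C' \<subseteq> carrier S" and t: "t' \<le> t" for C C' t t'
    proof
      fix J assume "J \<in> Z (C, t)"
      then have J: "\<forall>\<phi>. \<bar>J \<phi>\<bar> \<le> b \<phi>" "J f = 1" "adds C J" "scales C J" "posit C J" "quasi C t J"
        by (auto simp: Z_def)
      have g: "\<phi> \<in> good C" if "\<phi> \<in> good C'" for \<phi> using good_mono[OF C] that by blast
      have "adds C' J" using J(3) g unfolding adds_def by simp
      moreover have "scales C' J" using J(4) g unfolding scales_def by simp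
      moreover have "posit C' J" using J(5) g unfolding posit_def by simp
      moreover have "quasi C' t' J"
        unfolding quasi_def
      proof (intro allI impI, elim conjE)
        fix \<phi> x assume \<phi>: "\<phi> \<in> good C'" "\<forall>x\<in>carrier ?G. 0 \<le> \<phi> x" "?L x \<phi> \<in> good C'" "x \<in> carrier H \<times> C'"
        have x: "x \<in> carrier ?G" "x \<in> carrier H \<times> C" using \<phi>(4) C CS by auto
        have *: "t * J (?L x \<phi>) \<le> J \<phi>"
          using J(6) g[OF \<phi>(1)] g[OF \<phi>(3)] \<phi>(2) x(2) unfolding quasi_def by blast
        have "0 \<le> ?L x \<phi> y" if "y \<in> carrier ?G" for y
          using bspec[OF \<phi>(2) G.m_closed[OF x(1) that]] that by (simp only: left_translate_def if_True)
        then have "0 \<le> J (?L x \<phi>)" using J(5) g[OF \<phi>(3)] unfolding posit_def by blast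
        then have "t' * J (?L x \<phi>) \<le> t * J (?L x \<phi>)" using t by (rule mult_right_mono[rotated])
        with * show "t' * J (?L x \<phi>) \<le> J \<phi>" by linarith
      qed
      ultimately show "J \<in> Z (C', t')" using J(1,2) by (simp add: Z_def)
    qed
    show "\<exists>k\<in>I. Z k \<subseteq> Z i \<inter> Z j"
    proof (intro bexI[of _ "(B \<union> B', max r r')"])
      show "Z (B \<union> B', max r r') \<subseteq> Z i \<inter> Z j" 
        using \<open>i \<in> I\<close> \<open>j \<in> I\<close> unfolding ij by (intro Int_greatest mono) (auto simp: I_def)
      show "(B \<union> B', max r r') \<in> I" using \<open>i \<in> I\<close> \<open>j \<in> I\<close> unfolding ij by (auto simp: I_def)
    qed
  next
    fix i assume "i \<in> I"
    obtain B r where i: "i = (B, r)" by (cases i)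
    have B: "finite B" "B0 \<subseteq> B" "B \<subseteq> carrier S" and r: "1/2 \<le> r" "r < 1"
      using \<open>i \<in> I\<close> unfolding i by (auto simp: I_def)
    \<comment> \<open>\<open>K\<close> makes this a neighbourhood of the unit and \<open>B\<close>
      brings in the translating elements; the union is compact.\<close>
    define A where "A = K \<union> B"
    have A: "compactin TS A" "\<exists>U. openin TS U \<and> \<one>\<^bsub>S\<^esub> \<in> U \<and> U \<subseteq> A"
    proof -
      show "compactin TS A"
        unfolding A_def using B
        by (intro compactin_Un[OF UK(2)] finite_imp_compactin) (simp_all add: S.topspace)
      show "\<exists>U. openin TS U \<and> \<one>\<^bsub>S\<^esub> \<in> U \<and> U \<subseteq> A" using UK by (auto simp: A_def)
    qed
    interpret slices H TH S TS m A r
    proof unfold_locales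
      show "left_haar_measure S TS m" by (rule m(1))
      show "Hausdorff_space TS" by (rule hS)
      show "compactin TS A" "\<exists>U. openin TS U \<and> \<one>\<^bsub>S\<^esub> \<in> U \<and> U \<subseteq> A" by (rule A)+
      show "(\<lambda>n. root n (measure m (set_power S A n))) \<longlonglongrightarrow> 1" using m(2) A by blast
      show "0 < r" "r < 1" using r by auto
    qed
    have wit: "witness f \<phi> (fst (w \<phi>)) (snd (w \<phi>))" if "\<phi> \<in> good B" for \<phi>
    proof -
      have D: "\<phi> \<in> ?D" and s: "snd ` set (snd (w \<phi>)) \<subseteq> B" using that by (auto simp: good_def)
      have "set (snd (w \<phi>)) \<subseteq> carrier H \<times> A"
      proof
        fix x assume x: "x \<in> set (snd (w \<phi>))"
        then have "snd x \<in> A" using s by (auto simp: A_def)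
        moreover have "x \<in> carrier ?G" using x w[OF D] by blast
        ultimately show "x \<in> carrier H \<times> A" by (auto simp: mem_Times_iff)
      qed
      with w[OF D] D show ?thesis by (simp add: witness_def dominated_def)
    qed
    have s0A: "s0 \<in> A" using B0 B by (auto simp: A_def)
    obtain J where J: "J f = 1"
      "\<forall>\<phi>\<in>{\<phi>. \<exists>c gs. witness f \<phi> c gs}. \<forall>\<psi>\<in>{\<phi>. \<exists>c gs. witness f \<phi> c gs}. J (\<lambda>x. \<phi> x + \<psi> x) = J \<phi> + J \<psi>"
      "\<forall>\<phi>\<in>{\<phi>. \<exists>c gs. witness f \<phi> c gs}. \<forall>c. J (\<lambda>x. c * \<phi> x) = c * J \<phi>"
      "\<forall>\<phi>\<in>{\<phi>. \<exists>c gs. witness f \<phi> c gs}. (\<forall>x\<in>carrier ?G. 0 \<le> \<phi> x) \<longrightarrow> 0 \<le> J \<phi>"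
      "\<forall>\<phi> c gs. witness f \<phi> c gs \<longrightarrow> \<bar>J \<phi>\<bar> \<le> c / r * real (length gs)"
      "\<forall>\<phi>\<in>{\<phi>. \<exists>c gs. witness f \<phi> c gs}. \<forall>g\<in>carrier H \<times> A. ?L g \<phi> \<in> {\<phi>. \<exists>c gs. witness f \<phi> c gs} \<longrightarrow>
        (\<forall>x\<in>carrier ?G. 0 \<le> \<phi> x) \<longrightarrow> r * J (?L g \<phi>) \<le> J \<phi>"
      using approximate_functional[OF inv f nonneg x0(1) s0A x0(3)] by auto
    have W: "\<phi> \<in> {\<phi>. \<exists>c gs. witness f \<phi> c gs}" if "\<phi> \<in> good B" for \<phi> using wit[OF that] by blast
    \<comment> \<open>Off the good functions no estimate is at hand; the value 0 satisfies the bound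
      everywhere.\<close>
    define J' where "J' \<phi> = (if \<phi> \<in> good B then J \<phi> else 0)" for \<phi>
    have "\<bar>J' \<phi>\<bar> \<le> b \<phi>" for \<phi>
    proof (cases "\<phi> \<in> good B")
      case True
      then have D: "\<phi> \<in> ?D" by (simp add: good_def)
      let ?c = "fst (w \<phi>)" and ?n = "real (length (snd (w \<phi>)))"
      have "\<bar>J \<phi>\<bar> \<le> ?c / r * ?n" using J(5) wit[OF True] by blast
      also have "?c / r \<le> 2 * ?c"
      proof -
        have "?c * 1 \<le> ?c * (2 * r)" using w[OF D] r by (intro mult_left_mono) auto
        then show ?thesis using r by (simp add: field_simps)
      qed
      then have "?c / r * ?n \<le> 2 * ?c * ?n" by (intro mult_right_mono) auto
      finally show ?thesis using True D by (simp add: J'_def b_def)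
    next
      case False
      then show ?thesis using w[of \<phi>] by (simp add: J'_def b_def)
    qed
    moreover have "J' f = 1"
    proof -
      have "f \<in> good B" using f_D B(2) by (auto simp: good_def B0_def)
      then show ?thesis using J(1) by (simp add: J'_def)
    qed
    moreover have "adds B J'" using J(2) W unfolding adds_def J'_def by simp
    moreover have "scales B J'" using J(3) W unfolding scales_def J'_def by simp
    moreover have "posit B J'" using J(4) W unfolding posit_def J'_def by simp
    moreover have "quasi B r J'"
      unfolding quasi_def
    proof (intro allI impI, elim conjE)
      fix \<phi> g assume \<phi>: "\<phi> \<in> good B" "\<forall>x\<in>carrier ?G. 0 \<le> \<phi> x" "?L g \<phi> \<in> good B" "g \<in> carrier H \<times> B"
      have "g \<in> carrier H \<times> A" using \<phi>(4) by (auto simp: A_def)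
      from J(6)[rule_format, OF W[OF \<phi>(1)] this W[OF \<phi>(3)]] \<phi>(2)
      show "r * J' (?L g \<phi>) \<le> J' \<phi>" using \<phi>(1,3) by (simp add: J'_def)
    qed
    ultimately have "J' \<in> Z i" unfolding Z_def i by simp
    then show "Z i \<noteq> {}" by blast
  qed
  then obtain J where JZ: "\<And>i. i \<in> I \<Longrightarrow> J \<in> Z i" by blast
  have J: "J f = 1 \<and> adds B J \<and> scales B J \<and> posit B J \<and> quasi B r J"
    if "finite B" "B0 \<subseteq> B" "B \<subseteq> carrier S" "1/2 \<le> r" "r < 1" for B r
    using JZ[of "(B, r)"] that by (simp add: I_def Z_def)
  let ?s = "\<lambda>\<phi>. snd ` set (snd (w \<phi>))"
  have pos: "positive_functional ?G ?T f J"
    unfolding positive_functional_def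
  proof (intro conjI ballI allI impI)
    fix \<phi> assume \<phi>: "\<phi> \<in> ?D"
    show "J (\<lambda>x. \<phi> x + \<psi> x) = J \<phi> + J \<psi>" if \<psi>: "\<psi> \<in> ?D" for \<psi>
    proof -
      have sum: "(\<lambda>x. \<phi> x + \<psi> x) \<in> ?D" by (rule dominated_add[OF gG nonneg \<phi> \<psi>])
      \<comment> \<open>The index is enlarged until the witnesses of all functions concerned fit.
        The law does not involve r, so its least value is taken.\<close>
      let ?B = "B0 \<union> ?s \<phi> \<union> ?s \<psi> \<union> ?s (\<lambda>x. \<phi> x + \<psi> x)"
      have "adds ?B J"
        using J[of ?B "1/2"] B0 good_fin[OF \<phi>] good_fin[OF \<psi>] good_fin[OF sum] by auto
      moreover have "\<phi> \<in> good ?B" "\<psi> \<in> good ?B" "(\<lambda>x. \<phi> x + \<psi> x) \<in> good ?B"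
        using \<phi> \<psi> sum by (auto simp: good_def)
      ultimately show ?thesis unfolding adds_def by blast
    qed
    show "J (\<lambda>x. c * \<phi> x) = c * J \<phi>" for c
    proof -
      have c: "(\<lambda>x. c * \<phi> x) \<in> ?D" by (rule dominated_scale[OF \<phi>])
      let ?B = "B0 \<union> ?s \<phi> \<union> ?s (\<lambda>x. c * \<phi> x)"
      have "scales ?B J" using J[of ?B "1/2"] B0 good_fin[OF \<phi>] good_fin[OF c] by auto
      moreover have "\<phi> \<in> good ?B" "(\<lambda>x. c * \<phi> x) \<in> good ?B" using \<phi> c by (auto simp: good_def)
      ultimately show ?thesis unfolding scales_def by blast
    qed
    show "0 \<le> J \<phi>" if nn: "\<forall>x\<in>carrier ?G. 0 \<le> \<phi> x"
    proof -
      let ?B = "B0 \<union> ?s \<phi>"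
      have "posit ?B J" using J[of ?B "1/2"] B0 good_fin[OF \<phi>] by auto
      moreover have "\<phi> \<in> good ?B" using \<phi> by (auto simp: good_def)
      ultimately show ?thesis using nn unfolding posit_def by blast
    qed
  qed
  moreover have "left_invariant ?G ?T f J"
  proof (rule left_invariantI[OF gG G.topspace G.continuous_conjugation f nonneg pos])
    fix \<phi> g assume \<phi>: "\<phi> \<in> ?D" and nn: "\<And>x. x \<in> carrier ?G \<Longrightarrow> 0 \<le> \<phi> x" and g: "g \<in> carrier ?G"
    note L\<phi> = LD[OF g \<phi>]
    \<comment> \<open>Besides the two witnesses the index must contain the
      \<open>S\<close>-component of g. It does not depend on r, so r may tend to 1 with \<phi> and g
      fixed.\<close>
    let ?B = "B0 \<union> ?s \<phi> \<union> ?s (?L g \<phi>) \<union> {snd g}"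
    have "r * J (?L g \<phi>) \<le> J \<phi>" if "1/2 \<le> r" "r < 1" for r
    proof -
      have "finite ?B" "B0 \<subseteq> ?B" "?B \<subseteq> carrier S"
        using B0 good_fin[OF \<phi>] good_fin[OF L\<phi>] g by auto
      from J[OF this that] have q: "quasi ?B r J" by blast
      have "\<phi> \<in> good ?B \<and> (\<forall>x\<in>carrier ?G. 0 \<le> \<phi> x) \<and> g \<in> carrier H \<times> ?B \<and> ?L g \<phi> \<in> good ?B"
        using \<phi> L\<phi> g nn by (auto simp: good_def)
      from mp[OF spec[OF spec[OF q[unfolded quasi_def]]] this] show ?thesis .
    qed
    moreover have "((\<lambda>r. r * J (?L g \<phi>)) \<longlongrightarrow> 1 * J (?L g \<phi>)) (at_left 1)"
      by (intro tendsto_intros)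
    moreover have "\<forall>\<^sub>F r in at_left 1. (1/2 :: real) \<le> r \<and> r < 1"
      unfolding eventually_at_left_field by (intro exI[of _ "1/2"]) auto
    ultimately have "1 * J (?L g \<phi>) \<le> J \<phi>"
      by (intro tendsto_upperbound) (auto elim: eventually_mono)
    then show "J (?L g \<phi>) \<le> J \<phi>" by simp
  qed
  moreover have "J f = 1" using J[of B0 "1/2"] B0 by simp
  ultimately show "\<exists>J. positive_functional ?G ?T f J \<and> left_invariant ?G ?T f J \<and> J f = 1" by blast
qed

lemma fixed_point_property_product:
  fixes H :: "('h, 'b) monoid_scheme" and TH :: "'h topology"
    and S :: "('s, 'c) monoid_scheme" and TS :: "'s topology"
  assumes H: "topological_group H TH"
    and fpp: "fixed_point_property_for_cones TYPE(('h \<Rightarrow> real) \<Rightarrow> real) H TH"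
    and S: "locally_compact_group S TS" and growth: "subexponential_growth S TS"
  shows "fixed_point_property_for_cones TYPE('e::real_vector) (H \<times>\<times> S) (prod_topology TH TS)"
proof -
  have tS: "topological_group S TS" using S by (simp add: locally_compact_group_def)
  have gH: "group H" and gS: "group S" using H tS by (auto simp: topological_group_def)
  interpret H: topological_group_on H TH
    by (intro topological_group_on.intro topological_group_on_axioms.intro H gH)
  have "topspace (prod_topology TH TS) = carrier (H \<times>\<times> S)"
    using H tS by (simp add: topological_group_def)
  moreover have "invariant_functionals H TH"
    by (rule fixed_point_property_imp_invariant_functionals[OF gH H.topspace H.continuous_conjugation fpp])
  ultimately show ?thesis
    by (intro invariant_functionals_imp_fixed_point_property DirProd_group gH gS
        invariant_functionals_product H S growth)
qed

theorem theorem12: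
  fixes H :: "('h, 'b) monoid_scheme" and TH :: "'h topology"
    and S :: "('s, 'c) monoid_scheme" and TS :: "'s topology"
    and G :: "('g, 'd) monoid_scheme" and TG :: "'g topology"
    and N :: "'g set"
  shows
    "(locally_compact_group H TH \<and> locally_compact_group S TS \<and>
      fixed_point_property_for_cones TYPE(('h \<Rightarrow> real) \<Rightarrow> real) H TH \<and>
      subexponential_growth S TS \<longrightarrow>
        fixed_point_property_for_cones TYPE('e::real_vector) (H \<times>\<times> S) (prod_topology TH TS))
     \<and>
     (locally_compact_group G TG \<and> N \<lhd> G \<and> compactin TG N \<and>
      fixed_point_property_for_cones TYPE(('g set \<Rightarrow> real) \<Rightarrow> real) (G Mod N) (coset_topology G TG N) \<longrightarrow>
        fixed_point_property_for_cones TYPE('e) G TG)"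
  by (intro conjI impI; elim conjE)
    (auto simp: locally_compact_group_def intro: fixed_point_property_product fixed_point_property_extension)

end
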